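(* Let $B$ be an abelian complex C*-algebra with a computable presentation. Let $A$ be the subset of self-adjoint elements of $B$. Then $A$ is a real C*-algebra, and any computable presentation of $A$ induces a computable presentation of $B$ (namely, if $(A,(x_n)_{n\in\mathbb{N}})$ is a computable presentation of the real C*-algebra $A$, then $(B,(x_n)_{n\in\mathbb{N}})$ is a computable presentation of the complex C*-algebra $B$). Furthermore, the following are equivalent: (a) $B$ is computably categorical as a complex C*-algebra; (b) $A$ is computably categorical as a real C*-algebra; (c) $A$ is computably categorical as a real Banach algebra.
   Context: Let $\mathbb{K}\in\{\mathbb{R},\mathbb{C}\}$. A C*-algebra over $\mathbb{K}$ is a Banach *-algebra over $\mathbb{K}$ (not necessarily unital) that is isometrically *-isomorphic to a norm-closed *-subalgebra of the bounded operators on a Hilbert space over $\mathbb{K}$; "real" and "complex" C*-algebra mean over $\mathbb{R}$ and over $\mathbb{C}$. *-homomorphisms are $\mathbb{K}$-linear. $A$ carries the operations and norm induced from $B$. A presentation $A^\dagger=(A,\overline{a})$ of a separable C*-algebra $A$ over $\mathbb{K}$ consists of $A$ and a countable (finite or infinite) sequence $\overline{a}$ of elements (the special points) generating $A$ as a C*-algebra over $\mathbb{K}$. A polynomial is rational if its coefficients lie in $\mathbb{Q}$ (when $\mathbb{K}=\mathbb{R}$) or $\mathbb{Q}(i)$ (when $\mathbb{K}=\mathbb{C}$). A rational point of $A^\dagger$ is an element $p(a_{i_1},\ldots,a_{i_n})$ with $p$ a rational noncommutative *-polynomial with no constant term (as input to an algorithm it is given by $p$ and the indices). $A^\dagger$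 is computable if there is an effective procedure which, given a rational point $r$ and $k\in\mathbb{N}$, returns $q\in\mathbb{Q}$ with $|\|r\|-q|<2^{-k}$. For computable presentations $A^\dagger$, $B^\dagger$ of $A$, $B$, a *-homomorphism $\varphi:A\to B$ is computable from $A^\dagger$ to $B^\dagger$ if there is an effective procedure which, given a rational point $r$ of $A^\dagger$ and $k\in\mathbb{N}$, returns a rational point $s$ of $B^\dagger$ with $\|\varphi(r)-s\|<2^{-k}$. A computable isomorphism is a bijective computable *-homomorphism. $A$ is computably categorical (as a C*-algebra over $\mathbb{K}$) if for all computable presentations $A^\dagger$, $A^+$ of $A$ there is a computable isomorphism from $A^\dagger$ to $A^+$. The corresponding notions for real Banach algebras are obtained by dropping the involution: special points generate $A$ as a real Banach algebra, rational points are given by rational polynomials (without * ) with no constant term, and isomorphisms are isometric real algebra isomorphisms. *)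

theory Defs
  imports
    "HOL-Analysis.Analysis"
    "HOL-Library.Nat_Bijection"
    "HOL-Library.Extended_Nat"
    "HOL-Library.Function_Algebras"
begin

section \<open>Partial recursive functions\<close>

datatype recf =
    Zero
  | Succ
  | Proj nat
  | Comp recf "recf list"
  | PrimRec recf recf
  | Mu recf

text \<open>
  \<open>computes e xs y\<close>: the program \<open>e\<close> halts on the argument list \<open>xs\<close> with output \<open>y\<close>.
  In \<open>PrimRec\<close> and \<open>Mu\<close> the recursion (search) variable is the head of the list.
\<close>

inductive computes :: "recf \<Rightarrow> nat list \<Rightarrow> nat \<Rightarrow> bool" where
  computes_Zero: "computes Zero xs 0"
| computes_Succ: "computes Succ [x] (Suc x)"
| computes_Proj: "i < length xs \<Longrightarrow> computes (Proj i) xs (xs ! i)"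
| computes_Comp: "list_all2 (\<lambda>g y. computes g xs y) gs ys \<Longrightarrow> computes f ys z
    \<Longrightarrow> computes (Comp f gs) xs z"
| computes_PrimRec_0: "computes f xs z \<Longrightarrow> computes (PrimRec f g) (0 # xs) z"
| computes_PrimRec_Suc: "computes (PrimRec f g) (n # xs) y \<Longrightarrow> computes g (n # y # xs) z
    \<Longrightarrow> computes (PrimRec f g) (Suc n # xs) z"
| computes_Mu: "computes f (n # xs) 0 \<Longrightarrow> (\<forall>i<n. \<exists>y. computes f (i # xs) (Suc y))
    \<Longrightarrow> computes (Mu f) xs n"


section \<open>Scalars\<close>

text \<open>
  The scalar field \<open>\<bbbK>\<close> is a type \<open>'k\<close> of the following class, whose only instances are
  \<^typ>\<open>real\<close> and \<^typ>\<open>complex\<close>.  The function \<open>scalar_of_code\<close> is a numbering of the rational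
  scalars, that is of \<open>\<rat>\<close> and of \<open>\<rat>(i)\<close> respectively.
\<close>

class rc_field = real_normed_field +
  fixes scalar_cnj :: "'a \<Rightarrow> 'a"
    and scalar_of_code :: "nat \<Rightarrow> 'a"

definition rat_of_code :: "nat \<Rightarrow> real" where
  "rat_of_code n = (case prod_decode n of (p, q) \<Rightarrow> of_int (int_decode p) / of_nat (Suc q))"

lemma range_rat_of_code: "range rat_of_code = \<rat>"
proof
  show "range rat_of_code \<subseteq> \<rat>"
    by (auto simp: rat_of_code_def split: prod.splits)
  show "\<rat> \<subseteq> range rat_of_code"
  proof
    fix x :: real assume "x \<in> \<rat>"
    then obtain p q :: int where "q > 0" "x = of_int p / of_int q"
      by (rule Rats_cases')
    then have "rat_of_code (prod_encode (int_encode p, nat q - 1)) = x"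
      by (simp add: rat_of_code_def)
    then show "x \<in> range rat_of_code"
      by blast
  qed
qed

instantiation real :: rc_field
begin

definition scalar_cnj_real :: "real \<Rightarrow> real" where
  "scalar_cnj_real x = x"

definition scalar_of_code_real :: "nat \<Rightarrow> real" where
  "scalar_of_code_real n = rat_of_code n"

instance ..

end

instantiation complex :: rc_field
begin

definition scalar_cnj_complex :: "complex \<Rightarrow> complex" where
  "scalar_cnj_complex z = cnj z"

definition scalar_of_code_complex :: "nat \<Rightarrow> complex" where
  "scalar_of_code_complex n =
     (case prod_decode n of (p, q) \<Rightarrow> Complex (rat_of_code p) (rat_of_code q))"

instance ..

end


section \<open>Vector spaces and Hilbert spaces on a carrier set\<close>

definition subspace_on :: "('k \<Rightarrow> 'v::ab_group_add \<Rightarrow> 'v) \<Rightarrow> 'v set \<Rightarrow> bool" where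
  "subspace_on sc V \<longleftrightarrow>
     0 \<in> V \<and> (\<forall>x\<in>V. \<forall>y\<in>V. x + y \<in> V) \<and> (\<forall>c. \<forall>x\<in>V. sc c x \<in> V)"

locale vspace_on =
  fixes V :: "'v::ab_group_add set"
    and sc :: "'k::field \<Rightarrow> 'v \<Rightarrow> 'v"
  assumes subspace: "subspace_on sc V"
    and sc_right_distrib: "x \<in> V \<Longrightarrow> y \<in> V \<Longrightarrow> sc c (x + y) = sc c x + sc c y"
    and sc_left_distrib: "x \<in> V \<Longrightarrow> sc (c + d) x = sc c x + sc d x"
    and sc_sc: "x \<in> V \<Longrightarrow> sc c (sc d x) = sc (c * d) x"
    and sc_one: "x \<in> V \<Longrightarrow> sc 1 x = x"

definition hnorm :: "('h \<Rightarrow> 'h \<Rightarrow> 'k::rc_field) \<Rightarrow> 'h \<Rightarrow> real" where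
  "hnorm ip x = sqrt (norm (ip x x))"

locale hilbert_space = vspace_on H sc
  for H :: "'h::ab_group_add set" and sc :: "'k::rc_field \<Rightarrow> 'h \<Rightarrow> 'h" +
  fixes ip :: "'h \<Rightarrow> 'h \<Rightarrow> 'k"
  assumes ip_add: "x \<in> H \<Longrightarrow> y \<in> H \<Longrightarrow> z \<in> H \<Longrightarrow> ip (x + y) z = ip x z + ip y z"
    and ip_scale: "x \<in> H \<Longrightarrow> y \<in> H \<Longrightarrow> ip (sc c x) y = c * ip x y"
    and ip_cnj: "x \<in> H \<Longrightarrow> y \<in> H \<Longrightarrow> ip y x = scalar_cnj (ip x y)"
    and ip_pos: "x \<in> H \<Longrightarrow> x \<noteq> 0 \<Longrightarrow> \<exists>r>0. ip x x = of_real r"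
    and complete_H: "(\<And>n. X n \<in> H) \<Longrightarrow>
          (\<And>e. e > 0 \<Longrightarrow> \<exists>N. \<forall>m\<ge>N. \<forall>n\<ge>N. hnorm ip (X m - X n) < e) \<Longrightarrow>
          \<exists>l\<in>H. (\<lambda>n::nat. hnorm ip (X n - l)) \<longlonglongrightarrow> 0"

text \<open>Operators on \<open>H\<close> are functions on the ambient type, set to \<open>0\<close> outside \<open>H\<close>.\<close>

definition bounded_operators ::
  "'h::ab_group_add set \<Rightarrow> ('k::rc_field \<Rightarrow> 'h \<Rightarrow> 'h) \<Rightarrow> ('h \<Rightarrow> 'h \<Rightarrow> 'k) \<Rightarrow> ('h \<Rightarrow> 'h) set" where
  "bounded_operators H sc ip = {T.
     (\<forall>x\<in>H. T x \<in> H) \<and> (\<forall>x. x \<notin> H \<longrightarrow> T x = 0) \<and>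
     (\<forall>x\<in>H. \<forall>y\<in>H. T (x + y) = T x + T y) \<and>
     (\<forall>c. \<forall>x\<in>H. T (sc c x) = sc c (T x)) \<and>
     (\<exists>C. \<forall>x\<in>H. hnorm ip (T x) \<le> C * hnorm ip x)}"

definition operator_norm :: "'h set \<Rightarrow> ('h \<Rightarrow> 'h \<Rightarrow> 'k::rc_field) \<Rightarrow> ('h \<Rightarrow> 'h) \<Rightarrow> real" where
  "operator_norm H ip T = (SUP x\<in>{x\<in>H. hnorm ip x \<le> 1}. hnorm ip (T x))"

definition adjoint_on ::
  "'h set \<Rightarrow> ('h \<Rightarrow> 'h \<Rightarrow> 'k) \<Rightarrow> ('h \<Rightarrow> 'h) \<Rightarrow> ('h \<Rightarrow> 'h) \<Rightarrow> bool" where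
  "adjoint_on H ip T T' \<longleftrightarrow> (\<forall>x\<in>H. \<forall>y\<in>H. ip (T x) y = ip x (T' y))"

definition closed_operator_star_algebra ::
  "'h::ab_group_add set \<Rightarrow> ('k::rc_field \<Rightarrow> 'h \<Rightarrow> 'h) \<Rightarrow> ('h \<Rightarrow> 'h \<Rightarrow> 'k) \<Rightarrow> ('h \<Rightarrow> 'h) set \<Rightarrow> bool"
where
  "closed_operator_star_algebra H sc ip M \<longleftrightarrow>
     M \<subseteq> bounded_operators H sc ip \<and>
     subspace_on (\<lambda>c T x. sc c (T x)) M \<and>
     (\<forall>S\<in>M. \<forall>T\<in>M. S \<circ> T \<in> M) \<and>
     (\<forall>T\<in>M. \<exists>T'\<in>M. adjoint_on H ip T T') \<and>
     (\<forall>X. \<forall>T\<in>bounded_operators H sc ip.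
        (\<forall>n::nat. X n \<in> M) \<and> (\<lambda>n. operator_norm H ip (X n - T)) \<longlonglongrightarrow> 0 \<longrightarrow> T \<in> M)"


section \<open>Banach algebras and C*-algebras\<close>

text \<open>
  An algebra over \<open>\<bbbK>\<close> is a subset \<open>A\<close> of a type providing addition, multiplication and norm,
  together with a scalar multiplication \<open>sc\<close> and, where applicable, an involution \<open>star\<close>.  The
  operations \<open>sc\<close> and \<open>star\<close> matter on \<open>A\<close> only.
\<close>

locale banach_algebra_on = vspace_on A sc
  for A :: "'a::real_normed_algebra set" and sc :: "'k::rc_field \<Rightarrow> 'a \<Rightarrow> 'a" +
  assumes mult_closed: "x \<in> A \<Longrightarrow> y \<in> A \<Longrightarrow> x * y \<in> A"
    and sc_of_real: "x \<in> A \<Longrightarrow> sc (of_real r) x = r *\<^sub>R x"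
    and sc_mult_left: "x \<in> A \<Longrightarrow> y \<in> A \<Longrightarrow> sc c x * y = sc c (x * y)"
    and sc_mult_right: "x \<in> A \<Longrightarrow> y \<in> A \<Longrightarrow> x * sc c y = sc c (x * y)"
    and norm_sc: "x \<in> A \<Longrightarrow> norm (sc c x) = norm c * norm x"
    and complete_A: "complete A"

locale banach_star_algebra_on = banach_algebra_on A sc
  for A :: "'a::real_normed_algebra set" and sc :: "'k::rc_field \<Rightarrow> 'a \<Rightarrow> 'a" +
  fixes star :: "'a \<Rightarrow> 'a"
  assumes star_closed: "x \<in> A \<Longrightarrow> star x \<in> A"
    and star_add: "x \<in> A \<Longrightarrow> y \<in> A \<Longrightarrow> star (x + y) = star x + star y"
    and star_sc: "x \<in> A \<Longrightarrow> star (sc c x) = sc (scalar_cnj c) (star x)"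
    and star_mult: "x \<in> A \<Longrightarrow> y \<in> A \<Longrightarrow> star (x * y) = star y * star x"
    and star_star: "x \<in> A \<Longrightarrow> star (star x) = x"
    and norm_star: "x \<in> A \<Longrightarrow> norm (star x) = norm x"

text \<open>
  The Hilbert space of a representation is sought inside the fixed type \<open>'a \<Rightarrow> complex\<close> (with
  arbitrary scalar multiplication and inner product on its carrier), because types cannot be
  quantified over.  This is no restriction.  Given an isometric representation of \<open>A \<noteq> {0}\<close> on any
  Hilbert space, pick for each \<open>a\<close> in \<open>A\<close> countably many unit vectors on which \<open>a\<close> attains its norm
  in the limit; on the closed invariant subspace they generate, the representation is still
  isometric.  That subspace has a dense subset of cardinality at most that of \<open>A\<close>, so at most
  \<open>2\<close> to the \<open>card A\<close> elements, and therefore embeds real-linearly into \<open>'a \<Rightarrow> complex\<close>.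
\<close>

definition cstar_algebra ::
  "'a::real_normed_algebra set \<Rightarrow> ('k::rc_field \<Rightarrow> 'a \<Rightarrow> 'a) \<Rightarrow> ('a \<Rightarrow> 'a) \<Rightarrow> bool" where
  "cstar_algebra A sc star \<longleftrightarrow>
     banach_star_algebra_on A sc star \<and>
     (\<exists>(H :: ('a \<Rightarrow> complex) set) (hsc :: 'k \<Rightarrow> _) ip M \<pi>.
        hilbert_space H hsc ip \<and>
        closed_operator_star_algebra H hsc ip M \<and>
        bij_betw \<pi> A M \<and>
        (\<forall>x\<in>A. \<forall>y\<in>A. \<pi> (x + y) = \<pi> x + \<pi> y) \<and>
        (\<forall>c. \<forall>x\<in>A. \<pi> (sc c x) = (\<lambda>v. hsc c (\<pi> x v))) \<and>
        (\<forall>x\<in>A. \<forall>y\<in>A. \<pi> (x * y) = \<pi> x \<circ> \<pi> y) \<and>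
        (\<forall>x\<in>A. adjoint_on H ip (\<pi> x) (\<pi> (star x))) \<and>
        (\<forall>x\<in>A. operator_norm H ip (\<pi> x) = norm x))"

definition algebra_hom ::
  "'a::real_normed_algebra set \<Rightarrow> ('k \<Rightarrow> 'a \<Rightarrow> 'a) \<Rightarrow>
   'b::real_normed_algebra set \<Rightarrow> ('k \<Rightarrow> 'b \<Rightarrow> 'b) \<Rightarrow> ('a \<Rightarrow> 'b) \<Rightarrow> bool" where
  "algebra_hom A scA B scB \<phi> \<longleftrightarrow>
     (\<forall>x\<in>A. \<phi> x \<in> B) \<and>
     (\<forall>x\<in>A. \<forall>y\<in>A. \<phi> (x + y) = \<phi> x + \<phi> y) \<and>
     (\<forall>c. \<forall>x\<in>A. \<phi> (scA c x) = scB c (\<phi> x)) \<and>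
     (\<forall>x\<in>A. \<forall>y\<in>A. \<phi> (x * y) = \<phi> x * \<phi> y)"

definition star_hom ::
  "'a::real_normed_algebra set \<Rightarrow> ('k \<Rightarrow> 'a \<Rightarrow> 'a) \<Rightarrow> ('a \<Rightarrow> 'a) \<Rightarrow>
   'b::real_normed_algebra set \<Rightarrow> ('k \<Rightarrow> 'b \<Rightarrow> 'b) \<Rightarrow> ('b \<Rightarrow> 'b) \<Rightarrow> ('a \<Rightarrow> 'b) \<Rightarrow> bool" where
  "star_hom A scA starA B scB starB \<phi> \<longleftrightarrow>
     algebra_hom A scA B scB \<phi> \<and> (\<forall>x\<in>A. \<phi> (starA x) = starB (\<phi> x))"


section \<open>Codes of rational polynomials\<close>

text \<open>
  A noncommutative polynomial without constant term is a list of monomials \<open>(c, x, xs)\<close>, each with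
  a coefficient (code) \<open>c\<close> and a nonempty word \<open>x # xs\<close> of letters (letter codes).  Every natural
  number codes such a polynomial.
\<close>

definition monomial_of_code :: "nat \<Rightarrow> nat \<times> nat \<times> nat list" where
  "monomial_of_code n =
     (case prod_decode n of (c, w) \<Rightarrow> case prod_decode w of (x, xs) \<Rightarrow> (c, x, list_decode xs))"

definition poly_of_code :: "nat \<Rightarrow> (nat \<times> nat \<times> nat list) list" where
  "poly_of_code n = map monomial_of_code (list_decode n)"

definition letters_of_code :: "nat \<Rightarrow> nat set" where
  "letters_of_code n = (\<Union>(c, x, xs)\<in>set (poly_of_code n). set (x # xs))"

text \<open>\<open>v\<close> gives the value of each letter code.\<close>

definition eval_code ::
  "('k::rc_field \<Rightarrow> 'a::real_normed_algebra \<Rightarrow> 'a) \<Rightarrow> (nat \<Rightarrow> 'a) \<Rightarrow> nat \<Rightarrow> 'a" where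
  "eval_code sc v n =
     (\<Sum>(c, x, xs)\<leftarrow>poly_of_code n. sc (scalar_of_code c) (foldl (*) (v x) (map v xs)))"

text \<open>
  A sequence \<open>(l, a)\<close> has length \<open>l\<close>, possibly \<open>\<infinity>\<close>, and entries \<open>a i\<close> for \<open>i < l\<close>; the values
  \<open>a i\<close> for \<open>i \<ge> l\<close> are irrelevant.  Polynomials may only mention indices below \<open>l\<close>.
\<close>

type_synonym 'a special_points = "enat \<times> (nat \<Rightarrow> 'a)"

definition index_of_letter :: "nat \<Rightarrow> nat" where
  "index_of_letter y = (case sum_decode y of Inl i \<Rightarrow> i | Inr i \<Rightarrow> i)"

definition star_codes :: "'a special_points \<Rightarrow> nat set" where
  "star_codes P = {n. \<forall>y\<in>letters_of_code n. enat (index_of_letter y) < fst P}"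

definition star_point ::
  "('k::rc_field \<Rightarrow> 'a::real_normed_algebra \<Rightarrow> 'a) \<Rightarrow> ('a \<Rightarrow> 'a) \<Rightarrow> 'a special_points \<Rightarrow> nat \<Rightarrow> 'a"
where
  "star_point sc star P =
     eval_code sc (\<lambda>y. case sum_decode y of Inl i \<Rightarrow> snd P i | Inr i \<Rightarrow> star (snd P i))"

definition plain_codes :: "'a special_points \<Rightarrow> nat set" where
  "plain_codes P = {n. \<forall>i\<in>letters_of_code n. enat i < fst P}"

definition plain_point ::
  "('k::rc_field \<Rightarrow> 'a::real_normed_algebra \<Rightarrow> 'a) \<Rightarrow> 'a special_points \<Rightarrow> nat \<Rightarrow> 'a" where
  "plain_point sc P = eval_code sc (snd P)"


section \<open>Computability relative to a numbering of rational points\<close>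

text \<open>\<open>D\<close> is the set of admissible codes and \<open>\<rho> n\<close> the point with code \<open>n\<close>.\<close>

definition computable_norm :: "nat set \<Rightarrow> (nat \<Rightarrow> 'a::real_normed_vector) \<Rightarrow> bool" where
  "computable_norm D \<rho> \<longleftrightarrow>
     (\<exists>e. \<forall>n\<in>D. \<forall>k. \<exists>q. computes e [n, k] q \<and> \<bar>norm (\<rho> n) - rat_of_code q\<bar> < 1 / 2 ^ k)"

definition computable_map ::
  "nat set \<Rightarrow> (nat \<Rightarrow> 'a) \<Rightarrow> nat set \<Rightarrow> (nat \<Rightarrow> 'b::real_normed_vector) \<Rightarrow> ('a \<Rightarrow> 'b) \<Rightarrow> bool" where
  "computable_map D \<rho> D' \<rho>' \<phi> \<longleftrightarrow>
     (\<exists>e. \<forall>n\<in>D. \<forall>k. \<exists>m\<in>D'. computes e [n, k] m \<and> norm (\<phi> (\<rho> n) - \<rho>' m) < 1 / 2 ^ k)"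


section \<open>Computable presentations and computable categoricity\<close>

subsection \<open>C*-algebras\<close>

definition cstar_presentation ::
  "'a::real_normed_algebra set \<Rightarrow> ('k::rc_field \<Rightarrow> 'a \<Rightarrow> 'a) \<Rightarrow> ('a \<Rightarrow> 'a) \<Rightarrow> 'a special_points \<Rightarrow> bool"
where
  "cstar_presentation A sc star P \<longleftrightarrow>
     cstar_algebra A sc star \<and>
     (\<forall>i. enat i < fst P \<longrightarrow> snd P i \<in> A) \<and>
     (\<forall>S\<subseteq>A. subspace_on sc S \<and> (\<forall>x\<in>S. \<forall>y\<in>S. x * y \<in> S) \<and> (\<forall>x\<in>S. star x \<in> S) \<and> closed S \<and>
        (\<forall>i. enat i < fst P \<longrightarrow> snd P i \<in> S) \<longrightarrow> S = A)"

definition computable_cstar_presentation ::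
  "'a::real_normed_algebra set \<Rightarrow> ('k::rc_field \<Rightarrow> 'a \<Rightarrow> 'a) \<Rightarrow> ('a \<Rightarrow> 'a) \<Rightarrow> 'a special_points \<Rightarrow> bool"
where
  "computable_cstar_presentation A sc star P \<longleftrightarrow>
     cstar_presentation A sc star P \<and> computable_norm (star_codes P) (star_point sc star P)"

definition computable_star_iso ::
  "'a::real_normed_algebra set \<Rightarrow> ('k::rc_field \<Rightarrow> 'a \<Rightarrow> 'a) \<Rightarrow> ('a \<Rightarrow> 'a) \<Rightarrow> 'a special_points \<Rightarrow>
   'b::real_normed_algebra set \<Rightarrow> ('k \<Rightarrow> 'b \<Rightarrow> 'b) \<Rightarrow> ('b \<Rightarrow> 'b) \<Rightarrow> 'b special_points \<Rightarrow>
   ('a \<Rightarrow> 'b) \<Rightarrow> bool" where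
  "computable_star_iso A scA starA P B scB starB Q \<phi> \<longleftrightarrow>
     star_hom A scA starA B scB starB \<phi> \<and> bij_betw \<phi> A B \<and>
     computable_map (star_codes P) (star_point scA starA P)
       (star_codes Q) (star_point scB starB Q) \<phi>"

definition computably_categorical_cstar ::
  "'a::real_normed_algebra set \<Rightarrow> ('k::rc_field \<Rightarrow> 'a \<Rightarrow> 'a) \<Rightarrow> ('a \<Rightarrow> 'a) \<Rightarrow> bool" where
  "computably_categorical_cstar A sc star \<longleftrightarrow>
     (\<forall>P Q. computable_cstar_presentation A sc star P \<and> computable_cstar_presentation A sc star Q
        \<longrightarrow> (\<exists>\<phi>. computable_star_iso A sc star P A sc star Q \<phi>))"

subsection \<open>Banach algebras\<close>

definition banach_presentation ::
  "'a::real_normed_algebra set \<Rightarrow> ('k::rc_field \<Rightarrow> 'a \<Rightarrow> 'a) \<Rightarrow> 'a special_points \<Rightarrow> bool" where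
  "banach_presentation A sc P \<longleftrightarrow>
     banach_algebra_on A sc \<and>
     (\<forall>i. enat i < fst P \<longrightarrow> snd P i \<in> A) \<and>
     (\<forall>S\<subseteq>A. subspace_on sc S \<and> (\<forall>x\<in>S. \<forall>y\<in>S. x * y \<in> S) \<and> closed S \<and>
        (\<forall>i. enat i < fst P \<longrightarrow> snd P i \<in> S) \<longrightarrow> S = A)"

definition computable_banach_presentation ::
  "'a::real_normed_algebra set \<Rightarrow> ('k::rc_field \<Rightarrow> 'a \<Rightarrow> 'a) \<Rightarrow> 'a special_points \<Rightarrow> bool" where
  "computable_banach_presentation A sc P \<longleftrightarrow>
     banach_presentation A sc P \<and> computable_norm (plain_codes P) (plain_point sc P)"

definition computable_banach_iso ::
  "'a::real_normed_algebra set \<Rightarrow> ('k::rc_field \<Rightarrow> 'a \<Rightarrow> 'a) \<Rightarrow> 'a special_points \<Rightarrow>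
   'b::real_normed_algebra set \<Rightarrow> ('k \<Rightarrow> 'b \<Rightarrow> 'b) \<Rightarrow> 'b special_points \<Rightarrow> ('a \<Rightarrow> 'b) \<Rightarrow> bool" where
  "computable_banach_iso A scA P B scB Q \<phi> \<longleftrightarrow>
     algebra_hom A scA B scB \<phi> \<and> bij_betw \<phi> A B \<and> (\<forall>x\<in>A. norm (\<phi> x) = norm x) \<and>
     computable_map (plain_codes P) (plain_point scA P) (plain_codes Q) (plain_point scB Q) \<phi>"

definition computably_categorical_banach ::
  "'a::real_normed_algebra set \<Rightarrow> ('k::rc_field \<Rightarrow> 'a \<Rightarrow> 'a) \<Rightarrow> bool" where
  "computably_categorical_banach A sc \<longleftrightarrow>
     (\<forall>P Q. computable_banach_presentation A sc P \<and> computable_banach_presentation A sc Q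
        \<longrightarrow> (\<exists>\<phi>. computable_banach_iso A sc P A sc Q \<phi>))"

end

(* Every z in B is uniquely x + i y with x, y self-adjoint, so a *-automorphism of B restricts to A and
   an algebra automorphism of A extends to B.  On codes: a rational polynomial in the special points
   of a presentation of A splits into its real and imaginary part coefficientwise, and
   ||x + i y||^2 = ||x^2 + y^2|| by the C*-identity, so norms in B are computable from norms in A.
   Conversely, the real and imaginary parts of the special points of B present A; rational points
   are translated by substitution, where commutativity makes the order of letters irrelevant.

   On A the involution is trivial, so the step from C*- to Banach categoricity only needs that algebra
   automorphisms of A are isometric.  This holds because the unit ball has an algebraic description:
   if ||a|| < 1, then a^2 = 2 d - d^2 for some d in A (a fixed point of d |-> (a^2 + d^2) / 2), and
   such an equation gives ||a v||^2 + ||(1 - d) v||^2 = ||v||^2 in any representation. *)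

theory Submission
  imports Defs
begin

text \<open>Two features shape the proof. A given program is only known to halt on admissible codes,
  and nothing else is known about it. So every transfer of a norm or of a map composes the given
  program with total recursive translations of codes, and the work lies in showing that these are
  recursive, stay admissible and have the right values. A code names different scalars over \<real>
  and over \<complex>, so even a polynomial with real coefficients must be recoded when it changes
  sides. The formula for norms in B yields the square of the norm; hence a computable square root of
  rationals enters.

  The algebras may lack a unit. In a function algebra the element d is 1 - sqrt (1 - a^2), which
  vanishes wherever a does and so makes sense without a unit, whereas sqrt (1 - a^2) does not. The
  equation for d is purely algebraic, so any algebra homomorphism carries it along.\<close>

section \<open>Computable functions on natural numbers\<close>

text \<open>Total functions on argument lists of a fixed length \<open>k\<close>. Since they take
  the whole list, computability of a term is proved by backward application of closure rules along
  the structure of the term.\<close>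

definition rec_fun :: "nat \<Rightarrow> (nat list \<Rightarrow> nat) \<Rightarrow> bool" where
  "rec_fun k f \<longleftrightarrow> (\<exists>e. \<forall>xs. length xs = k \<longrightarrow> computes e xs (f xs))"

abbreviation rec_fun1 :: "(nat \<Rightarrow> nat) \<Rightarrow> bool" where
  "rec_fun1 F \<equiv> rec_fun 1 (\<lambda>xs. F (xs ! 0))"

abbreviation rec_fun2 :: "(nat \<Rightarrow> nat \<Rightarrow> nat) \<Rightarrow> bool" where
  "rec_fun2 F \<equiv> rec_fun 2 (\<lambda>xs. F (xs ! 0) (xs ! 1))"

abbreviation rec_fun3 :: "(nat \<Rightarrow> nat \<Rightarrow> nat \<Rightarrow> nat) \<Rightarrow> bool" where
  "rec_fun3 F \<equiv> rec_fun 3 (\<lambda>xs. F (xs ! 0) (xs ! 1) (xs ! 2))"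

lemma rec_fun_cong:
  "rec_fun k f \<Longrightarrow> (\<And>xs. length xs = k \<Longrightarrow> f xs = g xs) \<Longrightarrow> rec_fun k g"
  by (auto simp: rec_fun_def)

lemma rec_proj: "i < k \<Longrightarrow> rec_fun k (\<lambda>xs. xs ! i)"
  by (auto simp: rec_fun_def intro!: exI[of _ "Proj i"] computes_Proj)

lemma rec_comp:
  assumes "rec_fun (length gs) f" "\<And>g. g \<in> set gs \<Longrightarrow> rec_fun k g"
  shows "rec_fun k (\<lambda>xs. f (map (\<lambda>g. g xs) gs))"
proof -
  obtain e where e: "\<And>xs. length xs = length gs \<Longrightarrow> computes e xs (f xs)"
    using assms(1) by (auto simp: rec_fun_def)
  obtain E where E: "\<And>g xs. g \<in> set gs \<Longrightarrow> length xs = k \<Longrightarrow> computes (E g) xs (g xs)"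
    using assms(2) unfolding rec_fun_def by metis
  have "computes (Comp e (map E gs)) xs (f (map (\<lambda>g. g xs) gs))" if "length xs = k" for xs
    by (rule computes_Comp[where ys = "map (\<lambda>g. g xs) gs"])
      (auto simp: list_all2_conv_all_nth intro!: e E that)
  then show ?thesis
    unfolding rec_fun_def by blast
qed

lemma rec_app1:
  "rec_fun1 F \<Longrightarrow> rec_fun k f \<Longrightarrow> rec_fun k (\<lambda>xs. F (f xs))"
  using rec_comp[of "[f]" "\<lambda>xs. F (xs ! 0)" k] by simp

lemma rec_app2:
  "rec_fun2 F \<Longrightarrow> rec_fun k f \<Longrightarrow> rec_fun k g \<Longrightarrow> rec_fun k (\<lambda>xs. F (f xs) (g xs))"
  using rec_comp[of "[f, g]" "\<lambda>xs. F (xs ! 0) (xs ! 1)" k]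
  by (auto simp: numeral_2_eq_2)

lemma rec_app3:
  "rec_fun3 F \<Longrightarrow> rec_fun k f \<Longrightarrow> rec_fun k g \<Longrightarrow> rec_fun k h
    \<Longrightarrow> rec_fun k (\<lambda>xs. F (f xs) (g xs) (h xs))"
  using rec_comp[of "[f, g, h]" "\<lambda>xs. F (xs ! 0) (xs ! 1) (xs ! 2)" k]
  by (auto simp: numeral_2_eq_2 numeral_3_eq_3)

lemma rec_Suc: "rec_fun k f \<Longrightarrow> rec_fun k (\<lambda>xs. Suc (f xs))"
proof -
  have "rec_fun1 Suc"
    unfolding rec_fun_def
    by (rule exI[of _ Succ]) (auto simp: length_Suc_conv intro: computes_Succ)
  then show "rec_fun k f \<Longrightarrow> rec_fun k (\<lambda>xs. Suc (f xs))"
    by (rule rec_app1)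
qed

lemma rec_const: "rec_fun k (\<lambda>xs. c)"
proof (induction c)
  case 0
  show ?case
    unfolding rec_fun_def using computes_Zero by blast
next
  case (Suc c)
  then show ?case
    by (rule rec_Suc)
qed

lemma rec_rec:
  assumes "rec_fun k z" "rec_fun (Suc (Suc k)) s" "rec_fun k n"
  shows "rec_fun k (\<lambda>xs. rec_nat (z xs) (\<lambda>i r. s (i # r # xs)) (n xs))"
proof -
  obtain f where f: "\<And>xs. length xs = k \<Longrightarrow> computes f xs (z xs)"
    using assms(1) by (auto simp: rec_fun_def)
  obtain g where g: "\<And>xs. length xs = Suc (Suc k) \<Longrightarrow> computes g xs (s xs)"
    using assms(2) by (auto simp: rec_fun_def)
  have R: "computes (PrimRec f g) (m # xs) (rec_nat (z xs) (\<lambda>i r. s (i # r # xs)) m)"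
    if "length xs = k" for m xs
  proof (induction m)
    case 0
    show ?case
      using f[OF that] by (simp add: computes_PrimRec_0)
  next
    case (Suc m)
    then show ?case
      using g[of "m # rec_nat (z xs) (\<lambda>i r. s (i # r # xs)) m # xs"] that
      by (simp add: computes_PrimRec_Suc)
  qed
  \<comment> \<open>\<open>PrimRec\<close> expects the recursion variable in front of the
    parameters, so it is composed with \<open>n\<close> followed by all \<open>k\<close>
    projections.\<close>
  have "rec_fun (length (n # map (\<lambda>i xs. xs ! i) [0..<k]))
      (\<lambda>ys. rec_nat (z (tl ys)) (\<lambda>i r. s (i # r # tl ys)) (hd ys))"
    unfolding rec_fun_def using R by (intro exI[of _ "PrimRec f g"]) (auto simp: length_Suc_conv)
  then have "rec_fun k (\<lambda>xs. (\<lambda>ys. rec_nat (z (tl ys)) (\<lambda>i r. s (i # r # tl ys)) (hd ys))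
      (map (\<lambda>g. g xs) (n # map (\<lambda>i xs. xs ! i) [0..<k])))"
    by (rule rec_comp) (auto intro: rec_proj assms)
  then show ?thesis
    by (rule rec_fun_cong) (auto simp: comp_def map_nth)
qed

text \<open>Unbounded search stays total because every input has a zero. Halving, unpairing and
  integer square roots are obtained this way.\<close>

lemma rec_Least:
  assumes "rec_fun (Suc k) f" "\<And>xs. length xs = k \<Longrightarrow> \<exists>n. f (n # xs) = 0"
  shows "rec_fun k (\<lambda>xs. LEAST n. f (n # xs) = 0)"
proof -
  obtain e where e: "\<And>xs. length xs = Suc k \<Longrightarrow> computes e xs (f xs)"
    using assms(1) by (auto simp: rec_fun_def)
  have "computes (Mu e) xs (LEAST n. f (n # xs) = 0)" if k: "length xs = k" for xs
  proof (rule computes_Mu)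
    have "f ((LEAST n. f (n # xs) = 0) # xs) = 0"
      using assms(2)[OF k] by (rule LeastI_ex)
    then show "computes e ((LEAST n. f (n # xs) = 0) # xs) 0"
      using e[of "(LEAST n. f (n # xs) = 0) # xs"] k by simp
    show "\<forall>i<LEAST n. f (n # xs) = 0. \<exists>y. computes e (i # xs) (Suc y)"
    proof (intro allI impI)
      fix i assume "i < (LEAST n. f (n # xs) = 0)"
      then have "f (i # xs) \<noteq> 0"
        by (rule not_less_Least)
      then show "\<exists>y. computes e (i # xs) (Suc y)"
        using e[of "i # xs"] k by (metis length_Cons not0_implies_Suc)
    qed
  qed
  then show ?thesis
    unfolding rec_fun_def by blast
qed

section \<open>Arithmetic, case distinction and pairing\<close>

lemma rec_add: "rec_fun k f \<Longrightarrow> rec_fun k g \<Longrightarrow> rec_fun k (\<lambda>xs. f xs + g xs)"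
proof -
  assume "rec_fun k f" "rec_fun k g"
  from rec_rec[OF this(1) rec_Suc[OF rec_proj[of 1]] this(2)]
  have "rec_fun k (\<lambda>xs. rec_nat (f xs) (\<lambda>i. Suc) (g xs))"
    by simp
  moreover have "rec_nat a (\<lambda>i. Suc) b = a + b" for a b
    by (induction b) auto
  ultimately show ?thesis
    by simp
qed

lemma rec_mult: "rec_fun k f \<Longrightarrow> rec_fun k g \<Longrightarrow> rec_fun k (\<lambda>xs. f xs * g xs)"
proof -
  have "rec_fun2 (\<lambda>x y. rec_nat 0 (\<lambda>i r. r + x) y)"
    using rec_rec[OF rec_const[where c=0] rec_add[OF rec_proj[of 1] rec_proj[of 2]], of 2 "\<lambda>xs. xs ! 1"]
    by (simp add: rec_proj)
  moreover have "rec_nat 0 (\<lambda>i r. r + x) y = x * y" for x y :: nat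
    by (induction y) auto
  ultimately have "rec_fun2 (*)"
    by simp
  then show "rec_fun k f \<Longrightarrow> rec_fun k g \<Longrightarrow> rec_fun k (\<lambda>xs. f xs * g xs)"
    by (rule rec_app2)
qed

lemma rec_power: "rec_fun k f \<Longrightarrow> rec_fun k g \<Longrightarrow> rec_fun k (\<lambda>xs. f xs ^ g xs)"
proof -
  have "rec_fun2 (\<lambda>x y. rec_nat 1 (\<lambda>i r. r * x) y)"
    using rec_rec[OF rec_const[where c=1] rec_mult[OF rec_proj[of 1] rec_proj[of 2]], of 2 "\<lambda>xs. xs ! 1"]
    by (simp add: rec_proj)
  moreover have "rec_nat 1 (\<lambda>i r. r * x) y = x ^ y" for x y :: nat
    by (induction y) auto
  ultimately have "rec_fun2 (^)"
    by simp
  then show "rec_fun k f \<Longrightarrow> rec_fun k g \<Longrightarrow> rec_fun k (\<lambda>xs. f xs ^ g xs)"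
    by (rule rec_app2)
qed

lemma rec_diff: "rec_fun k f \<Longrightarrow> rec_fun k g \<Longrightarrow> rec_fun k (\<lambda>xs. f xs - g xs)"
proof -
  have "rec_fun1 (\<lambda>x. rec_nat 0 (\<lambda>i r. i) x)"
    using rec_rec[OF rec_const[where c=0] rec_proj[of 0], of 1 "\<lambda>xs. xs ! 0"]
    by (simp add: rec_proj)
  moreover have "rec_nat 0 (\<lambda>i r. i) x = x - 1" for x :: nat
    by (cases x) auto
  ultimately have pred: "rec_fun1 (\<lambda>x. x - 1)"
    by simp
  have "rec_fun2 (\<lambda>x y. rec_nat x (\<lambda>i r. r - 1) y)"
    using rec_rec[OF rec_proj[of 0] rec_app1[OF pred rec_proj[of 1]], of 2 "\<lambda>xs. xs ! 1"]
    by (simp add: rec_proj)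
  moreover have "rec_nat x (\<lambda>i r. r - 1) y = x - y" for x y :: nat
    by (induction y) auto
  ultimately have "rec_fun2 (-)"
    by simp
  then show "rec_fun k f \<Longrightarrow> rec_fun k g \<Longrightarrow> rec_fun k (\<lambda>xs. f xs - g xs)"
    by (rule rec_app2)
qed

lemma rec_if:
  assumes "rec_fun k b" "rec_fun k f" "rec_fun k g"
  shows "rec_fun k (\<lambda>xs. if b xs = 0 then f xs else g xs)"
proof -
  \<comment> \<open>With truncated subtraction, \<open>1 - b xs\<close> is the indicator of
    \<open>b xs = 0\<close>, and \<open>1 - (1 - b xs)\<close> is that of the opposite case.\<close>
  have "rec_fun k (\<lambda>xs. (1 - b xs) * f xs + (1 - (1 - b xs)) * g xs)"
    by (intro rec_add rec_mult rec_diff rec_const assms)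
  then show ?thesis
    by (rule rec_fun_cong) (auto simp: Suc_le_eq)
qed

lemma rec_div2: "rec_fun k f \<Longrightarrow> rec_fun k (\<lambda>xs. f xs div 2)"
proof -
  \<comment> \<open>For truncated subtraction, \<open>Suc a - b = 0\<close> says a < b. The search
    is for the least n with x < 2 (n + 1).\<close>
  have "rec_fun 1 (\<lambda>xs. LEAST n. Suc ((n # xs) ! 1) - 2 * Suc ((n # xs) ! 0) = 0)"
  proof (rule rec_Least)
    show "\<exists>n. Suc ((n # xs) ! 1) - 2 * Suc ((n # xs) ! 0) = 0" for xs :: "nat list"
      by (rule exI[of _ "xs ! 0"]) simp
    show "rec_fun (Suc 1) (\<lambda>xs. Suc (xs ! 1) - 2 * Suc (xs ! 0))"
      by (rule rec_diff rec_Suc rec_mult rec_const rec_proj | simp)+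
  qed
  moreover have "(LEAST n. Suc x - 2 * Suc n = 0) = x div 2" for x :: nat
    by (rule Least_equality) auto
  ultimately have "rec_fun1 (\<lambda>x. x div 2)"
    by simp
  then show "rec_fun k f \<Longrightarrow> rec_fun k (\<lambda>xs. f xs div 2)"
    by (rule rec_app1)
qed

lemma rec_mod2: "rec_fun k f \<Longrightarrow> rec_fun k (\<lambda>xs. f xs mod 2)"
proof -
  assume "rec_fun k f"
  then have "rec_fun k (\<lambda>xs. f xs - 2 * (f xs div 2))"
    by (intro rec_diff rec_mult rec_div2 rec_const)
  then show ?thesis
    by (simp add: minus_mult_div_eq_mod)
qed

lemma rec_triangle: "rec_fun k f \<Longrightarrow> rec_fun k (\<lambda>xs. triangle (f xs))"
  unfolding triangle_def by (intro rec_div2 rec_mult rec_Suc)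

lemma rec_prod_encode:
  "rec_fun k f \<Longrightarrow> rec_fun k g \<Longrightarrow> rec_fun k (\<lambda>xs. prod_encode (f xs, g xs))"
  unfolding prod_encode_def by (simp add: rec_add rec_triangle)

text \<open>Inverts the Cantor pairing: the code of (a, b) is \<open>triangle (a + b) + a\<close>,
  which lies strictly below the next triangular number, so the first triangular number above the
  code reveals the diagonal a + b.\<close>

lemma Least_triangle: "(LEAST n. Suc (prod_encode (a, b)) - triangle (Suc n) = 0) = a + b"
proof (rule Least_equality)
  show "Suc (prod_encode (a, b)) - triangle (Suc (a + b)) = 0"
    by (simp add: prod_encode_def)
next
  fix n assume n: "Suc (prod_encode (a, b)) - triangle (Suc n) = 0"
  have mono: "triangle i \<le> triangle j" if "i \<le> j" for i j
    using that by (induction rule: dec_induct) auto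
  show "a + b \<le> n"
  proof (rule ccontr)
    assume "\<not> a + b \<le> n"
    then have "triangle (Suc n) \<le> triangle (a + b)"
      by (intro mono) simp
    with n show False
      by (simp add: prod_encode_def)
  qed
qed

lemma rec_prod_decode:
  assumes "rec_fun k f"
  shows "rec_fun k (\<lambda>xs. fst (prod_decode (f xs)))"
    and "rec_fun k (\<lambda>xs. snd (prod_decode (f xs)))"
proof -
  define s where "s x = (LEAST n. Suc x - triangle (Suc n) = 0)" for x
  have "rec_fun 1 (\<lambda>xs. LEAST n. Suc ((n # xs) ! 1) - triangle (Suc ((n # xs) ! 0)) = 0)"
  proof (rule rec_Least)
    show "\<exists>n. Suc ((n # xs) ! 1) - triangle (Suc ((n # xs) ! 0)) = 0" for xs :: "nat list"
      by (rule exI[of _ "Suc (xs ! 0)"]) simp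
  qed (intro rec_Suc rec_diff rec_triangle rec_proj, auto)
  then have s: "rec_fun1 s"
    by (simp add: s_def)
  have eq1: "fst (prod_decode x) = x - triangle (s x)"
    and eq2: "snd (prod_decode x) = s x - fst (prod_decode x)" for x
  proof -
    obtain a b where x: "x = prod_encode (a, b)"
      by (metis prod.collapse prod_decode_inverse)
    then have "s x = a + b"
      unfolding s_def by (simp only: Least_triangle)
    then show "fst (prod_decode x) = x - triangle (s x)" "snd (prod_decode x) = s x - fst (prod_decode x)"
      by (simp_all add: x) (simp add: prod_encode_def)
  qed
  show fst: "rec_fun k (\<lambda>xs. fst (prod_decode (f xs)))"
    unfolding eq1 by (intro rec_diff rec_triangle rec_app1[OF s] assms)
  show "rec_fun k (\<lambda>xs. snd (prod_decode (f xs)))"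
    unfolding eq2 by (intro rec_diff fst rec_app1[OF s] assms)
qed

lemmas rec_intros = rec_const rec_proj rec_Suc rec_add rec_mult rec_diff rec_power rec_if rec_div2 rec_mod2
  rec_prod_encode rec_prod_decode

text \<open>Iterating the step on the pair (accumulator, remaining list) \<open>n\<close> times exhausts the list with
  code \<open>n\<close>, because a list is never longer than its code.\<close>
lemma rec_fold:
  assumes F: "rec_fun3 F"
  shows "rec_fun3 (\<lambda>n a p. fold (\<lambda>x acc. F x acc p) (list_decode n) a)"
proof -
  \<comment> \<open>A nonempty list has code \<open>Suc (prod_encode (x, t))\<close> with head x and
    tail code t, whence the \<open>- 1\<close>. Code 0 is the empty list; there the state no longer
    changes, so surplus iterations are harmless.\<close>
  define step where "step st p = (if snd (prod_decode st) = 0 then st else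
     prod_encode (F (fst (prod_decode (snd (prod_decode st) - 1))) (fst (prod_decode st)) p,
       snd (prod_decode (snd (prod_decode st) - 1))))" for st p
  have step: "rec_fun2 step"
    unfolding step_def by (intro rec_intros rec_app3[OF F]) auto
  have iter: "rec_nat (prod_encode (a, list_encode xs)) (\<lambda>i st. step st p) m
      = prod_encode (fold (\<lambda>x acc. F x acc p) (take m xs) a, list_encode (drop m xs))" for a xs p m
  proof (induction m)
    case (Suc m)
    show ?case
    proof (cases "drop m xs")
      case Nil
      then show ?thesis
        using Suc by (simp add: step_def)
    next
      case (Cons y ys)
      then have "m < length xs"
        by (metis drop_all leI list.distinct(1))
      with Cons have "take (Suc m) xs = take m xs @ [y]" "drop (Suc m) xs = ys"
        by (auto simp: take_Suc_conv_app_nth Cons_nth_drop_Suc[symmetric])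
      then show ?thesis
        using Suc Cons by (simp add: step_def)
    qed
  qed simp
  have len: "length xs \<le> list_encode xs" for xs
  proof (induction xs)
    case (Cons x xs)
    then show ?case
      using le_prod_encode_2[of "list_encode xs" x] by simp
  qed simp
  have "rec_fun3 (\<lambda>n a p. fst (prod_decode (rec_nat (prod_encode (a, n)) (\<lambda>i st. step st p) n)))"
    using rec_rec[OF _ rec_app2[OF step rec_proj[of 1] rec_proj[of 4]],
        of 3 "\<lambda>xs. prod_encode (xs ! 1, xs ! 0)" "\<lambda>xs. xs ! 0"]
    by (intro rec_prod_decode) (simp add: rec_intros)
  moreover have "fst (prod_decode (rec_nat (prod_encode (a, n)) (\<lambda>i st. step st p) n))
      = fold (\<lambda>x acc. F x acc p) (list_decode n) a" for a n p
    using iter[of a "list_decode n" p n] len[of "list_decode n"] by simp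
  ultimately show ?thesis
    by simp
qed

section \<open>Arithmetic on polynomial codes\<close>

definition cons_code :: "nat \<Rightarrow> nat \<Rightarrow> nat" where
  "cons_code x n = Suc (prod_encode (x, n))"

lemma list_decode_cons_code [simp]: "list_decode (cons_code x n) = x # list_decode n"
  by (simp add: cons_code_def)

text \<open>Building a list by \<open>fold\<close> reverses it. For a list of monomials this merely
  permutes a sum.\<close>

lemma list_decode_fold_cons_code:
  "list_decode (fold (\<lambda>x acc. cons_code (g x) acc) xs n) = rev (map g xs) @ list_decode n"
  by (induction xs arbitrary: n) auto

lemma rec_cons_code: "rec_fun k f \<Longrightarrow> rec_fun k g \<Longrightarrow> rec_fun k (\<lambda>xs. cons_code (f xs) (g xs))"
  unfolding cons_code_def by (intro rec_intros)

text \<open>The integer with code \<open>n\<close> is \<open>int_pos n - int_neg n\<close>; this way integer and rational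
  arithmetic on codes needs only natural numbers.\<close>

definition int_pos :: "nat \<Rightarrow> nat" where "int_pos n = (if n mod 2 = 0 then n div 2 else 0)"
definition int_neg :: "nat \<Rightarrow> nat" where "int_neg n = (if n mod 2 = 0 then 0 else Suc (n div 2))"
text \<open>Matches \<open>int_encode\<close>, where 2 k codes k and 2 k - 1 codes - k.\<close>

definition diff_code :: "nat \<Rightarrow> nat \<Rightarrow> nat" where
  "diff_code a b = (if b - a = 0 then 2 * (a - b) else 2 * (b - a) - 1)"

lemma int_decode_pos_neg: "int_decode n = int (int_pos n) - int (int_neg n)"
  by (auto simp: int_decode_def sum_decode_def int_pos_def int_neg_def even_iff_mod_2_eq_zero)

lemma int_decode_diff_code: "int_decode (diff_code a b) = int a - int b"
proof -
  have "diff_code a b = int_encode (int a - int b)"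
    by (auto simp: int_encode_def sum_encode_def diff_code_def nat_diff_distrib')
  then show ?thesis
    by simp
qed

definition rat_pos :: "nat \<Rightarrow> nat" where "rat_pos c = int_pos (fst (prod_decode c))"
definition rat_neg :: "nat \<Rightarrow> nat" where "rat_neg c = int_neg (fst (prod_decode c))"
definition rat_den :: "nat \<Rightarrow> nat" where "rat_den c = Suc (snd (prod_decode c))"
text \<open>A code stores the denominator minus one, so \<open>d\<close> must be positive. The
  signed numerator is given as a difference of naturals. Fractions are not reduced, as only the
  values of codes matter.\<close>

definition frac_code :: "nat \<Rightarrow> nat \<Rightarrow> nat \<Rightarrow> nat" where
  "frac_code a b d = prod_encode (diff_code a b, d - 1)"

lemma rat_of_code_pos_neg: "rat_of_code c = (real (rat_pos c) - real (rat_neg c)) / real (rat_den c)"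
  by (simp add: rat_of_code_def rat_pos_def rat_neg_def rat_den_def int_decode_pos_neg split: prod.split)

lemma rat_den_pos [simp]: "rat_den c > 0"
  by (simp add: rat_den_def)

lemma rat_of_code_frac_code: "d > 0 \<Longrightarrow> rat_of_code (frac_code a b d) = (real a - real b) / real d"
  by (simp add: rat_of_code_def frac_code_def int_decode_diff_code)

definition rat_mult :: "nat \<Rightarrow> nat \<Rightarrow> nat" where
  "rat_mult x y = frac_code (rat_pos x * rat_pos y + rat_neg x * rat_neg y)
     (rat_pos x * rat_neg y + rat_neg x * rat_pos y) (rat_den x * rat_den y)"
definition rat_add :: "nat \<Rightarrow> nat \<Rightarrow> nat" where
  "rat_add x y = frac_code (rat_pos x * rat_den y + rat_pos y * rat_den x)
     (rat_neg x * rat_den y + rat_neg y * rat_den x) (rat_den x * rat_den y)"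
definition rat_diff :: "nat \<Rightarrow> nat \<Rightarrow> nat" where
  "rat_diff x y = frac_code (rat_pos x * rat_den y + rat_neg y * rat_den x)
     (rat_neg x * rat_den y + rat_pos y * rat_den x) (rat_den x * rat_den y)"

lemma rat_arith:
  "rat_of_code (rat_mult x y) = rat_of_code x * rat_of_code y"
  "rat_of_code (rat_add x y) = rat_of_code x + rat_of_code y"
  "rat_of_code (rat_diff x y) = rat_of_code x - rat_of_code y"
proof -
  have "real (rat_den x) > 0" "real (rat_den y) > 0"
    by simp_all
  then show "rat_of_code (rat_mult x y) = rat_of_code x * rat_of_code y"
    "rat_of_code (rat_add x y) = rat_of_code x + rat_of_code y"
    "rat_of_code (rat_diff x y) = rat_of_code x - rat_of_code y"
    unfolding rat_of_code_pos_neg[of x] rat_of_code_pos_neg[of y] rat_mult_def rat_add_def rat_diff_def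
    by (simp_all add: rat_of_code_frac_code field_simps)
qed

definition complex_mult :: "nat \<Rightarrow> nat \<Rightarrow> nat" where
  "complex_mult x y = prod_encode
     (rat_diff (rat_mult (fst (prod_decode x)) (fst (prod_decode y)))
        (rat_mult (snd (prod_decode x)) (snd (prod_decode y))),
      rat_add (rat_mult (fst (prod_decode x)) (snd (prod_decode y)))
        (rat_mult (snd (prod_decode x)) (fst (prod_decode y))))"

lemma scalar_of_code_complex:
  "scalar_of_code c = Complex (rat_of_code (fst (prod_decode c))) (rat_of_code (snd (prod_decode c)))"
  by (simp add: scalar_of_code_complex_def split: prod.split)

lemma scalar_complex_mult:
  "(scalar_of_code (complex_mult x y) :: complex) = scalar_of_code x * scalar_of_code y"
  by (simp add: scalar_of_code_complex complex_mult_def rat_arith complex_mult)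

lemma rec_complex_mult:
  "rec_fun k f \<Longrightarrow> rec_fun k g \<Longrightarrow> rec_fun k (\<lambda>xs. complex_mult (f xs) (g xs))"
proof -
  have frac: "rec_fun3 frac_code"
    unfolding frac_code_def diff_code_def by (intro rec_intros) auto
  have pos: "rec_fun1 rat_pos" "rec_fun1 rat_neg" "rec_fun1 rat_den"
    unfolding rat_pos_def rat_neg_def rat_den_def int_pos_def int_neg_def
    by (intro rec_intros; simp)+
  note pos = pos[THEN rec_app1]
  have "rec_fun2 rat_mult" "rec_fun2 rat_add" "rec_fun2 rat_diff"
    unfolding rat_mult_def rat_add_def rat_diff_def
    by (intro rec_app3[OF frac] rec_add rec_mult pos rec_proj; simp)+
  note rat = this[THEN rec_app2]
  have "rec_fun2 complex_mult"
    unfolding complex_mult_def by (intro rat rec_intros) auto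
  then show "rec_fun k f \<Longrightarrow> rec_fun k g \<Longrightarrow> rec_fun k (\<lambda>xs. complex_mult (f xs) (g xs))"
    by (rule rec_app2)
qed

section \<open>Codes of monomials and polynomials\<close>

definition mono_coeff :: "nat \<Rightarrow> nat" where "mono_coeff u = fst (prod_decode u)"
definition mono_head :: "nat \<Rightarrow> nat" where "mono_head u = fst (prod_decode (snd (prod_decode u)))"
definition mono_rest :: "nat \<Rightarrow> nat" where "mono_rest u = snd (prod_decode (snd (prod_decode u)))"
definition mono_code :: "nat \<Rightarrow> nat \<Rightarrow> nat \<Rightarrow> nat" where
  "mono_code c x xs = prod_encode (c, prod_encode (x, xs))"

lemma mono_sel [simp]: "mono_coeff (mono_code c x xs) = c" "mono_head (mono_code c x xs) = x" "mono_rest (mono_code c x xs) = xs"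
  by (simp_all add: mono_coeff_def mono_head_def mono_rest_def mono_code_def)

lemma rec_mono:
  "rec_fun k f \<Longrightarrow> rec_fun k (\<lambda>xs. mono_coeff (f xs))"
  "rec_fun k f \<Longrightarrow> rec_fun k (\<lambda>xs. mono_head (f xs))"
  "rec_fun k f \<Longrightarrow> rec_fun k (\<lambda>xs. mono_rest (f xs))"
  "rec_fun k f \<Longrightarrow> rec_fun k g \<Longrightarrow> rec_fun k h \<Longrightarrow> rec_fun k (\<lambda>xs. mono_code (f xs) (g xs) (h xs))"
  unfolding mono_coeff_def mono_head_def mono_rest_def mono_code_def by (intro rec_intros; assumption)+

definition mono_letters :: "nat \<Rightarrow> nat set" where
  "mono_letters u = insert (mono_head u) (set (list_decode (mono_rest u)))"

definition mono_word :: "(nat \<Rightarrow> 'a::real_normed_algebra) \<Rightarrow> nat \<Rightarrow> 'a" where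
  "mono_word v u = foldl (*) (v (mono_head u)) (map v (list_decode (mono_rest u)))"

lemma monomial_of_code_eq: "monomial_of_code u = (mono_coeff u, mono_head u, list_decode (mono_rest u))"
  by (simp add: monomial_of_code_def mono_coeff_def mono_head_def mono_rest_def split: prod.split)

lemma letters_of_code_eq: "letters_of_code n = (\<Union>u\<in>set (list_decode n). mono_letters u)"
  by (simp add: letters_of_code_def poly_of_code_def monomial_of_code_eq mono_letters_def)

lemma eval_code_eq:
  "eval_code sc v n = (\<Sum>u\<leftarrow>list_decode n. sc (scalar_of_code (mono_coeff u)) (mono_word v u))"
  by (simp add: eval_code_def poly_of_code_def monomial_of_code_eq mono_word_def comp_def)

lemma mono_letters_mono_code [simp]: "mono_letters (mono_code c x xs) = insert x (set (list_decode xs))"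
  by (simp add: mono_letters_def)

lemma mono_word_mono_code [simp]: "mono_word v (mono_code c x xs) = foldl (*) (v x) (map v (list_decode xs))"
  by (simp add: mono_word_def)

text \<open>Serves both as concatenation of words and, on lists of monomials, as addition of
  polynomials.\<close>

definition rev_append :: "nat \<Rightarrow> nat \<Rightarrow> nat" where
  "rev_append n m = fold (\<lambda>x acc. cons_code x acc) (list_decode n) m"

lemma list_decode_rev_append [simp]:
  "list_decode (rev_append n m) = rev (list_decode n) @ list_decode m"
  using list_decode_fold_cons_code[of "\<lambda>x. x"] by (simp add: rev_append_def)

lemma rec_rev_append: "rec_fun k f \<Longrightarrow> rec_fun k g \<Longrightarrow> rec_fun k (\<lambda>xs. rev_append (f xs) (g xs))"
proof -
  have "rec_fun3 (\<lambda>n a p. rev_append n a)"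
    unfolding rev_append_def by (intro rec_fold rec_cons_code rec_proj) auto
  from rec_app3[OF this _ _ rec_const[of k 0]]
  show "rec_fun k f \<Longrightarrow> rec_fun k g \<Longrightarrow> rec_fun k (\<lambda>xs. rev_append (f xs) (g xs))" .
qed

text \<open>Common form of all operations that change coefficients only. The parameter
  \<open>a\<close> lets the scalar of \<open>smult_code\<close> be an input of the computation; the
  recodings below fix it to 0.\<close>

definition map_coeff :: "(nat \<Rightarrow> nat \<Rightarrow> nat) \<Rightarrow> nat \<Rightarrow> nat \<Rightarrow> nat" where
  "map_coeff \<kappa> a n =
     fold (\<lambda>u acc. cons_code (mono_code (\<kappa> a (mono_coeff u)) (mono_head u) (mono_rest u)) acc) (list_decode n) 0"

lemma list_decode_map_coeff:
  "list_decode (map_coeff \<kappa> a n)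
    = rev (map (\<lambda>u. mono_code (\<kappa> a (mono_coeff u)) (mono_head u) (mono_rest u)) (list_decode n))"
  unfolding map_coeff_def by (subst list_decode_fold_cons_code) simp

lemma rec_map_coeff:
  assumes "rec_fun2 \<kappa>" "rec_fun k f" "rec_fun k g"
  shows "rec_fun k (\<lambda>xs. map_coeff \<kappa> (f xs) (g xs))"
proof -
  have "rec_fun3 (\<lambda>n acc a.
      fold (\<lambda>u acc. cons_code (mono_code (\<kappa> a (mono_coeff u)) (mono_head u) (mono_rest u)) acc) (list_decode n) acc)"
    by (intro rec_fold rec_cons_code rec_mono rec_app2[OF assms(1)] rec_proj) auto
  from rec_app3[OF this assms(3) rec_const assms(2)] show ?thesis
    unfolding map_coeff_def by simp
qed

lemma letters_map_coeff [simp]: "letters_of_code (map_coeff \<kappa> a n) = letters_of_code n"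
  by (simp add: letters_of_code_eq list_decode_map_coeff) (simp add: mono_letters_def)

lemma eval_map_coeff:
  "eval_code sc v (map_coeff \<kappa> a n)
    = (\<Sum>u\<leftarrow>list_decode n. sc (scalar_of_code (\<kappa> a (mono_coeff u))) (mono_word v u))"
  by (simp add: eval_code_eq list_decode_map_coeff rev_map[symmetric] comp_def) (simp add: mono_word_def)

text \<open>Over \<real> a coefficient code names a rational, over \<complex> it is a pair of such
  codes. The last three abbreviations pass between the two readings.\<close>

abbreviation "smult_code \<equiv> map_coeff complex_mult"
abbreviation "complexify \<equiv> map_coeff (\<lambda>_ c. prod_encode (c, 0)) 0"
abbreviation "Re_code \<equiv> map_coeff (\<lambda>_ c. fst (prod_decode c)) 0"
abbreviation "Im_code \<equiv> map_coeff (\<lambda>_ c. snd (prod_decode c)) 0"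

text \<open>The product reverses the first word; this is harmless since codes will be evaluated in
  commutative algebras.\<close>

definition mono_mult :: "nat \<Rightarrow> nat \<Rightarrow> nat" where
  "mono_mult u w = mono_code (complex_mult (mono_coeff u) (mono_coeff w)) (mono_head u)
     (rev_append (mono_rest u) (cons_code (mono_head w) (mono_rest w)))"

definition mono_mult_poly :: "nat \<Rightarrow> nat \<Rightarrow> nat \<Rightarrow> nat" where
  "mono_mult_poly m acc u = fold (\<lambda>w acc. cons_code (mono_mult u w) acc) (list_decode m) acc"

definition mult_code :: "nat \<Rightarrow> nat \<Rightarrow> nat" where
  "mult_code n m = fold (\<lambda>u acc. mono_mult_poly m acc u) (list_decode n) 0"

text \<open>Multiplies out the polynomials substituted for the letters of a word. The product starts
  from the first letter, as there is no code for the constant 1.\<close>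

definition subst_word :: "(nat \<Rightarrow> nat) \<Rightarrow> nat \<Rightarrow> nat \<Rightarrow> nat" where
  "subst_word \<sigma> x xs = fold (\<lambda>y acc. mult_code acc (\<sigma> y)) (list_decode xs) (\<sigma> x)"

definition subst_code :: "(nat \<Rightarrow> nat) \<Rightarrow> nat \<Rightarrow> nat" where
  "subst_code \<sigma> n = fold (\<lambda>u acc. rev_append (smult_code (mono_coeff u) (subst_word \<sigma> (mono_head u) (mono_rest u))) acc)
     (list_decode n) 0"

lemma rec_smult_code: "rec_fun k f \<Longrightarrow> rec_fun k g \<Longrightarrow> rec_fun k (\<lambda>xs. smult_code (f xs) (g xs))"
  by (intro rec_map_coeff rec_complex_mult rec_proj) auto

lemma rec_coeff_codes:
  "rec_fun k g \<Longrightarrow> rec_fun k (\<lambda>xs. complexify (g xs))"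
  "rec_fun k g \<Longrightarrow> rec_fun k (\<lambda>xs. Re_code (g xs))"
  "rec_fun k g \<Longrightarrow> rec_fun k (\<lambda>xs. Im_code (g xs))"
  by (intro rec_map_coeff rec_intros; simp)+

lemma rec_mult_code: "rec_fun k f \<Longrightarrow> rec_fun k g \<Longrightarrow> rec_fun k (\<lambda>xs. mult_code (f xs) (g xs))"
proof -
  have 1: "rec_fun3 mono_mult_poly"
    unfolding mono_mult_poly_def mono_mult_def
    by (intro rec_fold rec_cons_code rec_mono rec_rev_append rec_complex_mult rec_proj) auto
  \<comment> \<open>The fold rule hands one fixed parameter to the step: the second factor in this
    outer fold, the current monomial in the inner one.\<close>
  have "rec_fun3 (\<lambda>n acc m. fold (\<lambda>u acc. mono_mult_poly m acc u) (list_decode n) acc)"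
    by (intro rec_fold rec_app3[OF 1] rec_proj) auto
  from rec_app3[OF this _ rec_const]
  show "rec_fun k f \<Longrightarrow> rec_fun k g \<Longrightarrow> rec_fun k (\<lambda>xs. mult_code (f xs) (g xs))"
    unfolding mult_code_def by simp
qed

lemma rec_subst_code:
  assumes "rec_fun1 \<sigma>" "rec_fun k f"
  shows "rec_fun k (\<lambda>xs. subst_code \<sigma> (f xs))"
proof -
  note \<sigma> = rec_app1[OF assms(1)]
  have "rec_fun3 (\<lambda>n acc p. fold (\<lambda>y acc. mult_code acc (\<sigma> y)) (list_decode n) acc)"
    by (intro rec_fold rec_mult_code \<sigma> rec_proj) auto
  from rec_app3[OF this rec_proj[of 1] \<sigma>[OF rec_proj[of 0]] rec_const, of 2]
  have "rec_fun2 (subst_word \<sigma>)"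
    unfolding subst_word_def by simp
  note w = rec_app2[OF this]
  have "rec_fun3 (\<lambda>n acc p.
      fold (\<lambda>u acc. rev_append (smult_code (mono_coeff u) (subst_word \<sigma> (mono_head u) (mono_rest u))) acc) (list_decode n) acc)"
    by (intro rec_fold rec_rev_append rec_smult_code w rec_mono rec_proj) auto
  from rec_app3[OF this assms(2) rec_const rec_const] show ?thesis
    unfolding subst_code_def by simp
qed

section \<open>Letters occurring in computed codes\<close>

lemma letters_rev_append [simp]:
  "letters_of_code (rev_append n m) = letters_of_code n \<union> letters_of_code m"
  by (auto simp: letters_of_code_eq)

lemma letters_mono_mult [simp]: "mono_letters (mono_mult u w) = mono_letters u \<union> mono_letters w"
  by (auto simp: mono_mult_def mono_letters_def)

lemma letters_mono_mult_poly:
  "letters_of_code (mono_mult_poly m acc u) \<subseteq> letters_of_code m \<union> letters_of_code acc \<union> mono_letters u"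
  unfolding mono_mult_poly_def letters_of_code_eq
  by (subst list_decode_fold_cons_code) auto

text \<open>Only an inclusion, since a product with the empty sum has no letters. The inclusion is
  what keeps computed codes admissible.\<close>

lemma letters_mult_code: "letters_of_code (mult_code n m) \<subseteq> letters_of_code n \<union> letters_of_code m"
proof -
  have "letters_of_code (fold (\<lambda>u acc. mono_mult_poly m acc u) us acc)
      \<subseteq> \<Union> (mono_letters ` set us) \<union> letters_of_code m \<union> letters_of_code acc" for us acc
  proof (induction us arbitrary: acc)
    case (Cons u us)
    show ?case
      using Cons[of "mono_mult_poly m acc u"] letters_mono_mult_poly[of m acc u] by auto
  qed simp
  from this[of "list_decode n" 0] show ?thesis
    by (simp add: mult_code_def) (auto simp: letters_of_code_eq)
qed

lemma letters_subst_word: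
  "letters_of_code (subst_word \<sigma> x xs) \<subseteq> (\<Union>y\<in>insert x (set (list_decode xs)). letters_of_code (\<sigma> y))"
proof -
  have "letters_of_code (fold (\<lambda>y acc. mult_code acc (\<sigma> y)) ys acc)
      \<subseteq> letters_of_code acc \<union> (\<Union>y\<in>set ys. letters_of_code (\<sigma> y))" for ys acc
  proof (induction ys arbitrary: acc)
    case (Cons y ys)
    show ?case
      using Cons[of "mult_code acc (\<sigma> y)"] letters_mult_code[of acc "\<sigma> y"] by auto
  qed simp
  from this[of "list_decode xs" "\<sigma> x"] show ?thesis
    by (auto simp: subst_word_def)
qed

lemma letters_subst_code:
  "letters_of_code (subst_code \<sigma> n) \<subseteq> (\<Union>y\<in>letters_of_code n. letters_of_code (\<sigma> y))"
proof -
  have "letters_of_code (fold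
        (\<lambda>u acc. rev_append (smult_code (mono_coeff u) (subst_word \<sigma> (mono_head u) (mono_rest u))) acc) us acc)
      \<subseteq> letters_of_code acc \<union> (\<Union>u\<in>set us. \<Union>y\<in>mono_letters u. letters_of_code (\<sigma> y))" for us acc
  proof (induction us arbitrary: acc)
    case (Cons u us)
    show ?case
      using Cons[of "rev_append (smult_code (mono_coeff u) (subst_word \<sigma> (mono_head u) (mono_rest u))) acc"]
        letters_subst_word[of \<sigma> "mono_head u" "mono_rest u"] by (auto simp: mono_letters_def)
  qed simp
  from this[of "list_decode n" 0] show ?thesis
    by (simp add: subst_code_def) (auto simp: letters_of_code_eq)
qed

section \<open>Evaluation of codes in abelian star algebras\<close>

locale abelian_star_algebra = banach_star_algebra_on B sc star
  for B :: "'b::real_normed_algebra set" and sc :: "complex \<Rightarrow> 'b \<Rightarrow> 'b" and star :: "'b \<Rightarrow> 'b" +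
  assumes commute: "x \<in> B \<Longrightarrow> y \<in> B \<Longrightarrow> x * y = y * x"
begin

lemma zero_in: "0 \<in> B" and add_in: "x \<in> B \<Longrightarrow> y \<in> B \<Longrightarrow> x + y \<in> B"
  and sc_in: "x \<in> B \<Longrightarrow> sc c x \<in> B"
  using subspace by (auto simp: subspace_on_def)

text \<open>With \<open>j\<close>, complex scalars reduce to \<open>*\<^sub>R\<close> by
  \<open>sc_eq\<close>, so that calculations in B only need real-linear rules.\<close>

definition j :: "'b \<Rightarrow> 'b" where "j x = sc \<i> x"

lemma scaleR_in: "x \<in> B \<Longrightarrow> r *\<^sub>R x \<in> B"
  using sc_in[of x "of_real r"] by (simp add: sc_of_real)

lemma minus_in: "x \<in> B \<Longrightarrow> - x \<in> B"
  using scaleR_in[of x "-1"] by simp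

lemma diff_in: "x \<in> B \<Longrightarrow> y \<in> B \<Longrightarrow> x - y \<in> B"
  using add_in[of x "- y"] minus_in by simp

lemma j_in: "x \<in> B \<Longrightarrow> j x \<in> B"
  by (simp add: j_def sc_in)

lemmas closed_rules = zero_in add_in sc_in scaleR_in minus_in diff_in j_in mult_closed star_closed

lemma j_add: "x \<in> B \<Longrightarrow> y \<in> B \<Longrightarrow> j (x + y) = j x + j y"
  by (simp add: j_def sc_right_distrib)

lemma j_scaleR: "x \<in> B \<Longrightarrow> j (r *\<^sub>R x) = r *\<^sub>R j x"
  using sc_sc[of x \<i> "of_real r"] sc_sc[of x "of_real r" \<i>] sc_of_real[of "sc \<i> x" r]
  by (simp add: j_def sc_of_real sc_in mult.commute)

lemma j_minus: "x \<in> B \<Longrightarrow> j (- x) = - j x"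
  using j_scaleR[of x "-1"] by simp

lemma j_diff: "x \<in> B \<Longrightarrow> y \<in> B \<Longrightarrow> j (x - y) = j x - j y"
  using j_add[of x "- y"] j_minus[of y] minus_in by simp

lemma j_j: "x \<in> B \<Longrightarrow> j (j x) = - x"
  using sc_of_real[of x "-1"] by (simp add: j_def sc_sc)

lemma j_mult: "x \<in> B \<Longrightarrow> y \<in> B \<Longrightarrow> j x * y = j (x * y)" "x \<in> B \<Longrightarrow> y \<in> B \<Longrightarrow> x * j y = j (x * y)"
  by (simp_all add: j_def sc_mult_left sc_mult_right)

lemma norm_j: "x \<in> B \<Longrightarrow> norm (j x) = norm x"
  by (simp add: j_def norm_sc)

lemma sc_eq: "x \<in> B \<Longrightarrow> sc c x = Re c *\<^sub>R x + Im c *\<^sub>R j x"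
  using sc_left_distrib[of x "of_real (Re c)" "\<i> * of_real (Im c)"] sc_sc[of x "of_real (Im c)" \<i>]
  by (simp add: complex_eq[symmetric] sc_of_real j_def sc_in mult.commute)

lemma star_scaleR: "x \<in> B \<Longrightarrow> star (r *\<^sub>R x) = r *\<^sub>R star x"
  using star_sc[of x "of_real r"] by (simp add: sc_of_real star_closed scalar_cnj_complex_def)

lemma star_minus: "x \<in> B \<Longrightarrow> star (- x) = - star x"
  using star_scaleR[of x "-1"] by simp

lemma star_diff: "x \<in> B \<Longrightarrow> y \<in> B \<Longrightarrow> star (x - y) = star x - star y"
  using star_add[of x "- y"] star_minus[of y] minus_in by simp

lemma star_j: "x \<in> B \<Longrightarrow> star (j x) = - j (star x)"
  using star_sc[of x \<i>] sc_eq[of "star x" "- \<i>"] by (simp add: j_def scalar_cnj_complex_def star_closed)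

lemmas j_simps = j_add j_scaleR j_minus j_diff j_j j_mult star_scaleR star_minus star_diff star_j
  star_add star_star

section \<open>Self-adjoint elements, real and imaginary parts\<close>

definition A :: "'b set" where "A = {x \<in> B. star x = x}"

lemma A_iff: "x \<in> A \<longleftrightarrow> x \<in> B \<and> star x = x"
  by (simp add: A_def)

lemma A_in_B: "x \<in> A \<Longrightarrow> x \<in> B" and star_A: "x \<in> A \<Longrightarrow> star x = x"
  by (simp_all add: A_def)

lemma zero_in_A: "0 \<in> A"
  using star_scaleR[of 0 0] by (simp add: A_def zero_in)

lemma add_in_A: "x \<in> A \<Longrightarrow> y \<in> A \<Longrightarrow> x + y \<in> A"
  and scaleR_in_A: "x \<in> A \<Longrightarrow> r *\<^sub>R x \<in> A"
  and mult_in_A: "x \<in> A \<Longrightarrow> y \<in> A \<Longrightarrow> x * y \<in> A"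
  by (auto simp: A_def closed_rules star_add star_scaleR star_mult commute)

lemma minus_in_A: "x \<in> A \<Longrightarrow> - x \<in> A"
  using scaleR_in_A[of x "-1"] by simp

lemma diff_in_A: "x \<in> A \<Longrightarrow> y \<in> A \<Longrightarrow> x - y \<in> A"
  using add_in_A[of x "- y"] minus_in_A by simp

definition re :: "'b \<Rightarrow> 'b" where "re x = (1/2) *\<^sub>R (x + star x)"
definition im :: "'b \<Rightarrow> 'b" where "im x = - (1/2) *\<^sub>R j (x - star x)"

lemma re_in_A: "x \<in> B \<Longrightarrow> re x \<in> A"
  by (simp add: A_def re_def closed_rules j_simps add.commute)

lemma im_in_A: "x \<in> B \<Longrightarrow> im x \<in> A"
  by (simp add: A_def im_def closed_rules j_simps)

lemma re_im: "x \<in> B \<Longrightarrow> re x + j (im x) = x"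
  by (simp add: re_def im_def closed_rules j_simps algebra_simps flip: scaleR_left_distrib)

lemma re_eq: "x \<in> A \<Longrightarrow> y \<in> A \<Longrightarrow> re (x + j y) = x"
  by (simp add: re_def closed_rules j_simps algebra_simps A_in_B star_A flip: scaleR_left_distrib)

lemma im_eq: "x \<in> A \<Longrightarrow> y \<in> A \<Longrightarrow> im (x + j y) = y"
  by (simp add: im_def closed_rules j_simps algebra_simps A_in_B star_A flip: scaleR_left_distrib)

text \<open>The involution is isometric, so \<open>re\<close> and \<open>im\<close> are
  contractions: limits and approximations in B pass to their parts in A.\<close>

lemma norm_re_le: "x \<in> B \<Longrightarrow> norm (re x) \<le> norm x"
  using norm_triangle_ineq[of x "star x"] by (simp add: re_def norm_star)

lemma norm_im_le: "x \<in> B \<Longrightarrow> norm (im x) \<le> norm x"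
  using norm_triangle_ineq4[of x "star x"] by (simp add: im_def norm_j norm_star closed_rules)

lemma re_add: "x \<in> B \<Longrightarrow> y \<in> B \<Longrightarrow> re (x + y) = re x + re y"
  by (simp add: re_def j_simps closed_rules algebra_simps)

lemma im_add: "x \<in> B \<Longrightarrow> y \<in> B \<Longrightarrow> im (x + y) = im x + im y"
  by (simp add: im_def j_simps closed_rules algebra_simps)

lemma re_diff: "x \<in> B \<Longrightarrow> y \<in> B \<Longrightarrow> re (x - y) = re x - re y"
  by (simp add: re_def j_simps closed_rules algebra_simps)

lemma im_diff: "x \<in> B \<Longrightarrow> y \<in> B \<Longrightarrow> im (x - y) = im x - im y"
  by (simp add: im_def j_simps closed_rules algebra_simps)

lemma re_A: "x \<in> A \<Longrightarrow> re x = x"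
  by (simp add: re_def A_def flip: scaleR_left_distrib scaleR_2)

lemma re_sc: "a \<in> A \<Longrightarrow> re (sc c a) = Re c *\<^sub>R a" and im_sc: "a \<in> A \<Longrightarrow> im (sc c a) = Im c *\<^sub>R a"
  using re_eq[of "Re c *\<^sub>R a" "Im c *\<^sub>R a"] im_eq[of "Re c *\<^sub>R a" "Im c *\<^sub>R a"]
  by (simp_all add: sc_eq j_scaleR A_in_B scaleR_in_A)

abbreviation scR :: "real \<Rightarrow> 'b \<Rightarrow> 'b" where "scR \<equiv> \<lambda>r. sc (complex_of_real r)"

lemma scR_eq: "x \<in> B \<Longrightarrow> scR r x = r *\<^sub>R x"
  by (rule sc_of_real)

lemma foldl_mult_in:
  assumes "\<And>x y. x \<in> S \<Longrightarrow> y \<in> S \<Longrightarrow> x * y \<in> S" "(a::'b) \<in> S" "set xs \<subseteq> S"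
  shows "foldl (*) a xs \<in> S"
  using assms(2,3) by (induction xs arbitrary: a) (auto simp: assms(1))

lemma mono_word_in_B: "\<forall>y\<in>mono_letters u. v y \<in> B \<Longrightarrow> mono_word v u \<in> B"
  unfolding mono_word_def by (rule foldl_mult_in) (auto simp: mult_closed mono_letters_def)

lemma mono_word_in_A: "\<forall>y\<in>mono_letters u. v y \<in> A \<Longrightarrow> mono_word v u \<in> A"
  unfolding mono_word_def by (rule foldl_mult_in) (auto simp: mult_in_A mono_letters_def)

lemma sum_list_in_B: "\<forall>u\<in>set us. f u \<in> B \<Longrightarrow> (\<Sum>u\<leftarrow>us. f u) \<in> B"
  by (induction us) (auto simp: closed_rules)

lemma eval_in_B: "\<forall>y\<in>letters_of_code n. v y \<in> B \<Longrightarrow> eval_code sc v n \<in> B"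
  unfolding eval_code_eq
  by (intro sum_list_in_B ballI sc_in mono_word_in_B) (auto simp: letters_of_code_eq)

lemma eval_in_A: "\<forall>y\<in>letters_of_code n. v y \<in> A \<Longrightarrow> eval_code scR v n \<in> A"
proof -
  assume v: "\<forall>y\<in>letters_of_code n. v y \<in> A"
  have "\<forall>u\<in>set us. mono_word v u \<in> A \<Longrightarrow>
     (\<Sum>u\<leftarrow>us. scR (scalar_of_code (mono_coeff u)) (mono_word v u)) \<in> A" for us
    by (induction us) (auto simp: zero_in_A add_in_A scR_eq scaleR_in_A A_in_B)
  then show ?thesis
    unfolding eval_code_eq using v by (auto intro!: mono_word_in_A simp: letters_of_code_eq)
qed

lemma eval_rev_append: "eval_code s v (rev_append n m) = eval_code s v n + eval_code s v m"
  by (simp add: eval_code_eq rev_map[symmetric])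

lemma eval_smult_code:
  assumes "\<forall>y\<in>letters_of_code n. v y \<in> B"
  shows "eval_code sc v (smult_code c n) = sc (scalar_of_code c) (eval_code sc v n)"
proof -
  have z: "sc a 0 = 0" for a
    using sc_eq[OF zero_in] j_scaleR[OF zero_in, of 0] by simp
  have "\<forall>u\<in>set us. mono_word v u \<in> B \<Longrightarrow>
     (\<Sum>u\<leftarrow>us. sc (scalar_of_code (complex_mult c (mono_coeff u))) (mono_word v u))
      = sc (scalar_of_code c) (\<Sum>u\<leftarrow>us. sc (scalar_of_code (mono_coeff u)) (mono_word v u))" for us
    by (induction us) (simp_all add: z sc_right_distrib sc_in sum_list_in_B scalar_complex_mult sc_sc)
  then show ?thesis
    unfolding eval_map_coeff unfolding eval_code_eq using assms
    by (auto intro!: mono_word_in_B simp: letters_of_code_eq)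
qed

lemma eval_complexify: "eval_code sc v (complexify n) = eval_code scR v n"
proof -
  \<comment> \<open>Code 0 decodes to the fraction 0 / 1, so the imaginary part added by
    \<open>complexify\<close> vanishes.\<close>
  have "rat_of_code 0 = 0"
    using prod_decode_inverse[of 0] int_encode_inverse[of 0]
    by (simp add: rat_of_code_def prod_decode_def prod_decode_aux.simps int_decode_def sum_decode_def)
  then show ?thesis
    unfolding eval_map_coeff unfolding eval_code_eq
    by (simp add: scalar_of_code_complex scalar_of_code_real_def complex_of_real_def)
qed

text \<open>When the letters have self-adjoint values, so do all words, because A is closed under
  products by commutativity. The real part can then be taken coefficient by coefficient.\<close>

lemma eval_Re_code:
  assumes "\<forall>y\<in>letters_of_code n. v y \<in> A"
  shows "eval_code scR v (Re_code n) = re (eval_code sc v n)"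
proof -
  have "\<forall>u\<in>set us. mono_word v u \<in> A \<Longrightarrow>
     (\<Sum>u\<leftarrow>us. scR (scalar_of_code (fst (prod_decode (mono_coeff u)))) (mono_word v u))
      = re (\<Sum>u\<leftarrow>us. sc (scalar_of_code (mono_coeff u)) (mono_word v u))" for us
    by (induction us)
      (simp_all add: re_A zero_in_A re_add re_sc sc_in sum_list_in_B A_in_B scR_eq scalar_of_code_complex
        scalar_of_code_real_def)
  then show ?thesis
    unfolding eval_map_coeff unfolding eval_code_eq using assms
    by (auto intro!: mono_word_in_A simp: letters_of_code_eq)
qed

lemma eval_Im_code:
  assumes "\<forall>y\<in>letters_of_code n. v y \<in> A"
  shows "eval_code scR v (Im_code n) = im (eval_code sc v n)"
proof -
  have "im 0 = 0"
    using im_sc[OF zero_in_A, of 0] scR_eq[OF zero_in, of 0] by simp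
  then have "\<forall>u\<in>set us. mono_word v u \<in> A \<Longrightarrow>
     (\<Sum>u\<leftarrow>us. scR (scalar_of_code (snd (prod_decode (mono_coeff u)))) (mono_word v u))
      = im (\<Sum>u\<leftarrow>us. sc (scalar_of_code (mono_coeff u)) (mono_word v u))" for us
    by (induction us)
      (simp_all add: zero_in_A im_add im_sc sc_in sum_list_in_B A_in_B scR_eq scalar_of_code_complex
        scalar_of_code_real_def)
  then show ?thesis
    unfolding eval_map_coeff unfolding eval_code_eq using assms
    by (auto intro!: mono_word_in_A simp: letters_of_code_eq)
qed

lemma foldl_mult_left: "foldl (*) (a * b) ys = a * foldl (*) (b::'b) ys"
  by (induction ys arbitrary: b) (simp_all add: mult.assoc)

text \<open>Absorbs the reversal of the first word in \<open>mono_mult\<close>.\<close>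

lemma foldl_mult_rev: "a \<in> B \<Longrightarrow> set xs \<subseteq> B \<Longrightarrow> foldl (*) a (rev xs) = foldl (*) a xs"
proof (induction xs arbitrary: a)
  case (Cons x xs)
  have w: "foldl (*) a xs \<in> B"
    by (rule foldl_mult_in) (use Cons.prems in \<open>auto simp: mult_closed\<close>)
  have "foldl (*) a (rev (x # xs)) = x * foldl (*) a xs"
    using Cons w by (simp add: commute)
  also have "\<dots> = foldl (*) (a * x) xs"
    using foldl_mult_left[of x a xs] Cons.prems by (simp add: commute)
  finally show ?case
    by simp
qed simp

lemma mono_word_mult:
  assumes "\<forall>y\<in>mono_letters u \<union> mono_letters w. v y \<in> B"
  shows "mono_word v (mono_mult u w) = mono_word v u * mono_word v w"
proof -
  have "foldl (*) (v (mono_head u)) (rev (map v (list_decode (mono_rest u))))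
      = foldl (*) (v (mono_head u)) (map v (list_decode (mono_rest u)))"
    by (rule foldl_mult_rev) (use assms in \<open>auto simp: mono_letters_def\<close>)
  then show ?thesis
    unfolding mono_mult_def mono_word_mono_code
    by (simp add: rev_map[symmetric] foldl_mult_left mono_word_def)
qed

lemma sc_mult_sc: "x \<in> B \<Longrightarrow> y \<in> B \<Longrightarrow> sc (c * d) (x * y) = sc c x * sc d y"
  by (simp add: sc_mult_left sc_mult_right sc_in sc_sc mult_closed mult.commute)

lemma eval_mono_mult_poly:
  assumes "\<forall>y\<in>mono_letters u \<union> letters_of_code m. v y \<in> B"
  shows "eval_code sc v (mono_mult_poly m acc u)
    = sc (scalar_of_code (mono_coeff u)) (mono_word v u) * eval_code sc v m + eval_code sc v acc"
proof -
  have "(\<Sum>w\<leftarrow>ws. sc (scalar_of_code (mono_coeff (mono_mult u w))) (mono_word v (mono_mult u w)))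
      = (\<Sum>w\<leftarrow>ws. sc (scalar_of_code (mono_coeff u)) (mono_word v u)
            * sc (scalar_of_code (mono_coeff w)) (mono_word v w))"
    if "\<forall>w\<in>set ws. \<forall>y\<in>mono_letters u \<union> mono_letters w. v y \<in> B" for ws
    using that
  proof (induction ws)
    case (Cons w ws)
    then have "mono_word v (mono_mult u w) = mono_word v u * mono_word v w"
      "mono_word v u \<in> B" "mono_word v w \<in> B"
      by (auto intro!: mono_word_mult mono_word_in_B)
    then show ?case
      using Cons by (simp add: mono_mult_def scalar_complex_mult sc_mult_sc)
  qed simp
  moreover have "\<forall>w\<in>set (list_decode m). \<forall>y\<in>mono_letters u \<union> mono_letters w. v y \<in> B"
    using assms by (auto simp: letters_of_code_eq)
  ultimately show ?thesis
    unfolding eval_code_eq mono_mult_poly_def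
    by (simp add: list_decode_fold_cons_code rev_map[symmetric] comp_def sum_list_const_mult)
qed

lemma eval_mult_code:
  assumes "\<forall>y\<in>letters_of_code n \<union> letters_of_code m. v y \<in> B"
  shows "eval_code sc v (mult_code n m) = eval_code sc v n * eval_code sc v m"
proof -
  have "eval_code sc v (fold (\<lambda>u acc. mono_mult_poly m acc u) us acc)
      = (\<Sum>u\<leftarrow>us. sc (scalar_of_code (mono_coeff u)) (mono_word v u)) * eval_code sc v m
        + eval_code sc v acc"
    if "\<forall>u\<in>set us. \<forall>y\<in>mono_letters u \<union> letters_of_code m. v y \<in> B" for us acc
    using that by (induction us arbitrary: acc) (simp_all add: eval_mono_mult_poly distrib_right)
  from this[of "list_decode n" 0] assms show ?thesis
    by (auto simp: mult_code_def letters_of_code_eq eval_code_eq)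
qed

lemma eval_subst_word:
  assumes "\<forall>y\<in>insert x (set (list_decode xs)). eval_code sc v (\<sigma> y) = w y \<and> (\<forall>z\<in>letters_of_code (\<sigma> y). v z \<in> B)"
  shows "eval_code sc v (subst_word \<sigma> x xs) = foldl (*) (w x) (map w (list_decode xs))"
proof -
  have "eval_code sc v (fold (\<lambda>y acc. mult_code acc (\<sigma> y)) ys acc) = foldl (*) (eval_code sc v acc) (map w ys)"
    if "\<forall>y\<in>set ys. eval_code sc v (\<sigma> y) = w y \<and> (\<forall>z\<in>letters_of_code (\<sigma> y). v z \<in> B)"
      "\<forall>z\<in>letters_of_code acc. v z \<in> B" for ys acc
    using that
  proof (induction ys arbitrary: acc)
    case (Cons y ys)
    then have "\<forall>z\<in>letters_of_code (mult_code acc (\<sigma> y)). v z \<in> B"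
      using letters_mult_code by fastforce
    then show ?case
      using Cons by (simp add: eval_mult_code ball_Un)
  qed simp
  from this[of "list_decode xs" "\<sigma> x"] assms show ?thesis
    by (simp add: subst_word_def)
qed

text \<open>Both hypotheses are confined to letters that occur: a sequence of special points may be
  finite, and its values beyond its length are arbitrary.\<close>

lemma eval_subst_code:
  assumes "\<And>y. y \<in> letters_of_code n \<Longrightarrow> eval_code sc v (\<sigma> y) = w y"
    and "\<And>y z. y \<in> letters_of_code n \<Longrightarrow> z \<in> letters_of_code (\<sigma> y) \<Longrightarrow> v z \<in> B"
  shows "eval_code sc v (subst_code \<sigma> n) = eval_code sc w n"
proof -
  have "eval_code sc v (fold
        (\<lambda>u acc. rev_append (smult_code (mono_coeff u) (subst_word \<sigma> (mono_head u) (mono_rest u))) acc) us acc)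
      = (\<Sum>u\<leftarrow>us. sc (scalar_of_code (mono_coeff u)) (mono_word w u)) + eval_code sc v acc"
    if "\<forall>u\<in>set us. \<forall>y\<in>mono_letters u. eval_code sc v (\<sigma> y) = w y \<and> (\<forall>z\<in>letters_of_code (\<sigma> y). v z \<in> B)"
    for us acc
    using that
  proof (induction us arbitrary: acc)
    case (Cons u us)
    have 1: "eval_code sc v (subst_word \<sigma> (mono_head u) (mono_rest u)) = mono_word w u"
      unfolding mono_word_def by (rule eval_subst_word) (use Cons.prems in \<open>auto simp: mono_letters_def\<close>)
    have 2: "\<forall>z\<in>letters_of_code (subst_word \<sigma> (mono_head u) (mono_rest u)). v z \<in> B"
      using letters_subst_word[of \<sigma> "mono_head u" "mono_rest u"] Cons.prems
      by (auto simp: mono_letters_def)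
    show ?case
      using Cons by (simp add: eval_rev_append eval_smult_code[OF 2] 1 ac_simps)
  qed simp
  from this[of "list_decode n" 0] assms show ?thesis
    by (auto simp: subst_code_def letters_of_code_eq eval_code_eq)
qed

end

section \<open>Real Hilbert spaces\<close>

locale real_hilbert_space = hilbert_space H sc ip
  for H :: "'h::ab_group_add set" and sc :: "real \<Rightarrow> 'h \<Rightarrow> 'h" and ip :: "'h \<Rightarrow> 'h \<Rightarrow> real"
begin

lemma zero_in: "0 \<in> H" and add_in: "x \<in> H \<Longrightarrow> y \<in> H \<Longrightarrow> x + y \<in> H"
  and sc_in: "x \<in> H \<Longrightarrow> sc c x \<in> H"
  using subspace by (auto simp: subspace_on_def)

lemma sc_minus_one: "x \<in> H \<Longrightarrow> sc (- 1) x = - x"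
  using sc_left_distrib[of x 0 0] sc_left_distrib[of x 1 "- 1"]
  by (simp add: sc_one minus_unique)

lemma minus_in: "x \<in> H \<Longrightarrow> - x \<in> H"
  using sc_in[of x "- 1"] by (simp add: sc_minus_one)

lemma diff_in: "x \<in> H \<Longrightarrow> y \<in> H \<Longrightarrow> x - y \<in> H"
  using add_in[of x "- y"] minus_in by simp

lemma ip_sym: "x \<in> H \<Longrightarrow> y \<in> H \<Longrightarrow> ip y x = ip x y"
  using ip_cnj[of x y] by (simp add: scalar_cnj_real_def)

lemma ip_minus: "x \<in> H \<Longrightarrow> y \<in> H \<Longrightarrow> ip (- x) y = - ip x y"
  using ip_scale[of x y "- 1"] by (simp add: sc_minus_one)

lemma ip_diff: "x \<in> H \<Longrightarrow> y \<in> H \<Longrightarrow> z \<in> H \<Longrightarrow> ip (x - y) z = ip x z - ip y z"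
  using ip_add[of x "- y" z] ip_minus[of y z] minus_in by simp

lemma ip_add_right: "x \<in> H \<Longrightarrow> y \<in> H \<Longrightarrow> z \<in> H \<Longrightarrow> ip z (x + y) = ip z x + ip z y"
  by (simp add: ip_sym[of _ z] add_in ip_add)

lemma ip_diff_right: "x \<in> H \<Longrightarrow> y \<in> H \<Longrightarrow> z \<in> H \<Longrightarrow> ip z (x - y) = ip z x - ip z y"
  by (simp add: ip_sym[of _ z] diff_in ip_diff)

lemma ip_scale_right: "x \<in> H \<Longrightarrow> y \<in> H \<Longrightarrow> ip x (sc c y) = c * ip x y"
  using ip_scale[of y x c] by (simp add: ip_sym[of _ x] sc_in)

lemma ip_self_nonneg: "x \<in> H \<Longrightarrow> 0 \<le> ip x x"
  using ip_pos[of x] ip_diff[of x x x] by (cases "x = 0") auto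

lemma hnorm_nonneg: "0 \<le> hnorm ip x"
  by (simp add: hnorm_def)

lemma hnorm_sq: "x \<in> H \<Longrightarrow> (hnorm ip x)\<^sup>2 = ip x x"
  by (simp add: hnorm_def ip_self_nonneg)

lemma hnorm_eq_0: "x \<in> H \<Longrightarrow> hnorm ip x = 0 \<Longrightarrow> x = 0"
  using ip_pos[of x] by (auto simp: hnorm_def)

lemma hnorm_sc: "x \<in> H \<Longrightarrow> hnorm ip (sc c x) = \<bar>c\<bar> * hnorm ip x"
  by (simp add: hnorm_def ip_scale ip_scale_right sc_in real_sqrt_mult abs_mult mult.assoc[symmetric] flip: power2_eq_square)

lemma hnorm_minus: "x \<in> H \<Longrightarrow> hnorm ip (- x) = hnorm ip x"
  using hnorm_sc[of x "- 1"] by (simp add: sc_minus_one)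

lemma cauchy_schwarz:
  assumes x: "x \<in> H" and y: "y \<in> H"
  shows "ip x y \<le> hnorm ip x * hnorm ip y"
proof (cases "hnorm ip x = 0")
  case True
  then have "ip x y = 0"
    using hnorm_eq_0[OF x True] ip_diff[of 0 0 y] zero_in y by simp
  then show ?thesis
    using True by simp
next
  case False
  define a b where "a = hnorm ip x" and "b = hnorm ip y"
  have a: "a > 0"
    using False hnorm_nonneg[of x] by (simp add: a_def less_le)
  \<comment> \<open>The scaling by the norms turns the expansion into 2 a b (a b - <x, y>).
    Cancelling 2 a b requires b > 0, hence the separate case b = 0.\<close>
  have "0 \<le> ip (sc b x - sc a y) (sc b x - sc a y)"
    by (intro ip_self_nonneg diff_in sc_in x y)
  also have "\<dots> = b\<^sup>2 * a\<^sup>2 - 2 * a * b * ip x y + a\<^sup>2 * b\<^sup>2"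
  proof -
    have "ip x x = a\<^sup>2" "ip y y = b\<^sup>2"
      using x y by (simp_all add: a_def b_def hnorm_sq)
    then show ?thesis
      using x y ip_sym[OF x y]
      by (simp add: ip_diff ip_diff_right ip_scale ip_scale_right sc_in diff_in)
        (simp add: algebra_simps power2_eq_square)
  qed
  finally have "2 * a * b * ip x y \<le> 2 * a * b * (a * b)"
    by (simp add: algebra_simps power2_eq_square)
  moreover have ?thesis if "b = 0"
  proof -
    have "y = 0"
      using hnorm_eq_0[OF y] that by (simp add: b_def)
    then show ?thesis
      using ip_diff_right[of 0 0 x] zero_in x hnorm_nonneg[of x] hnorm_nonneg[of y] by simp
  qed
  moreover have "b \<ge> 0"
    by (simp add: b_def hnorm_nonneg)
  ultimately show ?thesis
    using a by (cases "b = 0") (auto simp: a_def b_def)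
qed

lemma hnorm_triangle:
  assumes x: "x \<in> H" and y: "y \<in> H"
  shows "hnorm ip (x + y) \<le> hnorm ip x + hnorm ip y"
proof (rule power2_le_imp_le)
  show "(hnorm ip (x + y))\<^sup>2 \<le> (hnorm ip x + hnorm ip y)\<^sup>2"
    using cauchy_schwarz[OF x y] ip_sym[OF x y] x y
    by (simp add: hnorm_sq ip_add ip_add_right add_in power2_sum)
qed (simp add: hnorm_nonneg)

lemma hnorm_triangle_diff:
  "x \<in> H \<Longrightarrow> y \<in> H \<Longrightarrow> hnorm ip (x - y) \<le> hnorm ip x + hnorm ip y"
  using hnorm_triangle[of x "- y"] by (simp add: minus_in hnorm_minus)

lemma hnorm_zero: "hnorm ip 0 = 0"
  using ip_diff[of 0 0 0] zero_in by (simp add: hnorm_def)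

text \<open>The third part makes \<open>operator_norm\<close> meaningful: a supremum of reals is
  only controlled when the set is bounded above.\<close>

lemma bounded_operatorsD:
  assumes "T \<in> bounded_operators H sc ip"
  shows "x \<in> H \<Longrightarrow> T x \<in> H" "x \<in> H \<Longrightarrow> T (sc c x) = sc c (T x)"
    "bdd_above ((\<lambda>x. hnorm ip (T x)) ` {x \<in> H. hnorm ip x \<le> 1})"
proof -
  obtain C where C: "\<And>x. x \<in> H \<Longrightarrow> hnorm ip (T x) \<le> C * hnorm ip x"
    using assms unfolding bounded_operators_def by blast
  have "hnorm ip (T x) \<le> \<bar>C\<bar>" if "x \<in> H" "hnorm ip x \<le> 1" for x
  proof -
    have "C * hnorm ip x \<le> \<bar>C\<bar> * 1"
      using that hnorm_nonneg[of x] by (intro mult_mono) auto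
    then show ?thesis
      using C[OF that(1)] by simp
  qed
  then show "bdd_above ((\<lambda>x. hnorm ip (T x)) ` {x \<in> H. hnorm ip x \<le> 1})"
    by (intro bdd_aboveI[of _ "\<bar>C\<bar>"]) auto
qed (use assms in \<open>auto simp: bounded_operators_def\<close>)

lemma le_operator_norm:
  assumes "T \<in> bounded_operators H sc ip" "x \<in> H" "hnorm ip x \<le> 1"
  shows "hnorm ip (T x) \<le> operator_norm H ip T"
  unfolding operator_norm_def by (rule cSUP_upper) (use assms bounded_operatorsD(3)[OF assms(1)] in auto)

lemma operator_norm_le:
  assumes "\<And>x. x \<in> H \<Longrightarrow> hnorm ip x \<le> 1 \<Longrightarrow> hnorm ip (T x) \<le> c"
  shows "operator_norm H ip T \<le> c"
  unfolding operator_norm_def by (rule cSUP_least) (use zero_in hnorm_zero assms in auto)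

lemma hnorm_operator:
  assumes T: "T \<in> bounded_operators H sc ip" and x: "x \<in> H"
  shows "hnorm ip (T x) \<le> operator_norm H ip T * hnorm ip x"
proof (cases "hnorm ip x = 0")
  case True
  then have "T x = 0"
    using hnorm_eq_0[OF x] bounded_operatorsD(2)[OF T x, of 0] sc_left_distrib[of _ 0 0]
      bounded_operatorsD(1)[OF T x] x by (metis add_cancel_right_right)
  then show ?thesis
    using True by (simp add: hnorm_zero)
next
  case False
  then have pos: "hnorm ip x > 0"
    using hnorm_nonneg[of x] by simp
  let ?y = "sc (1 / hnorm ip x) x"
  have "hnorm ip (T ?y) \<le> operator_norm H ip T"
    by (rule le_operator_norm) (use T x pos in \<open>auto simp: sc_in hnorm_sc\<close>)
  then show ?thesis
    using T x pos by (simp add: bounded_operatorsD hnorm_sc field_simps)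
qed

text \<open>Makes the norm estimates applicable to \<open>X n - T\<close> when a sequence of
  operators approaches a limit.\<close>

lemma bounded_operators_diff:
  assumes S: "S \<in> bounded_operators H sc ip" and T: "T \<in> bounded_operators H sc ip"
  shows "S - T \<in> bounded_operators H sc ip"
proof -
  have "hnorm ip ((S - T) x) \<le> (operator_norm H ip S + operator_norm H ip T) * hnorm ip x" if "x \<in> H" for x
    using hnorm_triangle_diff[of "S x" "T x"] hnorm_operator[OF S that] hnorm_operator[OF T that]
      bounded_operatorsD(1)[OF S that] bounded_operatorsD(1)[OF T that]
    by (simp add: distrib_right)
  moreover have "sc c x - sc c y = sc c (x - y)" if "x \<in> H" "y \<in> H" for c x y
    using sc_right_distrib[of "x - y" y c] that by (simp add: diff_in algebra_simps)
  ultimately show ?thesis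
    using S T unfolding bounded_operators_def by (auto simp: diff_in)
qed

end

text \<open>Restriction of scalars. Since <x, x> is real, passing to the real part of the inner
  product keeps the norm, and completeness with it. A acts on this real space, and estimates for B
  can be made there too.\<close>

lemma real_hilbert_space_Re:
  assumes "hilbert_space H hsc (ip :: 'h::ab_group_add \<Rightarrow> 'h \<Rightarrow> complex)"
  shows "real_hilbert_space H (\<lambda>r. hsc (complex_of_real r)) (\<lambda>x y. Re (ip x y))"
    and "x \<in> H \<Longrightarrow> hnorm (\<lambda>x y. Re (ip x y)) x = hnorm ip x"
proof -
  interpret hilbert_space H hsc ip by fact
  have "norm (ip x x) = \<bar>Re (ip x x)\<bar>" if "x \<in> H" for x
  proof -
    have "Im (ip x x) = 0"
      using ip_cnj[of x x] that by (simp add: scalar_cnj_complex_def complex_eq_iff)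
    then show ?thesis
      by (simp add: cmod_eq_Re)
  qed
  then show eq: "hnorm (\<lambda>x y. Re (ip x y)) x = hnorm ip x" if "x \<in> H" for x
    using that by (simp add: hnorm_def)
  have zero: "0 \<in> H" and add: "\<And>x y. x \<in> H \<Longrightarrow> y \<in> H \<Longrightarrow> x + y \<in> H" and sc: "\<And>x c. x \<in> H \<Longrightarrow> hsc c x \<in> H"
    using subspace by (auto simp: subspace_on_def)
  have diff: "x - y \<in> H" if "x \<in> H" "y \<in> H" for x y
  proof -
    have "hsc (- 1) y = - y"
      using sc_left_distrib[of y 0 0] sc_left_distrib[of y 1 "- 1"] that
      by (simp add: sc_one minus_unique)
    then show ?thesis
      using add[OF that(1) sc[OF that(2), of "- 1"]] by simp
  qed
  show "real_hilbert_space H (\<lambda>r. hsc (complex_of_real r)) (\<lambda>x y. Re (ip x y))"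
  proof
    show "subspace_on (\<lambda>r. hsc (complex_of_real r)) H"
      using zero add sc by (auto simp: subspace_on_def)
    show "\<exists>r>0. Re (ip x x) = of_real r" if "x \<in> H" "x \<noteq> 0" for x
      using ip_pos[OF that] by auto
    show "Re (ip y x) = scalar_cnj (Re (ip x y))" if "x \<in> H" "y \<in> H" for x y
      using ip_cnj[OF that] by (simp add: scalar_cnj_real_def scalar_cnj_complex_def)
    show "\<exists>l\<in>H. (\<lambda>n. hnorm (\<lambda>x y. Re (ip x y)) (X n - l)) \<longlonglongrightarrow> 0"
      if X: "\<And>n. X n \<in> H"
        and cauchy: "\<And>e. e > 0 \<Longrightarrow> \<exists>N. \<forall>m\<ge>N. \<forall>n\<ge>N. hnorm (\<lambda>x y. Re (ip x y)) (X m - X n) < e" for X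
    proof -
      have "\<exists>l\<in>H. (\<lambda>n. hnorm ip (X n - l)) \<longlonglongrightarrow> 0"
      proof (rule complete_H)
        show "X n \<in> H" for n
          by (rule X)
        show "\<exists>N. \<forall>m\<ge>N. \<forall>n\<ge>N. hnorm ip (X m - X n) < e" if "e > 0" for e
          using cauchy[OF that] X by (simp add: eq diff)
      qed
      then show ?thesis
        using X by (auto simp: eq diff)
    qed
  qed (auto simp: sc_right_distrib sc_left_distrib sc_sc sc_one ip_add ip_scale)
qed

section \<open>Abelian C*-algebras and their self-adjoint parts\<close>

text \<open>The norms agree on H, so boundedness is unaffected by restricting scalars and the two
  classes of operators differ only in complex homogeneity. The second part asks that T preserve H
  because the norms are compared only there.\<close>

lemma bounded_operators_Re:
  assumes "hilbert_space H hsc (ip :: 'h::ab_group_add \<Rightarrow> 'h \<Rightarrow> complex)"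
  shows "bounded_operators H hsc ip = {T \<in> bounded_operators H (\<lambda>r. hsc (complex_of_real r)) (\<lambda>x y. Re (ip x y)).
      \<forall>c. \<forall>x\<in>H. T (hsc c x) = hsc c (T x)}"
    and "(\<And>x. x \<in> H \<Longrightarrow> T x \<in> H) \<Longrightarrow> operator_norm H (\<lambda>x y. Re (ip x y)) T = operator_norm H ip T"
proof -
  note eq = real_hilbert_space_Re(2)[OF assms]
  show "bounded_operators H hsc ip = {T \<in> bounded_operators H (\<lambda>r. hsc (complex_of_real r)) (\<lambda>x y. Re (ip x y)).
      \<forall>c. \<forall>x\<in>H. T (hsc c x) = hsc c (T x)}"
    unfolding bounded_operators_def by (auto simp: eq; blast)
  show "operator_norm H (\<lambda>x y. Re (ip x y)) T = operator_norm H ip T" if "\<And>x. x \<in> H \<Longrightarrow> T x \<in> H"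
  proof -
    have "{x \<in> H. hnorm (\<lambda>x y. Re (ip x y)) x \<le> 1} = {x \<in> H. hnorm ip x \<le> 1}"
      using eq by auto
    then show ?thesis
      unfolding operator_norm_def by (auto intro!: SUP_cong simp: eq that)
  qed
qed

locale abelian_cstar_algebra = abelian_star_algebra B sc star
  for B :: "'b::real_normed_algebra set" and sc :: "complex \<Rightarrow> 'b \<Rightarrow> 'b" and star :: "'b \<Rightarrow> 'b" +
  assumes cstar: "cstar_algebra B sc star"
begin

text \<open>Forgets the complex structure of the Hilbert space, so that the norm estimates below
  become inequalities between real inner products.\<close>

lemma representation:
  obtains H :: "('b \<Rightarrow> complex) set" and hsc ip \<pi> where
    "real_hilbert_space H hsc ip"
    "\<And>x. x \<in> B \<Longrightarrow> \<pi> x \<in> bounded_operators H hsc ip"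
    "\<And>x y. x \<in> B \<Longrightarrow> y \<in> B \<Longrightarrow> \<pi> (x + y) = \<pi> x + \<pi> y"
    "\<And>x y. x \<in> B \<Longrightarrow> y \<in> B \<Longrightarrow> \<pi> (x * y) = \<pi> x \<circ> \<pi> y"
    "\<And>x. x \<in> B \<Longrightarrow> adjoint_on H ip (\<pi> x) (\<pi> (star x))"
    "\<And>x. x \<in> B \<Longrightarrow> operator_norm H ip (\<pi> x) = norm x"
proof -
  obtain H :: "('b \<Rightarrow> complex) set" and hsc ip M \<pi> where
    H: "hilbert_space H hsc (ip :: _ \<Rightarrow> _ \<Rightarrow> complex)" and M: "closed_operator_star_algebra H hsc ip M"
    and \<pi>: "bij_betw \<pi> B M" "\<forall>x\<in>B. \<forall>y\<in>B. \<pi> (x + y) = \<pi> x + \<pi> y"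
      "\<forall>x\<in>B. \<forall>y\<in>B. \<pi> (x * y) = \<pi> x \<circ> \<pi> y" "\<forall>x\<in>B. adjoint_on H ip (\<pi> x) (\<pi> (star x))"
      "\<forall>x\<in>B. operator_norm H ip (\<pi> x) = norm x"
    using cstar unfolding cstar_algebra_def by blast
  have bdd: "\<pi> x \<in> bounded_operators H hsc ip" if "x \<in> B" for x
    using M \<pi>(1) that by (auto simp: closed_operator_star_algebra_def bij_betw_def)
  show thesis
  proof (rule that[of H "\<lambda>r. hsc (complex_of_real r)" "\<lambda>x y. Re (ip x y)" \<pi>])
    show "operator_norm H (\<lambda>x y. Re (ip x y)) (\<pi> x) = norm x" if "x \<in> B" for x
      using bounded_operators_Re(2)[OF H, of "\<pi> x"] bdd[OF that] \<pi>(5) that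
      by (simp add: bounded_operators_def)
  qed (use real_hilbert_space_Re(1)[OF H] bdd bounded_operators_Re(1)[OF H] \<pi> in
      \<open>auto simp: adjoint_on_def\<close>)
qed

text \<open>For v in the unit ball, ||x v||^2 = <v, x* x v> is at most ||x* x|| by Cauchy-Schwarz.
  The converse inequality is submultiplicativity together with isometry of the involution.\<close>

lemma cstar_identity:
  assumes x: "x \<in> B"
  shows "(norm x)\<^sup>2 = norm (star x * x)"
proof (rule antisym)
  obtain H :: "('b \<Rightarrow> complex) set" and hsc ip \<pi> where
    H: "real_hilbert_space H hsc ip"
    and \<pi>: "\<And>x. x \<in> B \<Longrightarrow> \<pi> x \<in> bounded_operators H hsc ip"
      "\<And>x y. x \<in> B \<Longrightarrow> y \<in> B \<Longrightarrow> \<pi> (x * y) = \<pi> x \<circ> \<pi> y"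
      "\<And>x. x \<in> B \<Longrightarrow> adjoint_on H ip (\<pi> x) (\<pi> (star x))"
      "\<And>x. x \<in> B \<Longrightarrow> operator_norm H ip (\<pi> x) = norm x"
    by (rule representation) blast
  interpret H: real_hilbert_space H hsc ip by fact
  have "hnorm ip (\<pi> x v) \<le> sqrt (norm (star x * x))" if v: "v \<in> H" "hnorm ip v \<le> 1" for v
  proof -
    have px: "\<pi> x v \<in> H" "\<pi> (star x * x) v \<in> H"
      using H.bounded_operatorsD(1)[OF \<pi>(1)] x v by (auto simp: closed_rules)
    have "(hnorm ip (\<pi> x v))\<^sup>2 = ip v (\<pi> (star x * x) v)"
      using \<pi>(3)[OF x] px v \<pi>(2)[of "star x" x] x by (simp add: H.hnorm_sq adjoint_on_def closed_rules)
    also have "\<dots> \<le> hnorm ip v * hnorm ip (\<pi> (star x * x) v)"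
      by (rule H.cauchy_schwarz[OF v(1) px(2)])
    also have "\<dots> \<le> 1 * norm (star x * x)"
      using H.le_operator_norm[OF \<pi>(1) v, of "star x * x"] \<pi>(4)[of "star x * x"] v H.hnorm_nonneg x
      by (intro mult_mono) (auto simp: closed_rules)
    finally show ?thesis
      by (simp add: real_le_rsqrt)
  qed
  then have "norm x \<le> sqrt (norm (star x * x))"
    using H.operator_norm_le[of "\<pi> x"] \<pi>(4)[OF x] by simp
  then have "(norm x)\<^sup>2 \<le> (sqrt (norm (star x * x)))\<^sup>2"
    by (intro power_mono) auto
  then show "(norm x)\<^sup>2 \<le> norm (star x * x)"
    by simp
  show "norm (star x * x) \<le> (norm x)\<^sup>2"
    using norm_mult_ineq[of "star x" x] x by (simp add: norm_star power2_eq_square)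
qed

text \<open>In a function algebra the hypothesis says \<open>a\<^sup>2 + (1 - d)\<^sup>2 = 1\<close>.\<close>
lemma norm_le_1_if_square:
  assumes a: "a \<in> A" and d: "d \<in> A" and eq: "a * a + d * d = d + d"
  shows "norm a \<le> 1"
proof -
  obtain H :: "('b \<Rightarrow> complex) set" and hsc ip \<pi> where
    H: "real_hilbert_space H hsc ip"
    and \<pi>: "\<And>x. x \<in> B \<Longrightarrow> \<pi> x \<in> bounded_operators H hsc ip"
      "\<And>x y. x \<in> B \<Longrightarrow> y \<in> B \<Longrightarrow> \<pi> (x + y) = \<pi> x + \<pi> y"
      "\<And>x y. x \<in> B \<Longrightarrow> y \<in> B \<Longrightarrow> \<pi> (x * y) = \<pi> x \<circ> \<pi> y"
      "\<And>x. x \<in> B \<Longrightarrow> adjoint_on H ip (\<pi> x) (\<pi> (star x))"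
      "\<And>x. x \<in> B \<Longrightarrow> operator_norm H ip (\<pi> x) = norm x"
    by (rule representation) blast
  interpret H: real_hilbert_space H hsc ip by fact
  have "hnorm ip (\<pi> a v) \<le> 1" if v: "v \<in> H" "hnorm ip v \<le> 1" for v
  proof -
    have in_H: "\<pi> x v \<in> H" if "x \<in> B" for x
      using H.bounded_operatorsD(1)[OF \<pi>(1)[OF that] v(1)] .
    have sq: "ip (\<pi> x v) (\<pi> x v) = ip v (\<pi> (x * x) v)" if "x \<in> A" for x
      using \<pi>(4)[of x] \<pi>(3)[of x x] that v in_H by (simp add: adjoint_on_def A_iff)
    have B: "a \<in> B" "d \<in> B" "a * a \<in> B" "d * d \<in> B"
      using a d by (auto simp: A_iff closed_rules)
    have "\<pi> (a * a) v + \<pi> (d * d) v = \<pi> d v + \<pi> d v"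
      using \<pi>(2)[OF B(3,4)] \<pi>(2)[OF B(2,2)] eq by (metis plus_fun_apply)
    then have "ip v (\<pi> (a * a) v + \<pi> (d * d) v) = ip v (\<pi> d v + \<pi> d v)"
      by (rule arg_cong)
    then have "ip v (\<pi> (a * a) v) + ip v (\<pi> (d * d) v) = ip v (\<pi> d v) + ip v (\<pi> d v)"
      using H.ip_add_right v in_H B by metis
    \<comment> \<open>This vector replaces (1 - d) v, which would refer to a unit. Expanding its
      square norm produces the terms of the preceding equation.\<close>
    moreover have "0 \<le> ip (v - \<pi> d v) (v - \<pi> d v)"
      by (intro H.ip_self_nonneg H.diff_in v in_H B)
    ultimately have "(hnorm ip (\<pi> a v))\<^sup>2 \<le> (hnorm ip v)\<^sup>2"
      using v in_H B sq[OF a] sq[OF d] H.ip_sym[OF v(1) in_H[OF B(2)]]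
      by (simp add: H.hnorm_sq H.ip_diff H.ip_diff_right H.diff_in)
    then show ?thesis
      using v(2) H.hnorm_nonneg by (meson order_trans power2_le_imp_le)
  qed
  then show ?thesis
    using H.operator_norm_le[of "\<pi> a" 1] \<pi>(5)[of a] a by (simp add: A_iff)
qed

lemma closed_B: "closed B"
  using complete_A by (rule complete_imp_closed)

lemma star_limit:
  assumes "\<And>n. X n \<in> B" "X \<longlonglongrightarrow> l"
  shows "l \<in> B" "(\<lambda>n. star (X n)) \<longlonglongrightarrow> star l"
proof -
  show l: "l \<in> B"
    using closed_B assms by (rule closed_sequentially)
  have "norm (star (X n) - star l) = norm (X n - l)" for n
    using norm_star[of "X n - l"] assms(1) l by (simp add: star_diff diff_in)
  then show "(\<lambda>n. star (X n)) \<longlonglongrightarrow> star l"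
    using assms(2) by (simp add: LIMSEQ_iff)
qed

lemma closed_A: "closed A"
  unfolding closed_sequential_limits
proof (intro allI impI)
  fix X l assume *: "(\<forall>n. X n \<in> A) \<and> X \<longlonglongrightarrow> l"
  then have "(\<lambda>n. star (X n)) \<longlonglongrightarrow> star l" "l \<in> B"
    using star_limit[of X l] by (auto simp: A_iff)
  then show "l \<in> A"
    using * LIMSEQ_unique[of X l "star l"] by (auto simp: A_iff)
qed

lemma complete_self_adjoint: "complete A"
  using complete_A closed_A by (metis A_in_B complete_Int_closed inf.absorb_iff2 subsetI)

text \<open>On the ball of radius r = ||a|| in A, the map d |-> (a^2 + d^2) / 2 stays inside because
  (r^2 + r^2) / 2 <= r. It contracts by the factor r < 1, because d^2 - e^2 = (d - e)(d + e) by
  commutativity and ||d + e|| <= 2 r.\<close>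

lemma square_if_norm_less_1:
  assumes a: "a \<in> A" and norm: "norm a < 1"
  obtains d where "d \<in> A" "a * a + d * d = d + d"
proof -
  define r where "r = norm a"
  define f where "f d = (1/2) *\<^sub>R (a * a + d * d)" for d
  define S where "S = A \<inter> cball 0 r"
  have r: "0 \<le> r" "r < 1"
    using norm by (auto simp: r_def)
  have "\<exists>!d\<in>S. f d = d"
  proof (rule Banach_fix)
    show "complete S"
      unfolding S_def using complete_self_adjoint closed_cball by (rule complete_Int_closed)
    show "S \<noteq> {}"
      using a by (auto simp: S_def r_def)
    show "f ` S \<subseteq> S"
    proof safe
      fix d assume "d \<in> S"
      then have d: "d \<in> A" "norm d \<le> r"
        by (auto simp: S_def)
      have "norm (a * a + d * d) \<le> r * r + r * r"
        using norm_triangle_ineq[of "a * a" "d * d"] norm_mult_ineq[of a a] norm_mult_ineq[of d d]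
          mult_mono[OF d(2) d(2)] r by (simp add: r_def)
      also have "\<dots> \<le> 2 * r"
        using r mult_left_mono[of r 1 r] by simp
      finally show "f d \<in> S"
        using d a by (simp add: S_def f_def scaleR_in_A add_in_A mult_in_A)
    qed
    show "dist (f d) (f e) \<le> r * dist d e" if "d \<in> S" "e \<in> S" for d e
    proof -
      have de: "d \<in> A" "e \<in> A" "norm d \<le> r" "norm e \<le> r"
        using that by (auto simp: S_def)
      then have "f d - f e = (1/2) *\<^sub>R ((d - e) * (d + e))"
        by (simp add: f_def algebra_simps commute[of d e] A_in_B)
      then have "norm (f d - f e) \<le> (1/2) * (norm (d - e) * norm (d + e))"
        using norm_mult_ineq[of "d - e" "d + e"] by simp
      also have "\<dots> \<le> (1/2) * (norm (d - e) * (r + r))"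
        using de norm_triangle_ineq[of d e] by (intro mult_left_mono) auto
      finally show ?thesis
        by (simp add: dist_norm mult.commute)
    qed
  qed (use r in auto)
  then obtain d where "d \<in> A" "f d = d"
    by (auto simp: S_def)
  moreover have "a * a + d * d = 2 *\<^sub>R f d"
    by (simp add: f_def)
  ultimately show thesis
    using that by (simp add: scaleR_2)
qed

text \<open>For each c above ||x||, the scaled element x / c satisfies the equation with some d, and
  \<phi> carries it to the same equation for \<phi> x / c and \<phi> d. So c bounds ||\<phi> x||,
  and c may approach ||x||.\<close>

lemma algebra_hom_contractive:
  assumes "algebra_hom A scR A scR \<phi>" and x: "x \<in> A"
  shows "norm (\<phi> x) \<le> norm x"
proof -
  have \<phi>: "\<And>x. x \<in> A \<Longrightarrow> \<phi> x \<in> A" "\<And>x y. x \<in> A \<Longrightarrow> y \<in> A \<Longrightarrow> \<phi> (x + y) = \<phi> x + \<phi> y"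
    "\<And>x y. x \<in> A \<Longrightarrow> y \<in> A \<Longrightarrow> \<phi> (x * y) = \<phi> x * \<phi> y"
    "\<And>c x. x \<in> A \<Longrightarrow> \<phi> (c *\<^sub>R x) = c *\<^sub>R \<phi> x"
    using assms(1) unfolding algebra_hom_def by (auto simp: A_in_B scR_eq[symmetric])
  have "norm (\<phi> x) \<le> c" if c: "norm x < c" for c
  proof -
    have c0: "c > 0"
      using c norm_ge_zero[of x] by linarith
    have "norm ((1/c) *\<^sub>R x) < 1"
      using c c0 by simp
    then obtain d where d: "d \<in> A" "(1/c) *\<^sub>R x * (1/c) *\<^sub>R x + d * d = d + d"
      using square_if_norm_less_1 scaleR_in_A[OF x] by metis
    have "norm (\<phi> ((1/c) *\<^sub>R x)) \<le> 1"
    proof (rule norm_le_1_if_square)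
      show "\<phi> ((1/c) *\<^sub>R x) * \<phi> ((1/c) *\<^sub>R x) + \<phi> d * \<phi> d = \<phi> d + \<phi> d"
        using d \<phi>(2,3) scaleR_in_A[OF x] mult_in_A by metis
    qed (use d x \<phi> scaleR_in_A in auto)
    then show ?thesis
      using c0 x by (simp add: \<phi>(4) field_simps)
  qed
  then show ?thesis
    by (rule dense_ge)
qed

text \<open>The inverse is again an algebra homomorphism, so contractivity applies in both
  directions.\<close>

lemma algebra_iso_isometric:
  assumes hom: "algebra_hom A scR A scR \<phi>" and bij: "bij_betw \<phi> A A" and x: "x \<in> A"
  shows "norm (\<phi> x) = norm x"
proof (rule antisym)
  define \<psi> where "\<psi> = inv_into A \<phi>"
  have \<psi>: "\<And>y. y \<in> A \<Longrightarrow> \<psi> y \<in> A" "\<And>y. y \<in> A \<Longrightarrow> \<phi> (\<psi> y) = y" "\<And>x. x \<in> A \<Longrightarrow> \<psi> (\<phi> x) = x"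
    using bij by (auto simp: \<psi>_def bij_betw_def inv_into_into f_inv_into_f)
  have \<phi>: "\<And>x. x \<in> A \<Longrightarrow> \<phi> x \<in> A" "\<And>x y. x \<in> A \<Longrightarrow> y \<in> A \<Longrightarrow> \<phi> (x + y) = \<phi> x + \<phi> y"
    "\<And>x y. x \<in> A \<Longrightarrow> y \<in> A \<Longrightarrow> \<phi> (x * y) = \<phi> x * \<phi> y"
    "\<And>c x. x \<in> A \<Longrightarrow> \<phi> (scR c x) = scR c (\<phi> x)"
    using hom unfolding algebra_hom_def by auto
  have in_A: "scR c x \<in> A" if "x \<in> A" for c x
    using that by (simp add: scR_eq A_in_B scaleR_in_A)
  have "algebra_hom A scR A scR \<psi>"
    unfolding algebra_hom_def
  proof (intro conjI ballI allI)
    fix x y c assume "x \<in> A" "y \<in> A"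
    then show "\<psi> (x + y) = \<psi> x + \<psi> y" "\<psi> (x * y) = \<psi> x * \<psi> y"
      using \<psi>(3)[of "\<psi> x + \<psi> y"] \<psi>(3)[of "\<psi> x * \<psi> y"] by (simp_all add: \<psi> \<phi> add_in_A mult_in_A)
  next
    fix x c assume "x \<in> A"
    then show "\<psi> (scR c x) = scR c (\<psi> x)"
      using \<psi>(3)[of "scR c (\<psi> x)"] by (simp add: \<psi> \<phi> in_A)
  qed (simp add: \<psi>)
  from algebra_hom_contractive[OF this \<phi>(1)[OF x]] show "norm x \<le> norm (\<phi> x)"
    by (simp add: \<psi> x)
  show "norm (\<phi> x) \<le> norm x"
    by (rule algebra_hom_contractive[OF hom x])
qed

section \<open>The self-adjoint part as a real C*-algebra\<close>

lemma banach_star_algebra_A: "banach_star_algebra_on A scR star"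
proof
  show "subspace_on scR A"
    by (simp add: subspace_on_def zero_in_A add_in_A scR_eq A_in_B scaleR_in_A)
  show "complete A"
    by (rule complete_self_adjoint)
  show "scR c (scR d x) = scR (c * d) x" if "x \<in> A" for c d x
    using sc_sc[of x "of_real c" "of_real d"] that by (simp add: A_in_B)
qed (simp_all add: A_in_B sc_right_distrib sc_left_distrib sc_sc sc_one mult_in_A sc_mult_left sc_mult_right
    norm_sc star_A star_add star_mult norm_star scalar_cnj_real_def scR_eq scaleR_in_A commute
    scaleR_right_distrib scaleR_left_distrib)

text \<open>A acts on the Hilbert space of B with restricted scalars. The delicate point is
  closedness: the image must contain its limits among all real-linear bounded operators, while
  \<open>M\<close> is known to contain only its complex-linear limits.\<close>

theorem cstar_algebra_A: "cstar_algebra A scR star"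
proof -
  obtain H :: "('b \<Rightarrow> complex) set" and hsc ip M \<pi> where
    H: "hilbert_space H hsc (ip :: _ \<Rightarrow> _ \<Rightarrow> complex)" and M: "closed_operator_star_algebra H hsc ip M"
    and \<pi>: "bij_betw \<pi> B M" "\<forall>x\<in>B. \<forall>y\<in>B. \<pi> (x + y) = \<pi> x + \<pi> y"
      "\<forall>c. \<forall>x\<in>B. \<pi> (sc c x) = (\<lambda>v. hsc c (\<pi> x v))"
      "\<forall>x\<in>B. \<forall>y\<in>B. \<pi> (x * y) = \<pi> x \<circ> \<pi> y" "\<forall>x\<in>B. adjoint_on H ip (\<pi> x) (\<pi> (star x))"
      "\<forall>x\<in>B. operator_norm H ip (\<pi> x) = norm x"
    using cstar unfolding cstar_algebra_def by blast
  let ?hsc = "\<lambda>r. hsc (complex_of_real r)" and ?ip = "\<lambda>x y. Re (ip x y)"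
  interpret C: hilbert_space H hsc ip by fact
  interpret H: real_hilbert_space H ?hsc ?ip
    by (rule real_hilbert_space_Re(1)[OF H])
  have bdd: "\<pi> x \<in> bounded_operators H hsc ip" if "x \<in> B" for x
    using M \<pi>(1) that by (auto simp: closed_operator_star_algebra_def bij_betw_def)
  have bddR: "\<pi> x \<in> bounded_operators H ?hsc ?ip" if "x \<in> B" for x
    using bdd[OF that] bounded_operators_Re(1)[OF H] by simp
  have norm: "operator_norm H ?ip (\<pi> x) = norm x" if "x \<in> B" for x
    using bounded_operators_Re(2)[OF H, of "\<pi> x"] bdd[OF that] \<pi>(6) that
    by (simp add: bounded_operators_def)
  have \<pi>_diff: "\<pi> (x - y) = \<pi> x - \<pi> y" if "x \<in> B" "y \<in> B" for x y
  proof -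
    have "\<pi> (x - y + y) = \<pi> (x - y) + \<pi> y"
      using \<pi>(2) that diff_in by blast
    then show ?thesis
      by simp
  qed
  have "closed_operator_star_algebra H ?hsc ?ip (\<pi> ` A)"
    unfolding closed_operator_star_algebra_def
  proof (intro conjI allI ballI impI)
    show "\<pi> ` A \<subseteq> bounded_operators H ?hsc ?ip"
      using bddR A_in_B by blast
    show "subspace_on (\<lambda>c T x. ?hsc c (T x)) (\<pi> ` A)"
      unfolding subspace_on_def
    proof (intro conjI ballI allI)
      have "\<pi> 0 = 0"
        using \<pi>_diff[OF zero_in zero_in] by simp
      then show "0 \<in> \<pi> ` A"
        using zero_in_A by force
      show "S + T \<in> \<pi> ` A" if "S \<in> \<pi> ` A" "T \<in> \<pi> ` A" for S T
      proof -
        obtain x y where "x \<in> A" "y \<in> A" "S = \<pi> x" "T = \<pi> y"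
          using \<open>S \<in> \<pi> ` A\<close> \<open>T \<in> \<pi> ` A\<close> by blast
        then show ?thesis
          using \<pi>(2) A_in_B add_in_A by (metis imageI)
      qed
      show "(\<lambda>x. ?hsc c (T x)) \<in> \<pi> ` A" if "T \<in> \<pi> ` A" for c T
      proof -
        obtain x where x: "x \<in> A" "T = \<pi> x"
          using \<open>T \<in> \<pi> ` A\<close> by blast
        moreover have "scR c x \<in> A"
          using x by (simp add: scR_eq A_in_B scaleR_in_A)
        ultimately show ?thesis
          using \<pi>(3) A_in_B by (metis imageI)
      qed
    qed
    show "S \<circ> T \<in> \<pi> ` A" if "S \<in> \<pi> ` A" "T \<in> \<pi> ` A" for S T
    proof -
      obtain x y where "x \<in> A" "y \<in> A" "S = \<pi> x" "T = \<pi> y"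
        using \<open>S \<in> \<pi> ` A\<close> \<open>T \<in> \<pi> ` A\<close> by blast
      then show ?thesis
        using \<pi>(4) A_in_B mult_in_A by (metis imageI)
    qed
    show "\<exists>T'\<in>\<pi> ` A. adjoint_on H ?ip T T'" if "T \<in> \<pi> ` A" for T
      using that \<pi>(5) by (force simp: A_iff adjoint_on_def)
    fix X T
    assume T: "T \<in> bounded_operators H ?hsc ?ip"
      and "(\<forall>n. X n \<in> \<pi> ` A) \<and> (\<lambda>n. operator_norm H ?ip (X n - T)) \<longlonglongrightarrow> 0"
    then have lim: "(\<lambda>n. operator_norm H ?ip (X n - T)) \<longlonglongrightarrow> 0" and "\<forall>n. X n \<in> \<pi> ` A"
      by auto
    then obtain a where a: "\<And>n. a n \<in> A" "\<And>n. X n = \<pi> (a n)"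
      unfolding image_iff by metis
    have X: "X n \<in> bounded_operators H ?hsc ?ip" for n
      using a bddR A_in_B by simp
    have hsc_in: "hsc c x \<in> H" if "x \<in> H" for c x
      using C.subspace that by (simp add: subspace_on_def)
    \<comment> \<open>A priori T is only real-linear. Its failure D to commute with the scalar c is
      bounded by ||X n - T|| times a constant, which tends to 0.\<close>
    have "T (hsc c x) = hsc c (T x)" if x: "x \<in> H" for c x
    proof -
      define D where "D = T (hsc c x) - hsc c (T x)"
      have D: "D \<in> H"
        unfolding D_def by (intro H.diff_in hsc_in H.bounded_operatorsD(1)[OF T] x)
      have hn: "hnorm ?ip (hsc c v) = norm c * hnorm ?ip v" if "v \<in> H" for v
      proof -
        have "ip (hsc c v) (hsc c v) = c * cnj c * ip v v"
          using C.ip_cnj[of "hsc c v" v] C.ip_scale[of v "hsc c v" c] C.ip_scale[of v v c] C.ip_cnj[of v v] that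
          by (simp add: hsc_in scalar_cnj_complex_def)
        then have "hnorm ip (hsc c v) = norm c * hnorm ip v"
          by (simp add: hnorm_def norm_mult real_sqrt_mult flip: power2_eq_square)
        then show ?thesis
          using real_hilbert_space_Re(2)[OF H] that hsc_in by simp
      qed
      have "hnorm ?ip D \<le> operator_norm H ?ip (X n - T) * (2 * norm c * hnorm ?ip x)" for n
      proof -
        let ?S = "X n - T"
        have S: "?S \<in> bounded_operators H ?hsc ?ip"
          using X T by (rule H.bounded_operators_diff)
        have Xc: "X n (hsc c x) = hsc c (X n x)"
          using bdd[of "a n"] a A_in_B x by (simp add: bounded_operators_def)
        have sd: "hsc c (u - v) = hsc c u - hsc c v" if "u \<in> H" "v \<in> H" for u v
          using C.sc_right_distrib[of "u - v" v c] that H.diff_in by (simp add: algebra_simps)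
        \<comment> \<open>The contributions of \<open>X n\<close> cancel, since it commutes with c
          as the image of an element of B.\<close>
        have "D = hsc c (?S x) - ?S (hsc c x)"
          using Xc sd[OF H.bounded_operatorsD(1)[OF X x] H.bounded_operatorsD(1)[OF T x]] by (simp add: D_def)
        then have "hnorm ?ip D \<le> hnorm ?ip (hsc c (?S x)) + hnorm ?ip (?S (hsc c x))"
          using H.hnorm_triangle_diff hsc_in H.bounded_operatorsD(1)[OF S] x by simp
        also have "\<dots> \<le> norm c * (operator_norm H ?ip ?S * hnorm ?ip x)
            + operator_norm H ?ip ?S * (norm c * hnorm ?ip x)"
          using H.hnorm_operator[OF S x] H.hnorm_operator[OF S hsc_in[OF x, of c]] x
            H.bounded_operatorsD(1)[OF S x]
          by (intro add_mono) (simp_all add: hn mult_left_mono)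
        finally show ?thesis
          by (simp add: algebra_simps)
      qed
      moreover have "(\<lambda>n. operator_norm H ?ip (X n - T) * (2 * norm c * hnorm ?ip x)) \<longlonglongrightarrow> 0"
        using tendsto_mult_right[OF lim] by simp
      ultimately have "hnorm ?ip D \<le> 0"
        by (intro LIMSEQ_le_const) auto
      then have "D = 0"
        using H.hnorm_eq_0[OF D] H.hnorm_nonneg[of D] by simp
      then show ?thesis
        by (simp add: D_def)
    qed
    then have Tc: "T \<in> bounded_operators H hsc ip"
      using T bounded_operators_Re(1)[OF H] by blast
    have "operator_norm H ?ip (X n - T) = operator_norm H ip (X n - T)" for n
      by (rule bounded_operators_Re(2)[OF H]) (rule H.bounded_operatorsD(1)[OF H.bounded_operators_diff[OF X T]])
    then have "(\<forall>n. X n \<in> M) \<and> (\<lambda>n. operator_norm H ip (X n - T)) \<longlonglongrightarrow> 0"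
      using lim a A_in_B \<pi>(1) by (auto simp: bij_betw_def)
    then have "T \<in> M"
      using M Tc unfolding closed_operator_star_algebra_def by blast
    then obtain b where b: "b \<in> B" "T = \<pi> b"
      using \<pi>(1) by (auto simp: bij_betw_def)
    \<comment> \<open>Since \<pi> is isometric, convergence of the operators pulls back to
      convergence of \<open>a\<close> to \<open>b\<close>, and A is closed.\<close>
    have "operator_norm H ?ip (X n - T) = norm (a n - b)" for n
      using norm[of "a n - b"] a b A_in_B by (simp add: \<pi>_diff diff_in)
    then have "(\<lambda>n. norm (a n - b)) \<longlonglongrightarrow> 0"
      using lim by presburger
    then have "a \<longlonglongrightarrow> b"
      by (rule LIM_zero_cancel[OF tendsto_norm_zero_cancel])
    then have "b \<in> A"
      using closed_A a(1) closed_sequentially by blast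
    then show "T \<in> \<pi> ` A"
      using b by blast
  qed
  moreover have "bij_betw \<pi> A (\<pi> ` A)"
    using \<pi>(1) by (auto simp: bij_betw_def inj_on_def A_in_B)
  moreover have "\<forall>x\<in>A. adjoint_on H ?ip (\<pi> x) (\<pi> (star x))"
    using \<pi>(5) A_in_B by (simp add: adjoint_on_def)
  ultimately show ?thesis
    unfolding cstar_algebra_def using banach_star_algebra_A H.hilbert_space_axioms \<pi> norm A_in_B
    by (intro conjI exI[of _ H] exI[of _ ?hsc] exI[of _ ?ip] exI[of _ "\<pi> ` A"] exI[of _ \<pi>]) auto
qed

end

section \<open>Reductions between computable norms and maps\<close>

lemma computes_Comp2:
  "computes g xs y \<Longrightarrow> computes g' xs y' \<Longrightarrow> computes f [y, y'] z \<Longrightarrow> computes (Comp f [g, g']) xs z"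
  by (rule computes_Comp[of _ _ "[y, y']"]) auto

lemma rec_fun2E:
  assumes "rec_fun2 F"
  obtains e where "\<And>x y. computes e [x, y] (F x y)"
proof -
  obtain e where "\<forall>xs. length xs = 2 \<longrightarrow> computes e xs (F (xs ! 0) (xs ! 1))"
    using assms by (auto simp: rec_fun_def)
  then have "computes e [x, y] (F x y)" for x y
    by (metis One_nat_def length_Cons list.size(3) nth_Cons_0 nth_Cons_Suc numeral_2_eq_2)
  with that show thesis .
qed

text \<open>The program behind the hypothesis may diverge off \<open>D'\<close>, so it is not of the
  form \<open>rec_fun\<close>; it is composed by hand with the total translation
  \<open>T\<close>.\<close>

lemma computable_norm_reduce:
  assumes "computable_norm D' \<rho>'" and T: "rec_fun1 T"
    and "\<And>n. n \<in> D \<Longrightarrow> T n \<in> D' \<and> norm (\<rho>' (T n)) = norm (\<rho> n)"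
  shows "computable_norm D \<rho>"
proof -
  obtain e where e: "\<And>n k. n \<in> D' \<Longrightarrow> \<exists>q. computes e [n, k] q \<and> \<bar>norm (\<rho>' n) - rat_of_code q\<bar> < 1 / 2 ^ k"
    using assms(1) by (auto simp: computable_norm_def)
  have "rec_fun2 (\<lambda>n k. T n)"
    by (intro rec_app1[OF T] rec_proj) auto
  then obtain t where t: "\<And>n k. computes t [n, k] (T n)"
    using rec_fun2E[of "\<lambda>n k. T n"] by blast
  have p: "computes (Proj 1) [n, k] k" for n k
    using computes_Proj[of 1 "[n, k]"] by simp
  show ?thesis
    unfolding computable_norm_def
  proof (rule exI, intro ballI allI)
    fix n k assume "n \<in> D"
    with assms(3) e[of "T n" k]
    obtain q where "computes e [T n, k] q" "\<bar>norm (\<rho> n) - rat_of_code q\<bar> < 1 / 2 ^ k"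
      by metis
    with computes_Comp2[OF t p]
    show "\<exists>q. computes (Comp e [t, Proj 1]) [n, k] q \<and> \<bar>norm (\<rho> n) - rat_of_code q\<bar> < 1 / 2 ^ k"
      by blast
  qed
qed

text \<open>Shaped for a map on B that is computed from a map on A: the program is queried at the
  codes of the real and of the imaginary part, and \<open>G\<close> reassembles the answers. The
  hypothesis \<open>le\<close> says that the errors at most add up.\<close>

lemma computable_map_combine:
  assumes "computable_map D \<rho> D' \<rho>' \<phi>" and T: "rec_fun1 T1" "rec_fun1 T2" and G: "rec_fun2 G"
    and T_in: "\<And>n. n \<in> E \<Longrightarrow> T1 n \<in> D \<and> T2 n \<in> D"
    and G_in: "\<And>m m'. m \<in> D' \<Longrightarrow> m' \<in> D' \<Longrightarrow> G m m' \<in> E'"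
    and le: "\<And>n m m'. n \<in> E \<Longrightarrow> m \<in> D' \<Longrightarrow> m' \<in> D' \<Longrightarrow> norm (\<psi> (\<sigma> n) - \<sigma>' (G m m'))
      \<le> norm (\<phi> (\<rho> (T1 n)) - \<rho>' m) + norm (\<phi> (\<rho> (T2 n)) - \<rho>' m')"
  shows "computable_map E \<sigma> E' \<sigma>' \<psi>"
proof -
  obtain e where e: "\<And>n k. n \<in> D \<Longrightarrow> \<exists>m\<in>D'. computes e [n, k] m \<and> norm (\<phi> (\<rho> n) - \<rho>' m) < 1 / 2 ^ k"
    using assms(1) by (auto simp: computable_map_def)
  have "rec_fun2 (\<lambda>n k. T1 n)" "rec_fun2 (\<lambda>n k. T2 n)" "rec_fun2 (\<lambda>n k. Suc k)"
    by (intro T[THEN rec_app1] rec_proj rec_Suc; simp)+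
  then obtain t1 t2 s where t: "\<And>n k. computes t1 [n, k] (T1 n)" "\<And>n k. computes t2 [n, k] (T2 n)"
    "\<And>n k. computes s [n, k] (Suc k)"
    using rec_fun2E[of "\<lambda>n k. T1 n"] rec_fun2E[of "\<lambda>n k. T2 n"] rec_fun2E[of "\<lambda>n k. Suc k"] by metis
  obtain g where g: "\<And>m m'. computes g [m, m'] (G m m')"
    using rec_fun2E[OF G] by blast
  show ?thesis
    unfolding computable_map_def
  proof (rule exI, intro ballI allI)
    fix n k assume n: "n \<in> E"
    \<comment> \<open>One extra bit of precision in each query compensates for the sum of two
      errors.\<close>
    obtain m where m: "m \<in> D'" "computes e [T1 n, Suc k] m" "norm (\<phi> (\<rho> (T1 n)) - \<rho>' m) < 1 / 2 ^ Suc k"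
      using e T_in[OF n] by blast
    obtain m' where m': "m' \<in> D'" "computes e [T2 n, Suc k] m'" "norm (\<phi> (\<rho> (T2 n)) - \<rho>' m') < 1 / 2 ^ Suc k"
      using e T_in[OF n] by blast
    have "computes (Comp g [Comp e [t1, s], Comp e [t2, s]]) [n, k] (G m m')"
      by (intro computes_Comp2[OF computes_Comp2[OF t(1,3) m(2)] computes_Comp2[OF t(2,3) m'(2)] g])
    moreover have "norm (\<psi> (\<sigma> n) - \<sigma>' (G m m')) < 1 / 2 ^ k"
      using le[OF n m(1) m'(1)] m(3) m'(3) by simp
    ultimately show "\<exists>m\<in>E'. computes (Comp g [Comp e [t1, s], Comp e [t2, s]]) [n, k] m
        \<and> norm (\<psi> (\<sigma> n) - \<sigma>' m) < 1 / 2 ^ k"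
      using G_in m(1) m'(1) by blast
  qed
qed

text \<open>The case of two equal queries in which the second answer is ignored.\<close>

lemma computable_map_reduce:
  assumes "computable_map D \<rho> D' \<rho>' \<phi>" and T: "rec_fun1 T" and G: "rec_fun1 G"
    and "\<And>n. n \<in> E \<Longrightarrow> T n \<in> D" and "\<And>m. m \<in> D' \<Longrightarrow> G m \<in> E'"
    and le: "\<And>n m. n \<in> E \<Longrightarrow> m \<in> D' \<Longrightarrow> norm (\<psi> (\<sigma> n) - \<sigma>' (G m)) \<le> norm (\<phi> (\<rho> (T n)) - \<rho>' m)"
  shows "computable_map E \<sigma> E' \<sigma>' \<psi>"
proof (rule computable_map_combine[OF assms(1) T T])
  show "rec_fun2 (\<lambda>m m'. G m)"
    by (intro rec_app1[OF G] rec_proj) auto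
  show "norm (\<psi> (\<sigma> n) - \<sigma>' (G m)) \<le> norm (\<phi> (\<rho> (T n)) - \<rho>' m) + norm (\<phi> (\<rho> (T n)) - \<rho>' m')"
    if "n \<in> E" "m \<in> D'" "m' \<in> D'" for n m m'
    using le[OF that(1,2)] norm_ge_zero[of "\<phi> (\<rho> (T n)) - \<rho>' m'"] by linarith
qed (use assms in auto)

text \<open>With r the positive part of the rational coded by \<open>q\<close>, the search finds the
  integer part of sqrt r * 2^(k+1), here characterised as the least i with r * 4^(k+1) < (i + 1)^2.
  Negative approximations have \<open>rat_pos q = 0\<close> and are thus treated as 0.\<close>

definition sqrt_code :: "nat \<Rightarrow> nat \<Rightarrow> nat" where
  "sqrt_code q k = frac_code
     (LEAST i. Suc (rat_pos q * 4 ^ Suc k) - (Suc i * Suc i) * rat_den q = 0) 0 (2 ^ Suc k)"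

lemma square_search: "d > 0 \<Longrightarrow> \<exists>i. Suc m - (Suc i * Suc i) * d = 0"
proof
  assume "d > 0"
  then have "Suc m * 1 * 1 \<le> Suc m * Suc m * d"
    by (intro mult_mono) auto
  then show "Suc m - (Suc m * Suc m) * d = 0"
    by simp
qed

lemma rec_sqrt_code: "rec_fun2 sqrt_code"
proof -
  have pos: "rec_fun1 rat_pos" "rec_fun1 rat_den"
    unfolding rat_pos_def rat_den_def int_pos_def by (intro rec_intros; simp)+
  have frac: "rec_fun3 frac_code"
    unfolding frac_code_def diff_code_def by (intro rec_intros) auto
  have "rec_fun 2 (\<lambda>xs. LEAST i. Suc (rat_pos ((i # xs) ! 1) * 4 ^ Suc ((i # xs) ! 2))
      - (Suc ((i # xs) ! 0) * Suc ((i # xs) ! 0)) * rat_den ((i # xs) ! 1) = 0)"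
  proof (rule rec_Least)
    show "rec_fun (Suc 2) (\<lambda>xs. Suc (rat_pos (xs ! 1) * 4 ^ Suc (xs ! 2))
      - (Suc (xs ! 0) * Suc (xs ! 0)) * rat_den (xs ! 1))"
      by (intro rec_diff rec_mult rec_Suc rec_power rec_const pos[THEN rec_app1] rec_proj) auto
    show "\<exists>i. Suc (rat_pos ((i # xs) ! 1) * 4 ^ Suc ((i # xs) ! 2))
      - (Suc ((i # xs) ! 0) * Suc ((i # xs) ! 0)) * rat_den ((i # xs) ! 1) = 0" for xs :: "nat list"
      using square_search[OF rat_den_pos] by simp
  qed
  then have "rec_fun2 (\<lambda>q k. LEAST i. Suc (rat_pos q * 4 ^ Suc k) - (Suc i * Suc i) * rat_den q = 0)"
    by (simp del: power_Suc mult_Suc mult_Suc_right add: numeral_2_eq_2)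
  then show ?thesis
    unfolding sqrt_code_def by (intro rec_app3[OF frac] rec_const rec_power rec_Suc rec_proj) auto
qed

text \<open>By |sqrt t - sqrt r|^2 <= |t - r|, precision 4^-(k+1) before the root gives 2^-(k+1)
  after it. Rounding to the grid costs at most another 2^-(k+1).\<close>

lemma sqrt_code_approx:
  assumes "t \<ge> 0" and q: "\<bar>t - rat_of_code q\<bar> < 1 / 4 ^ Suc k"
  shows "\<bar>sqrt t - rat_of_code (sqrt_code q k)\<bar> < 1 / 2 ^ k"
proof -
  define r where "r = real (rat_pos q) / real (rat_den q)"
  define i where "i = (LEAST i. Suc (rat_pos q * 4 ^ Suc k) - (Suc i * Suc i) * rat_den q = 0)"
  define N :: real where "N = 2 ^ Suc k"
  have N: "N > 0" "N\<^sup>2 = 4 ^ Suc k"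
    by (simp_all add: N_def power_mult_distrib power2_eq_square flip: power_mult_distrib)
  have r: "r \<ge> 0"
    by (simp add: r_def)
  have "rat_pos q = 0 \<or> rat_neg q = 0"
    by (simp add: rat_pos_def rat_neg_def int_pos_def int_neg_def)
  \<comment> \<open>Replacing a negative approximation by 0 does not increase the error, as t is
    nonnegative.\<close>
  then have "\<bar>t - r\<bar> \<le> \<bar>t - rat_of_code q\<bar>"
  proof
    assume "rat_pos q = 0"
    then have "r = 0" "rat_of_code q \<le> 0"
      by (simp_all add: r_def rat_of_code_pos_neg)
    then show ?thesis
      using assms(1) by simp
  next
    assume "rat_neg q = 0"
    then show ?thesis
      by (simp add: r_def rat_of_code_pos_neg)
  qed
  with q have tr: "\<bar>t - r\<bar> < 1 / N\<^sup>2"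
    by (simp add: N)
  have "\<bar>sqrt t - sqrt r\<bar> < 1 / N"
  proof (rule ccontr)
    assume "\<not> \<bar>sqrt t - sqrt r\<bar> < 1 / N"
    \<comment> \<open>One of the two factors |sqrt t - sqrt r| is enlarged to sqrt t + sqrt r, which
      makes the product |t - r|.\<close>
    then have "1 / N \<le> \<bar>sqrt t - sqrt r\<bar>"
      by simp
    from mult_mono[OF this this]
    have "(1 / N)\<^sup>2 \<le> \<bar>sqrt t - sqrt r\<bar> * \<bar>sqrt t - sqrt r\<bar>"
      using N by (simp add: power2_eq_square)
    also have "\<dots> \<le> \<bar>sqrt t - sqrt r\<bar> * (sqrt t + sqrt r)"
      using assms(1) r by (intro mult_left_mono) (auto simp: abs_if)
    also have "\<dots> = \<bar>(sqrt t - sqrt r) * (sqrt t + sqrt r)\<bar>"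
      using assms(1) r by (simp add: abs_mult)
    also have "(sqrt t - sqrt r) * (sqrt t + sqrt r) = t - r"
      using assms(1) r by (simp add: algebra_simps)
    finally show False
      using tr by (simp add: power_divide)
  qed
  moreover have "\<bar>sqrt r - real i / N\<bar> \<le> 1 / N"
  proof -
    have ex: "\<exists>i. Suc (rat_pos q * 4 ^ Suc k) - (Suc i * Suc i) * rat_den q = 0"
      by (rule square_search) simp
    have char: "(Suc (rat_pos q * 4 ^ Suc k) - (Suc i * Suc i) * rat_den q = 0)
        \<longleftrightarrow> r * N\<^sup>2 < (real (Suc i))\<^sup>2" for i
    proof -
      have "(Suc (rat_pos q * 4 ^ Suc k) - (Suc i * Suc i) * rat_den q = 0)
          \<longleftrightarrow> real (rat_pos q * 4 ^ Suc k) < real ((Suc i * Suc i) * rat_den q)"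
        by (simp only: of_nat_less_iff diff_is_0_eq Suc_le_eq)
      also have "\<dots> \<longleftrightarrow> real (rat_pos q) * N\<^sup>2 < (real (Suc i))\<^sup>2 * real (rat_den q)"
        unfolding N by (simp only: of_nat_mult of_nat_power of_nat_numeral power2_eq_square)
      also have "\<dots> \<longleftrightarrow> r * N\<^sup>2 < (real (Suc i))\<^sup>2"
        unfolding r_def by (simp add: field_simps del: of_nat_Suc)
      finally show ?thesis .
    qed
    have sq: "(sqrt r * N)\<^sup>2 = r * N\<^sup>2"
      using r by (simp only: power_mult_distrib real_sqrt_pow2)
    have i: "i = (LEAST i. r * N\<^sup>2 < (real (Suc i))\<^sup>2)"
      by (simp only: i_def char)
    have "r * N\<^sup>2 < (real (Suc i))\<^sup>2"
      using LeastI_ex[OF ex[unfolded char]] by (simp only: i)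
    then have "(sqrt r * N)\<^sup>2 \<le> (real (Suc i))\<^sup>2"
      unfolding sq by (rule less_imp_le)
    then have "sqrt r * N \<le> real (Suc i)"
      by (rule power2_le_imp_le) simp
    moreover have "real i \<le> sqrt r * N"
    proof (cases i)
      case 0
      then show ?thesis
        using r N(1) by simp
    next
      case (Suc i')
      have "i' < (LEAST i. r * N\<^sup>2 < (real (Suc i))\<^sup>2)"
        unfolding i[symmetric] Suc by (rule lessI)
      then have "(real i)\<^sup>2 \<le> (sqrt r * N)\<^sup>2"
        unfolding sq Suc using not_less_Least not_less by blast
      then show ?thesis
        by (rule power2_le_imp_le) (use r N(1) in simp)
    qed
    ultimately have "real i / N \<le> sqrt r" "sqrt r \<le> (real i + 1) / N"
      using N(1) by (simp_all add: field_simps)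
    then show ?thesis
      by (simp add: add_divide_distrib)
  qed
  moreover have "rat_of_code (sqrt_code q k) = real i / N"
    unfolding sqrt_code_def by (simp add: rat_of_code_frac_code i_def N_def del: power_Suc mult_Suc mult_Suc_right)
  moreover have "1 / N + 1 / N = 1 / 2 ^ k"
    by (simp add: N_def)
  ultimately show ?thesis
    by linarith
qed

lemma computable_norm_sqrt:
  assumes "computable_norm D' \<rho>'" and T: "rec_fun1 T"
    and "\<And>n. n \<in> D \<Longrightarrow> T n \<in> D' \<and> norm (\<rho>' (T n)) = (norm (\<rho> n))\<^sup>2"
  shows "computable_norm D \<rho>"
proof -
  obtain e where e: "\<And>n k. n \<in> D' \<Longrightarrow> \<exists>q. computes e [n, k] q \<and> \<bar>norm (\<rho>' n) - rat_of_code q\<bar> < 1 / 2 ^ k"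
    using assms(1) by (auto simp: computable_norm_def)
  \<comment> \<open>Precision 2 (k + 1) in powers of two is the 4^-(k+1) that
    \<open>sqrt_code_approx\<close> demands of the squared norm.\<close>
  have "rec_fun2 (\<lambda>n k. T n)" "rec_fun2 (\<lambda>n k. 2 * Suc k)"
    by (intro rec_app1[OF T] rec_proj rec_Suc rec_mult rec_const; simp)+
  then obtain t s where t: "\<And>n k. computes t [n, k] (T n)" "\<And>n k. computes s [n, k] (2 * Suc k)"
    using rec_fun2E[of "\<lambda>n k. T n"] rec_fun2E[of "\<lambda>n k. 2 * Suc k"] by metis
  obtain g where g: "\<And>q k. computes g [q, k] (sqrt_code q k)"
    using rec_fun2E[OF rec_sqrt_code] by blast
  have p: "computes (Proj 1) [n, k] k" for n k
    using computes_Proj[of 1 "[n, k]"] by simp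
  show ?thesis
    unfolding computable_norm_def
  proof (rule exI, intro ballI allI)
    fix n k assume n: "n \<in> D"
    with assms(3) e[of "T n" "2 * Suc k"]
    obtain q where q: "computes e [T n, 2 * Suc k] q" "\<bar>(norm (\<rho> n))\<^sup>2 - rat_of_code q\<bar> < 1 / 2 ^ (2 * Suc k)"
      by metis
    then have "\<bar>norm (\<rho> n) - rat_of_code (sqrt_code q k)\<bar> < 1 / 2 ^ k"
      using sqrt_code_approx[of "(norm (\<rho> n))\<^sup>2" q k] by (simp add: power_mult)
    with computes_Comp2[OF computes_Comp2[OF t q(1)] p g]
    show "\<exists>q. computes (Comp g [Comp e [t, s], Proj 1]) [n, k] q \<and> \<bar>norm (\<rho> n) - rat_of_code q\<bar> < 1 / 2 ^ k"
      by blast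
  qed
qed

section \<open>Presentations\<close>

text \<open>A choice does no harm to computability: it is applied to a few fixed scalars only, whose
  codes enter programs as constants.\<close>

definition scalar_code :: "complex \<Rightarrow> nat" where
  "scalar_code z = (SOME c. scalar_of_code c = z)"

lemma scalar_of_code_scalar_code:
  assumes "Re z \<in> \<rat>" "Im z \<in> \<rat>"
  shows "scalar_of_code (scalar_code z) = z"
proof -
  obtain p q where "Re z = rat_of_code p" "Im z = rat_of_code q"
    using assms unfolding range_rat_of_code[symmetric] by blast
  then have "scalar_of_code (prod_encode (p, q)) = z"
    by (simp add: scalar_of_code_complex complex_eq_iff)
  then show ?thesis
    unfolding scalar_code_def by (rule someI)
qed

definition term_code :: "complex \<Rightarrow> nat \<Rightarrow> nat" where
  "term_code z y = cons_code (mono_code (scalar_code z) y 0) 0"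

lemma letters_term_code [simp]: "letters_of_code (term_code z y) = {y}"
  by (simp add: letters_of_code_eq term_code_def)

lemma eval_term_code:
  "Re z \<in> \<rat> \<Longrightarrow> Im z \<in> \<rat> \<Longrightarrow> eval_code sc v (term_code z y) = sc z (v y)"
  by (simp add: eval_code_eq term_code_def scalar_of_code_scalar_code)

lemma rec_term_code: "rec_fun k f \<Longrightarrow> rec_fun k (\<lambda>xs. term_code z (f xs))"
  unfolding term_code_def by (intro rec_cons_code rec_mono rec_const)

text \<open>The interpretation of letters in \<open>star_point\<close>, with
  \<open>sum_decode\<close> replaced by parity, so that translating letters becomes arithmetic on
  their codes.\<close>

definition letter_value :: "('a \<Rightarrow> 'a) \<Rightarrow> 'a special_points \<Rightarrow> nat \<Rightarrow> 'a" where
  "letter_value star P y = (if y mod 2 = 0 then snd P (y div 2) else star (snd P (y div 2)))"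

lemma star_point_eq: "star_point sc star P = eval_code sc (letter_value star P)"
proof -
  have "(\<lambda>y. case sum_decode y of Inl i \<Rightarrow> snd P i | Inr i \<Rightarrow> star (snd P i)) = letter_value star P"
    by (rule ext) (auto simp: sum_decode_def letter_value_def even_iff_mod_2_eq_zero)
  then show ?thesis
    by (simp add: star_point_def)
qed

lemma star_codes_eq: "star_codes P = {n. \<forall>y\<in>letters_of_code n. enat (y div 2) < fst P}"
proof -
  have "index_of_letter y = y div 2" for y
    by (simp add: index_of_letter_def sum_decode_def)
  then show ?thesis
    by (simp add: star_codes_def)
qed

context abelian_cstar_algebra
begin

text \<open>Such rules split an identity in B into two identities in A, where a homomorphism given
  on A can be applied.\<close>

lemma re_mult: "x \<in> B \<Longrightarrow> y \<in> B \<Longrightarrow> re (x * y) = re x * re y - im x * im y"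
  and im_mult: "x \<in> B \<Longrightarrow> y \<in> B \<Longrightarrow> im (x * y) = re x * im y + im x * re y"
proof -
  assume xy: "x \<in> B" "y \<in> B"
  note A = re_in_A[OF xy(1)] im_in_A[OF xy(1)] re_in_A[OF xy(2)] im_in_A[OF xy(2)]
  have "x * y = (re x + j (im x)) * (re y + j (im y))"
    by (simp add: re_im xy)
  also have "\<dots> = (re x * re y - im x * im y) + j (re x * im y + im x * re y)"
    using A by (simp add: algebra_simps j_simps closed_rules A_in_B)
  finally have eq: "x * y = (re x * re y - im x * im y) + j (re x * im y + im x * re y)" .
  show "re (x * y) = re x * re y - im x * im y" "im (x * y) = re x * im y + im x * re y"
    unfolding eq by (intro re_eq im_eq diff_in_A add_in_A mult_in_A A)+
qed

lemma re_scale: "x \<in> B \<Longrightarrow> re (sc c x) = Re c *\<^sub>R re x - Im c *\<^sub>R im x"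
  and im_scale: "x \<in> B \<Longrightarrow> im (sc c x) = Re c *\<^sub>R im x + Im c *\<^sub>R re x"
proof -
  assume x: "x \<in> B"
  note A = re_in_A[OF x] im_in_A[OF x]
  have "sc c x = Re c *\<^sub>R (re x + j (im x)) + Im c *\<^sub>R j (re x + j (im x))"
    by (simp add: re_im x sc_eq)
  also have "\<dots> = (Re c *\<^sub>R re x - Im c *\<^sub>R im x) + j (Re c *\<^sub>R im x + Im c *\<^sub>R re x)"
    using A by (simp add: algebra_simps j_simps closed_rules A_in_B)
  finally have eq: "sc c x = (Re c *\<^sub>R re x - Im c *\<^sub>R im x) + j (Re c *\<^sub>R im x + Im c *\<^sub>R re x)" .
  show "re (sc c x) = Re c *\<^sub>R re x - Im c *\<^sub>R im x" "im (sc c x) = Re c *\<^sub>R im x + Im c *\<^sub>R re x"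
    unfolding eq by (intro re_eq im_eq diff_in_A add_in_A scaleR_in_A A)+
qed

lemma re_star: "x \<in> B \<Longrightarrow> re (star x) = re x" and im_star: "x \<in> B \<Longrightarrow> im (star x) = - im x"
  by (simp_all add: re_def im_def j_simps closed_rules algebra_simps)

lemma star_eq: "x \<in> B \<Longrightarrow> star x = re x - j (im x)"
  using re_im[of "star x"] by (simp add: re_star im_star star_closed j_minus im_in_A A_in_B)

lemma norm_sq: "x \<in> B \<Longrightarrow> (norm x)\<^sup>2 = norm (re x * re x + im x * im x)"
proof -
  assume x: "x \<in> B"
  have "re (star x * x) = re x * re x + im x * im x" "im (star x * x) = 0"
    using commute[OF A_in_B A_in_B, OF re_in_A im_in_A, OF x x]
    by (simp_all add: re_mult im_mult star_closed x re_star im_star)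
  then have "star x * x = re x * re x + im x * im x + j 0"
    using re_im[of "star x * x"] x by (simp add: closed_rules)
  then show ?thesis
    using cstar_identity[OF x] j_scaleR[OF zero_in, of 0] by simp
qed

lemma B_eqI:
  assumes S: "S \<subseteq> B" "subspace_on sc S" and "A \<subseteq> S"
  shows "S = B"
proof
  show "B \<subseteq> S"
  proof
    fix x assume x: "x \<in> B"
    then have "re x \<in> S" "im x \<in> S"
      using assms(3) re_in_A im_in_A by auto
    then have "re x + j (im x) \<in> S"
      using S unfolding subspace_on_def j_def by blast
    then show "x \<in> S"
      by (simp add: re_im x)
  qed
qed fact

lemma letter_value_in_A:
  assumes "\<forall>i. enat i < fst P \<longrightarrow> snd P i \<in> A" "n \<in> star_codes P"
  shows "\<forall>y\<in>letters_of_code n. letter_value star P y \<in> A"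
  using assms by (auto simp: star_codes_eq letter_value_def star_A)

lemma letter_value_in_B:
  assumes "\<forall>i. enat i < fst P \<longrightarrow> snd P i \<in> B" "n \<in> star_codes P"
  shows "\<forall>y\<in>letters_of_code n. letter_value star P y \<in> B"
  using assms by (auto simp: star_codes_eq letter_value_def star_closed)

text \<open>The polynomial whose norm in A is the squared norm in B. Multiplication of codes is
  complex, so the real factors pass through \<open>complexify\<close> and the result returns through
  \<open>Re_code\<close>.\<close>

definition sum_squares_code :: "nat \<Rightarrow> nat" where
  "sum_squares_code n = Re_code (rev_append
     (mult_code (complexify (Re_code n)) (complexify (Re_code n)))
     (mult_code (complexify (Im_code n)) (complexify (Im_code n))))"

lemma complexified_presentation:
  assumes P: "computable_cstar_presentation A scR star P"
  shows "computable_cstar_presentation B sc star P"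
proof -
  have pts: "\<forall>i. enat i < fst P \<longrightarrow> snd P i \<in> A"
    and gen: "\<And>S. S \<subseteq> A \<Longrightarrow> subspace_on scR S \<Longrightarrow> (\<forall>x\<in>S. \<forall>y\<in>S. x * y \<in> S) \<Longrightarrow> (\<forall>x\<in>S. star x \<in> S)
      \<Longrightarrow> closed S \<Longrightarrow> (\<forall>i. enat i < fst P \<longrightarrow> snd P i \<in> S) \<Longrightarrow> S = A"
    and norm: "computable_norm (star_codes P) (star_point scR star P)"
    using P unfolding computable_cstar_presentation_def cstar_presentation_def by blast+
  have "cstar_presentation B sc star P"
    unfolding cstar_presentation_def
  proof (intro conjI allI impI)
    show "cstar_algebra B sc star"
      by (rule cstar)
    show "snd P i \<in> B" if "enat i < fst P" for i
      using pts that A_in_B by blast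
    fix S assume S: "S \<subseteq> B" and "subspace_on sc S \<and> (\<forall>x\<in>S. \<forall>y\<in>S. x * y \<in> S) \<and> (\<forall>x\<in>S. star x \<in> S)
      \<and> closed S \<and> (\<forall>i. enat i < fst P \<longrightarrow> snd P i \<in> S)"
    then have S': "subspace_on sc S" "\<forall>x\<in>S. \<forall>y\<in>S. x * y \<in> S" "\<forall>x\<in>S. star x \<in> S" "closed S"
      "\<forall>i. enat i < fst P \<longrightarrow> snd P i \<in> S"
      by blast+
    \<comment> \<open>The self-adjoint part of S is a closed real subalgebra containing the special
      points, hence all of A, and A spans B over \<complex>.\<close>
    have "S \<inter> A = A"
    proof (rule gen)
      show "subspace_on scR (S \<inter> A)"
        using S'(1) banach_star_algebra_A
        unfolding banach_star_algebra_on_def banach_algebra_on_def vspace_on_def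
        by (auto simp: subspace_on_def)
    qed (use S' pts closed_A in \<open>auto simp: mult_in_A star_A\<close>)
    then show "S = B"
      using S S'(1) by (intro B_eqI) auto
  qed
  moreover have "computable_norm (star_codes P) (star_point sc star P)"
  proof (rule computable_norm_sqrt[OF norm])
    show "rec_fun1 sum_squares_code"
      unfolding sum_squares_code_def
      by (intro rec_coeff_codes rec_rev_append rec_mult_code rec_proj) auto
    fix n assume n: "n \<in> star_codes P"
    let ?v = "letter_value star P" and ?z = "star_point sc star P n"
    have v: "\<forall>y\<in>letters_of_code n. ?v y \<in> A"
      using letter_value_in_A[OF pts n] .
    then have vB: "\<forall>y\<in>letters_of_code n. ?v y \<in> B"
      using A_in_B by blast
    have z: "?z \<in> B"
      unfolding star_point_eq by (rule eval_in_B[OF vB])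
    let ?r = "mult_code (complexify (Re_code n)) (complexify (Re_code n))"
      and ?i = "mult_code (complexify (Im_code n)) (complexify (Im_code n))"
    have let_ri: "letters_of_code ?r \<union> letters_of_code ?i \<subseteq> letters_of_code n"
      using letters_mult_code[of "complexify (Re_code n)" "complexify (Re_code n)"]
        letters_mult_code[of "complexify (Im_code n)" "complexify (Im_code n)"] by simp
    have "eval_code sc ?v ?r = re ?z * re ?z" "eval_code sc ?v ?i = im ?z * im ?z"
      using vB v by (simp_all add: eval_mult_code eval_complexify eval_Re_code eval_Im_code star_point_eq)
    moreover have "eval_code scR ?v (Re_code (rev_append ?r ?i)) = re (eval_code sc ?v (rev_append ?r ?i))"
      by (rule eval_Re_code) (use v let_ri in auto)
    ultimately have "star_point scR star P (sum_squares_code n) = re (re ?z * re ?z + im ?z * im ?z)"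
      by (simp add: sum_squares_code_def star_point_eq eval_rev_append)
    also have "\<dots> = re ?z * re ?z + im ?z * im ?z"
      by (intro re_A add_in_A mult_in_A re_in_A im_in_A z)
    finally show "sum_squares_code n \<in> star_codes P \<and>
        norm (star_point scR star P (sum_squares_code n)) = (norm ?z)\<^sup>2"
      using n let_ri norm_sq[OF z] by (auto simp: star_codes_eq sum_squares_code_def)
  qed
  ultimately show ?thesis
    by (simp add: computable_cstar_presentation_def)
qed

text \<open>Real and imaginary parts are interleaved. Doubling in \<open>enat\<close> treats finite
  and infinite sequences alike.\<close>

definition real_points :: "'b special_points \<Rightarrow> 'b special_points" where
  "real_points P = (2 * fst P, \<lambda>k. if k mod 2 = 0 then re (snd P (k div 2)) else im (snd P (k div 2)))"

lemma less_fst_real_points: "enat k < fst (real_points P) \<longleftrightarrow> enat (k div 2) < fst P"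
  by (cases "fst P") (auto simp: real_points_def numeral_eq_enat)

text \<open>Substitutions expressing the letters of \<open>P\<close> by those of \<open>real_points P\<close> and conversely.
  The unstarred letter of index \<open>i\<close> has code \<open>2 * i\<close>.\<close>

definition to_real_points :: "nat \<Rightarrow> nat" where
  "to_real_points y = (if y mod 2 = 0
     then rev_append (term_code 1 (4 * (y div 2))) (term_code \<i> (4 * (y div 2) + 2))
     else rev_append (term_code 1 (4 * (y div 2))) (term_code (- \<i>) (4 * (y div 2) + 2)))"

definition of_real_points :: "nat \<Rightarrow> nat" where
  "of_real_points y = (if (y div 2) mod 2 = 0
     then rev_append (term_code (1/2) (2 * (y div 2 div 2))) (term_code (1/2) (2 * (y div 2 div 2) + 1))
     else rev_append (term_code (- \<i>/2) (2 * (y div 2 div 2))) (term_code (\<i>/2) (2 * (y div 2 div 2) + 1)))"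

lemma rec_points_codes:
  "rec_fun k f \<Longrightarrow> rec_fun k (\<lambda>xs. subst_code to_real_points (f xs))"
  "rec_fun k f \<Longrightarrow> rec_fun k (\<lambda>xs. subst_code of_real_points (f xs))"
proof -
  have "rec_fun1 to_real_points" "rec_fun1 of_real_points"
    unfolding to_real_points_def of_real_points_def
    by (intro rec_if rec_mod2 rec_div2 rec_rev_append rec_term_code rec_add rec_mult rec_const rec_proj; simp)+
  then show "rec_fun k f \<Longrightarrow> rec_fun k (\<lambda>xs. subst_code to_real_points (f xs))"
    "rec_fun k f \<Longrightarrow> rec_fun k (\<lambda>xs. subst_code of_real_points (f xs))"
    by (simp_all add: rec_subst_code)
qed

text \<open>A letter y has index i = y div 2. The parts of this special point have indices 2 i and 2
  i + 1 in \<open>real_points P\<close>, hence unstarred letters 4 i and 4 i + 2, and halving twice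
  returns i. The next lemma is the converse count.\<close>

lemma letters_to_real_points: "z \<in> letters_of_code (to_real_points y) \<Longrightarrow> z div 2 div 2 = y div 2"
  by (auto simp: to_real_points_def split: if_splits)

lemma letters_of_real_points: "z \<in> letters_of_code (of_real_points y) \<Longrightarrow> z div 2 = y div 2 div 2"
  by (auto simp: of_real_points_def split: if_splits)

lemma subst_to_real_points_in: "n \<in> star_codes P \<Longrightarrow> subst_code to_real_points n \<in> star_codes (real_points P)"
  using letters_subst_code[of to_real_points n] letters_to_real_points
  by (fastforce simp: star_codes_eq less_fst_real_points)

lemma subst_of_real_points_in:
  "n \<in> star_codes (real_points P) \<Longrightarrow> subst_code of_real_points n \<in> star_codes P"
  using letters_subst_code[of of_real_points n] letters_of_real_points
  by (fastforce simp: star_codes_eq less_fst_real_points)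

lemma real_points_in_A:
  "\<forall>i. enat i < fst P \<longrightarrow> snd P i \<in> B \<Longrightarrow> \<forall>i. enat i < fst (real_points P) \<longrightarrow> snd (real_points P) i \<in> A"
  by (auto simp: less_fst_real_points) (auto simp: real_points_def re_in_A im_in_A)

lemma eval_to_real_points:
  assumes pts: "\<forall>i. enat i < fst P \<longrightarrow> snd P i \<in> B" and n: "n \<in> star_codes P"
  shows "eval_code sc (letter_value star (real_points P)) (subst_code to_real_points n) = star_point sc star P n"
  unfolding star_point_eq
proof (rule eval_subst_code)
  fix y assume "y \<in> letters_of_code n"
  then have a: "snd P (y div 2) \<in> B"
    using pts n by (auto simp: star_codes_eq)
  note A = re_in_A[OF a] im_in_A[OF a]
  have "letter_value star (real_points P) (4 * (y div 2)) = re (snd P (y div 2))"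
    "letter_value star (real_points P) (4 * (y div 2) + 2) = im (snd P (y div 2))"
    by (auto simp: letter_value_def real_points_def)
  then show "eval_code sc (letter_value star (real_points P)) (to_real_points y) = letter_value star P y"
    using a A re_im[OF a] star_eq[OF a]
    by (auto simp: to_real_points_def eval_rev_append eval_term_code sc_eq A_in_B letter_value_def)
  fix z assume "z \<in> letters_of_code (to_real_points y)"
  then have "z div 2 div 2 = y div 2"
    by (rule letters_to_real_points)
  then show "letter_value star (real_points P) z \<in> B"
    using A by (auto simp: letter_value_def real_points_def A_in_B star_A)
qed

lemma eval_of_real_points:
  assumes pts: "\<forall>i. enat i < fst P \<longrightarrow> snd P i \<in> B" and n: "n \<in> star_codes (real_points P)"
  shows "star_point sc star P (subst_code of_real_points (complexify n)) = star_point scR star (real_points P) n"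
  unfolding star_point_eq eval_complexify[symmetric]
proof (rule eval_subst_code)
  fix y assume "y \<in> letters_of_code (complexify n)"
  then have a: "snd P (y div 2 div 2) \<in> B"
    using pts n by (auto simp: star_codes_eq less_fst_real_points)
  note A = re_in_A[OF a] im_in_A[OF a]
  have "letter_value star P (2 * (y div 2 div 2)) = snd P (y div 2 div 2)"
    "letter_value star P (2 * (y div 2 div 2) + 1) = star (snd P (y div 2 div 2))"
    by (auto simp: letter_value_def)
  \<comment> \<open>The real points are self-adjoint, so starred and unstarred letters agree in
    value; accordingly \<open>of_real_points\<close> disregards the parity of y.\<close>
  moreover have "letter_value star (real_points P) y = snd (real_points P) (y div 2)"
    using A by (simp add: letter_value_def real_points_def star_A)
  ultimately show "eval_code sc (letter_value star P) (of_real_points y) = letter_value star (real_points P) y"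
    using a by (auto simp: of_real_points_def eval_rev_append eval_term_code sc_eq real_points_def
        re_def im_def j_simps closed_rules algebra_simps)
  fix z assume "z \<in> letters_of_code (of_real_points y)"
  then have "z div 2 = y div 2 div 2"
    by (rule letters_of_real_points)
  then show "letter_value star P z \<in> B"
    using a by (auto simp: letter_value_def star_closed)
qed

lemma real_presentation:
  assumes P: "computable_cstar_presentation B sc star P"
  shows "computable_cstar_presentation A scR star (real_points P)"
proof -
  have pts: "\<forall>i. enat i < fst P \<longrightarrow> snd P i \<in> B"
    and gen: "\<And>S. S \<subseteq> B \<Longrightarrow> subspace_on sc S \<Longrightarrow> (\<forall>x\<in>S. \<forall>y\<in>S. x * y \<in> S) \<Longrightarrow> (\<forall>x\<in>S. star x \<in> S)
      \<Longrightarrow> closed S \<Longrightarrow> (\<forall>i. enat i < fst P \<longrightarrow> snd P i \<in> S) \<Longrightarrow> S = B"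
    and norm: "computable_norm (star_codes P) (star_point sc star P)"
    using P unfolding computable_cstar_presentation_def cstar_presentation_def by blast+
  have "cstar_presentation A scR star (real_points P)"
    unfolding cstar_presentation_def
  proof (intro conjI allI impI)
    show "cstar_algebra A scR star"
      by (rule cstar_algebra_A)
    show "snd (real_points P) i \<in> A" if "enat i < fst (real_points P)" for i
      using real_points_in_A[OF pts] that by blast
    fix S assume SA: "S \<subseteq> A" and "subspace_on scR S \<and> (\<forall>x\<in>S. \<forall>y\<in>S. x * y \<in> S) \<and> (\<forall>x\<in>S. star x \<in> S)
      \<and> closed S \<and> (\<forall>i. enat i < fst (real_points P) \<longrightarrow> snd (real_points P) i \<in> S)"
    then have S: "subspace_on scR S" "\<And>x y. x \<in> S \<Longrightarrow> y \<in> S \<Longrightarrow> x * y \<in> S" "closed S"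
      "\<And>i. enat i < fst (real_points P) \<Longrightarrow> snd (real_points P) i \<in> S"
      by blast+
    have S_sc: "r *\<^sub>R x \<in> S" if "x \<in> S" for r x
    proof -
      have "scR r x \<in> S"
        using S(1) that unfolding subspace_on_def by blast
      then show ?thesis
        using SA that by (auto simp: scR_eq A_in_B)
    qed
    have S_add: "x + y \<in> S" if "x \<in> S" "y \<in> S" for x y
      using S(1) that unfolding subspace_on_def by blast
    have S_diff: "x - y \<in> S" if "x \<in> S" "y \<in> S" for x y
      using S_add[OF that(1) S_sc[OF that(2), of "-1"]] by simp
    \<comment> \<open>The complexification S + j S. Written with \<open>re\<close> and
      \<open>im\<close> it is a preimage of S under contractions, which makes closedness
      immediate.\<close>
    define S' where "S' = {z \<in> B. re z \<in> S \<and> im z \<in> S}"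
    have "S' = B"
    proof (rule gen)
      have "0 \<in> S"
        using S(1) by (simp add: subspace_on_def)
      moreover have "re 0 = 0" "im 0 = 0"
        using re_scale[OF zero_in, of 0] im_scale[OF zero_in, of 0] scR_eq[OF zero_in, of 0] by simp_all
      ultimately show "subspace_on sc S'"
        by (auto simp: subspace_on_def S'_def closed_rules re_add im_add re_scale im_scale S_add S_diff S_sc)
      show "\<forall>x\<in>S'. \<forall>y\<in>S'. x * y \<in> S'"
        by (auto simp: S'_def closed_rules re_mult im_mult S_add S_diff S(2))
      show "\<forall>x\<in>S'. star x \<in> S'"
        using S_sc[of _ "-1"] by (auto simp: S'_def closed_rules re_star im_star)
      show "closed S'"
        unfolding closed_sequential_limits
      proof (intro allI impI)
        fix X l assume "(\<forall>n. X n \<in> S') \<and> X \<longlonglongrightarrow> l"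
        then have X: "\<And>n. X n \<in> B" "\<And>n. re (X n) \<in> S" "\<And>n. im (X n) \<in> S" "X \<longlonglongrightarrow> l"
          by (auto simp: S'_def)
        have l: "l \<in> B"
          using star_limit(1) X by blast
        have lim0: "(\<lambda>n. norm (X n - l)) \<longlonglongrightarrow> 0"
          using X(4) by (simp add: LIM_zero tendsto_norm_zero)
        \<comment> \<open>Additivity and contractivity bound both distances by the norm of
          \<open>X n - l\<close>.\<close>
        have "(\<lambda>n. norm (re (X n) - re l)) \<longlonglongrightarrow> 0" "(\<lambda>n. norm (im (X n) - im l)) \<longlonglongrightarrow> 0"
          by (rule tendsto_sandwich[OF _ _ tendsto_const lim0];
              use norm_re_le norm_im_le X(1) l in \<open>simp add: re_diff[symmetric] im_diff[symmetric] diff_in\<close>)+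
        then have "(\<lambda>n. re (X n)) \<longlonglongrightarrow> re l" "(\<lambda>n. im (X n)) \<longlonglongrightarrow> im l"
          by (auto intro: LIM_zero_cancel tendsto_norm_zero_cancel)
        then have "re l \<in> S" "im l \<in> S"
          using closed_sequentially[OF S(3), of "\<lambda>n. re (X n)"]
            closed_sequentially[OF S(3), of "\<lambda>n. im (X n)"] X(2,3) by auto
        then show "l \<in> S'"
          using l by (simp add: S'_def)
      qed
      show "\<forall>i. enat i < fst P \<longrightarrow> snd P i \<in> S'"
      proof (intro allI impI)
        fix i assume i: "enat i < fst P"
        have "re (snd P i) \<in> S" "im (snd P i) \<in> S"
          using S(4)[of "2 * i"] S(4)[of "2 * i + 1"] i
          unfolding less_fst_real_points by (simp_all add: real_points_def)
        then show "snd P i \<in> S'"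
          using pts i by (simp add: S'_def)
      qed
    qed (auto simp: S'_def)
    then have "re x \<in> S" if "x \<in> A" for x
      using that A_in_B[OF that] by (auto simp: S'_def)
    then show "S = A"
      using SA re_A by (metis subsetI subset_antisym)
  qed
  moreover have "computable_norm (star_codes (real_points P)) (star_point scR star (real_points P))"
  proof (rule computable_norm_reduce[OF norm])
    show "rec_fun1 (\<lambda>n. subst_code of_real_points (complexify n))"
      by (intro rec_points_codes rec_coeff_codes rec_proj) auto
    fix n assume n: "n \<in> star_codes (real_points P)"
    then have "complexify n \<in> star_codes (real_points P)"
      by (simp add: star_codes_eq)
    then show "subst_code of_real_points (complexify n) \<in> star_codes P \<and>
        norm (star_point sc star P (subst_code of_real_points (complexify n)))
          = norm (star_point scR star (real_points P) n)"
      using subst_of_real_points_in eval_of_real_points[OF pts n] by simp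
  qed
  ultimately show ?thesis
    by (simp add: computable_cstar_presentation_def)
qed

end

section \<open>Categoricity\<close>

context abelian_cstar_algebra
begin

lemma categorical_A_imp_B:
  assumes A: "computably_categorical_cstar A scR star"
  shows "computably_categorical_cstar B sc star"
  unfolding computably_categorical_cstar_def
proof (intro allI impI, elim conjE)
  fix P Q assume P: "computable_cstar_presentation B sc star P" and Q: "computable_cstar_presentation B sc star Q"
  have P_pts: "\<forall>i. enat i < fst P \<longrightarrow> snd P i \<in> B" and Q_pts: "\<forall>i. enat i < fst Q \<longrightarrow> snd Q i \<in> B"
    using P Q unfolding computable_cstar_presentation_def cstar_presentation_def by blast+
  let ?P = "real_points P" and ?Q = "real_points Q"
  obtain \<phi> where iso: "computable_star_iso A scR star ?P A scR star ?Q \<phi>"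
    using A real_presentation[OF P] real_presentation[OF Q]
    unfolding computably_categorical_cstar_def by blast
  then have map: "computable_map (star_codes ?P) (star_point scR star ?P) (star_codes ?Q) (star_point scR star ?Q) \<phi>"
    and bij: "bij_betw \<phi> A A"
    and \<phi>: "\<And>x. x \<in> A \<Longrightarrow> \<phi> x \<in> A" "\<And>x y. x \<in> A \<Longrightarrow> y \<in> A \<Longrightarrow> \<phi> (x + y) = \<phi> x + \<phi> y"
      "\<And>x y. x \<in> A \<Longrightarrow> y \<in> A \<Longrightarrow> \<phi> (x * y) = \<phi> x * \<phi> y"
      "\<And>c x. x \<in> A \<Longrightarrow> \<phi> (c *\<^sub>R x) = c *\<^sub>R \<phi> x"
    unfolding computable_star_iso_def star_hom_def algebra_hom_def
    by (auto simp: A_in_B scR_eq[symmetric])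
  have \<phi>_minus: "\<phi> (- x) = - \<phi> x" if "x \<in> A" for x
    using \<phi>(4)[OF that, of "- 1"] by simp
  have \<phi>_diff: "\<phi> (x - y) = \<phi> x - \<phi> y" if "x \<in> A" "y \<in> A" for x y
    using \<phi>(2)[of x "- y"] \<phi>_minus that minus_in_A by simp
  \<comment> \<open>The complex-linear extension of \<phi>. All its properties are checked on real
    and imaginary parts through \<open>eqI\<close>.\<close>
  define \<psi> where "\<psi> z = \<phi> (re z) + j (\<phi> (im z))" for z
  note A_rules = re_in_A im_in_A add_in_A diff_in_A mult_in_A scaleR_in_A minus_in_A
  have \<psi>_in: "\<psi> z \<in> B" if "z \<in> B" for z
    using that by (simp add: \<psi>_def closed_rules A_in_B \<phi>(1) A_rules)
  have re_\<psi>: "re (\<psi> z) = \<phi> (re z)" and im_\<psi>: "im (\<psi> z) = \<phi> (im z)" if "z \<in> B" for z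
    using that by (simp_all add: \<psi>_def re_eq im_eq \<phi>(1) A_rules)
  have eqI: "x = y" if "x \<in> B" "y \<in> B" "re x = re y" "im x = im y" for x y
    by (metis re_im that)
  have hom: "star_hom B sc star B sc star \<psi>"
    unfolding star_hom_def algebra_hom_def
  proof (intro conjI ballI allI)
    fix x y assume xy: "x \<in> B" "y \<in> B"
    show "\<psi> (x + y) = \<psi> x + \<psi> y"
      by (rule eqI; simp add: xy \<psi>_in closed_rules re_\<psi> im_\<psi> re_add im_add \<phi> A_rules)
    show "\<psi> (x * y) = \<psi> x * \<psi> y"
      by (rule eqI; simp add: xy \<psi>_in closed_rules re_\<psi> im_\<psi> re_mult im_mult \<phi> \<phi>_diff A_rules)
  next
    fix x c assume x: "x \<in> B"
    show "\<psi> (sc c x) = sc c (\<psi> x)"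
      by (rule eqI; simp add: x \<psi>_in closed_rules re_\<psi> im_\<psi> re_scale im_scale \<phi> \<phi>_diff A_rules)
  next
    fix x assume x: "x \<in> B"
    show "\<psi> (star x) = star (\<psi> x)"
      by (rule eqI; simp add: x \<psi>_in closed_rules re_\<psi> im_\<psi> re_star im_star \<phi>_minus A_rules)
  qed (simp add: \<psi>_in)
  have "bij_betw \<psi> B B"
    unfolding bij_betw_def
  proof
    show "inj_on \<psi> B"
    proof
      fix x y assume xy: "x \<in> B" "y \<in> B" "\<psi> x = \<psi> y"
      then have "\<phi> (re x) = \<phi> (re y)" "\<phi> (im x) = \<phi> (im y)"
        using re_\<psi> im_\<psi> by metis+
      then have "re x = re y" "im x = im y"
        using bij xy re_in_A im_in_A by (auto simp: bij_betw_def inj_on_def)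
      with xy show "x = y"
        using eqI by blast
    qed
    show "\<psi> ` B = B"
    proof safe
      fix y assume y: "y \<in> B"
      have "re y \<in> \<phi> ` A" "im y \<in> \<phi> ` A"
        using bij y re_in_A im_in_A by (auto simp: bij_betw_def)
      then obtain u v where uv: "u \<in> A" "v \<in> A" "re y = \<phi> u" "im y = \<phi> v"
        by blast
      then have "\<psi> (u + j v) = y"
        using re_im[OF y] by (simp add: \<psi>_def re_eq im_eq)
      then show "y \<in> \<psi> ` B"
        using uv A_in_B closed_rules by (metis imageI)
    qed (simp add: \<psi>_in)
  qed
  moreover have "computable_map (star_codes P) (star_point sc star P) (star_codes Q) (star_point sc star Q) \<psi>"
  proof (rule computable_map_combine[OF map])
    \<comment> \<open>A rational point is first rewritten in the real points of P and only then
      split, because splitting by coefficients requires self-adjoint letters. \<open>?G\<close>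
      rewrites the two answers in the points of Q and forms s + \<i> s'.\<close>
    let ?T1 = "\<lambda>n. Re_code (subst_code to_real_points n)" and ?T2 = "\<lambda>n. Im_code (subst_code to_real_points n)"
    let ?S = "\<lambda>m. subst_code of_real_points (complexify m)"
    let ?G = "\<lambda>m m'. rev_append (?S m) (smult_code (scalar_code \<i>) (?S m'))"
    show "rec_fun1 ?T1" "rec_fun1 ?T2"
      by (intro rec_coeff_codes rec_points_codes rec_proj; simp)+
    show "rec_fun2 ?G"
      by (intro rec_rev_append rec_smult_code rec_const rec_coeff_codes rec_points_codes rec_proj) auto
    show T_in: "?T1 n \<in> star_codes ?P \<and> ?T2 n \<in> star_codes ?P" if "n \<in> star_codes P" for n
      using subst_to_real_points_in[OF that] by (simp add: star_codes_eq)
    have S_in: "?S m \<in> star_codes Q" if "m \<in> star_codes ?Q" for m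
      using that by (intro subst_of_real_points_in) (simp add: star_codes_eq)
    show "?G m m' \<in> star_codes Q" if "m \<in> star_codes ?Q" "m' \<in> star_codes ?Q" for m m'
      using S_in[OF that(1)] S_in[OF that(2)] by (auto simp: star_codes_eq)
    fix n m m' assume n: "n \<in> star_codes P" and m: "m \<in> star_codes ?Q" and m': "m' \<in> star_codes ?Q"
    let ?z = "star_point sc star P n" and ?s = "star_point scR star ?Q m" and ?s' = "star_point scR star ?Q m'"
    have v: "\<forall>y\<in>letters_of_code (subst_code to_real_points n). letter_value star ?P y \<in> A"
      by (rule letter_value_in_A[OF real_points_in_A[OF P_pts] subst_to_real_points_in[OF n]])
    have z: "?z \<in> B"
      unfolding star_point_eq by (rule eval_in_B[OF letter_value_in_B[OF P_pts n]])
    have s: "?s \<in> A" "?s' \<in> A"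
      unfolding star_point_eq by (intro eval_in_A letter_value_in_A real_points_in_A Q_pts m m')+
    have "star_point scR star ?P (?T1 n) = re ?z" "star_point scR star ?P (?T2 n) = im ?z"
      using eval_Re_code[OF v] eval_Im_code[OF v] eval_to_real_points[OF P_pts n] by (simp_all add: star_point_eq)
    moreover have "star_point sc star Q (?G m m') = ?s + j ?s'"
      using letter_value_in_B[OF Q_pts S_in[OF m']] eval_of_real_points[OF Q_pts m] eval_of_real_points[OF Q_pts m']
      by (simp add: star_point_eq eval_rev_append eval_smult_code scalar_of_code_scalar_code j_def)
    \<comment> \<open>The error splits into the errors of the two answers; the triangle inequality
      and isometry of \<open>j\<close> then give the bound.\<close>
    moreover have "\<psi> ?z - (?s + j ?s') = (\<phi> (re ?z) - ?s) + j (\<phi> (im ?z) - ?s')"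
      using s z by (simp add: \<psi>_def j_diff \<phi>(1) A_in_B A_rules)
    ultimately have eq: "\<psi> ?z - star_point sc star Q (?G m m')
        = (\<phi> (star_point scR star ?P (?T1 n)) - ?s) + j (\<phi> (star_point scR star ?P (?T2 n)) - ?s')"
      and im: "star_point scR star ?P (?T2 n) = im ?z"
      by (simp_all only:)
    have "norm (j (\<phi> (star_point scR star ?P (?T2 n)) - ?s')) = norm (\<phi> (star_point scR star ?P (?T2 n)) - ?s')"
      unfolding im by (intro norm_j diff_in A_in_B \<phi>(1) im_in_A z s)
    then show "norm (\<psi> ?z - star_point sc star Q (?G m m'))
        \<le> norm (\<phi> (star_point scR star ?P (?T1 n)) - ?s) + norm (\<phi> (star_point scR star ?P (?T2 n)) - ?s')"
      unfolding eq using norm_triangle_ineq by metis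
  qed
  ultimately show "\<exists>\<phi>. computable_star_iso B sc star P B sc star Q \<phi>"
    using hom unfolding computable_star_iso_def by blast
qed

lemma categorical_B_imp_A:
  assumes B: "computably_categorical_cstar B sc star"
  shows "computably_categorical_cstar A scR star"
  unfolding computably_categorical_cstar_def
proof (intro allI impI, elim conjE)
  fix P Q assume P: "computable_cstar_presentation A scR star P" and Q: "computable_cstar_presentation A scR star Q"
  have P_pts: "\<forall>i. enat i < fst P \<longrightarrow> snd P i \<in> A" and Q_pts: "\<forall>i. enat i < fst Q \<longrightarrow> snd Q i \<in> A"
    using P Q unfolding computable_cstar_presentation_def cstar_presentation_def by blast+
  obtain \<phi> where "computable_star_iso B sc star P B sc star Q \<phi>"
    using B complexified_presentation[OF P] complexified_presentation[OF Q]
    unfolding computably_categorical_cstar_def by blast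
  then have map: "computable_map (star_codes P) (star_point sc star P) (star_codes Q) (star_point sc star Q) \<phi>"
    and bij: "bij_betw \<phi> B B"
    and \<phi>: "\<And>x. x \<in> B \<Longrightarrow> \<phi> x \<in> B" "\<And>x y. x \<in> B \<Longrightarrow> y \<in> B \<Longrightarrow> \<phi> (x + y) = \<phi> x + \<phi> y"
      "\<And>x y. x \<in> B \<Longrightarrow> y \<in> B \<Longrightarrow> \<phi> (x * y) = \<phi> x * \<phi> y"
      "\<And>c x. x \<in> B \<Longrightarrow> \<phi> (sc c x) = sc c (\<phi> x)"
      "\<And>x. x \<in> B \<Longrightarrow> \<phi> (star x) = star (\<phi> x)"
    unfolding computable_star_iso_def star_hom_def algebra_hom_def by auto
  have \<phi>_A: "\<phi> x \<in> A" if "x \<in> A" for x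
    using that \<phi>(1,5) by (metis A_iff)
  have "star_hom A scR star A scR star \<phi>"
    unfolding star_hom_def algebra_hom_def by (simp add: \<phi> \<phi>_A A_in_B)
  moreover have "bij_betw \<phi> A A"
    unfolding bij_betw_def
  proof
    show "inj_on \<phi> A"
      using bij by (auto simp: bij_betw_def inj_on_def A_in_B)
    show "\<phi> ` A = A"
    proof safe
      fix y assume y: "y \<in> A"
      then obtain x where x: "x \<in> B" "\<phi> x = y"
        using bij A_in_B by (metis bij_betw_def imageE)
      \<comment> \<open>A preimage of a self-adjoint element is self-adjoint by injectivity, so
        \<phi> maps A onto A.\<close>
      then have "\<phi> (star x) = \<phi> x"
        using y \<phi>(5) by (simp add: A_iff)
      then have "star x = x"
        using bij x star_closed by (auto simp: bij_betw_def inj_on_def)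
      then show "y \<in> \<phi> ` A"
        using x by (auto simp: A_iff)
    qed (rule \<phi>_A)
  qed
  moreover have "computable_map (star_codes P) (star_point scR star P) (star_codes Q) (star_point scR star Q) \<phi>"
  proof (rule computable_map_reduce[OF map])
    show "rec_fun1 complexify" "rec_fun1 Re_code"
      by (intro rec_coeff_codes rec_proj; simp)+
    show "complexify n \<in> star_codes P" if "n \<in> star_codes P" for n
      using that by (simp add: star_codes_eq)
    show "Re_code m \<in> star_codes Q" if "m \<in> star_codes Q" for m
      using that by (simp add: star_codes_eq)
    fix n m assume n: "n \<in> star_codes P" and m: "m \<in> star_codes Q"
    let ?r = "star_point scR star P n" and ?s = "star_point sc star Q m"
    have v: "\<forall>y\<in>letters_of_code m. letter_value star Q y \<in> A"
      by (rule letter_value_in_A[OF Q_pts m])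
    have r: "?r \<in> A"
      unfolding star_point_eq by (intro eval_in_A letter_value_in_A P_pts n)
    have s: "?s \<in> B"
      unfolding star_point_eq by (rule eval_in_B) (use v A_in_B in blast)
    have "star_point sc star P (complexify n) = ?r" "star_point scR star Q (Re_code m) = re ?s"
      using eval_Re_code[OF v] by (simp_all add: star_point_eq eval_complexify)
    \<comment> \<open>The answer in B is projected to A by \<open>re\<close>. This contraction fixes
      \<phi> r, so the error does not grow.\<close>
    then show "norm (\<phi> ?r - star_point scR star Q (Re_code m)) \<le> norm (\<phi> (star_point sc star P (complexify n)) - ?s)"
      using norm_re_le[of "\<phi> ?r - ?s"] r s \<phi>_A[OF r] by (simp add: re_diff re_A A_in_B diff_in)
  qed
  ultimately show "\<exists>\<phi>. computable_star_iso A scR star P A scR star Q \<phi>"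
    unfolding computable_star_iso_def by blast
qed

text \<open>On \<open>A\<close> the involution is trivial, so codes with and without star letters can be translated
  into each other.\<close>

definition unstar_code :: "nat \<Rightarrow> nat" where
  "unstar_code n = Re_code (subst_code (\<lambda>y. term_code 1 (y div 2)) (complexify n))"

definition star_code :: "nat \<Rightarrow> nat" where
  "star_code n = Re_code (subst_code (\<lambda>i. term_code 1 (2 * i)) (complexify n))"

lemma rec_star_codes: "rec_fun1 unstar_code" "rec_fun1 star_code"
  unfolding unstar_code_def star_code_def
  by (intro rec_coeff_codes rec_subst_code rec_term_code rec_div2 rec_mult rec_const rec_proj; simp)+

lemma unstar_code_in: "n \<in> star_codes P \<Longrightarrow> unstar_code n \<in> plain_codes P"
  using letters_subst_code[of "\<lambda>y. term_code 1 (y div 2)" "complexify n"]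
  by (auto simp: unstar_code_def star_codes_eq plain_codes_def)

lemma star_code_in: "n \<in> plain_codes P \<Longrightarrow> star_code n \<in> star_codes P"
  using letters_subst_code[of "\<lambda>i. term_code 1 (2 * i)" "complexify n"]
  by (fastforce simp: star_code_def star_codes_eq plain_codes_def)

text \<open>Substitution is available for complex coefficients only. The value obtained is
  self-adjoint already, so returning to real coefficients by \<open>Re_code\<close> leaves it
  unchanged.\<close>

lemma eval_Re_subst_code:
  assumes "\<And>y. y \<in> letters_of_code n \<Longrightarrow> eval_code sc v (\<sigma> y) = w y"
    and "\<And>y z. y \<in> letters_of_code n \<Longrightarrow> z \<in> letters_of_code (\<sigma> y) \<Longrightarrow> v z \<in> A"
    and "\<And>y. y \<in> letters_of_code n \<Longrightarrow> w y \<in> A"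
  shows "eval_code scR v (Re_code (subst_code \<sigma> (complexify n))) = eval_code scR w n"
proof -
  have "eval_code scR v (Re_code (subst_code \<sigma> (complexify n))) = re (eval_code sc v (subst_code \<sigma> (complexify n)))"
    by (rule eval_Re_code) (use letters_subst_code[of \<sigma> "complexify n"] assms(2) in auto)
  also have "eval_code sc v (subst_code \<sigma> (complexify n)) = eval_code sc w (complexify n)"
    by (rule eval_subst_code) (use assms A_in_B in auto)
  finally show ?thesis
    using assms(3) by (simp add: eval_complexify re_A eval_in_A)
qed

lemma eval_unstar_code:
  assumes "\<forall>i. enat i < fst P \<longrightarrow> snd P i \<in> A" "n \<in> star_codes P"
  shows "plain_point scR P (unstar_code n) = star_point scR star P n"
  unfolding plain_point_def star_point_eq unstar_code_def
  by (rule eval_Re_subst_code)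
    (use assms in \<open>auto simp: eval_term_code star_codes_eq letter_value_def star_A sc_one A_in_B\<close>)

lemma eval_star_code:
  assumes "\<forall>i. enat i < fst P \<longrightarrow> snd P i \<in> A" "n \<in> plain_codes P"
  shows "star_point scR star P (star_code n) = plain_point scR P n"
  unfolding plain_point_def star_point_eq star_code_def
  by (rule eval_Re_subst_code)
    (use assms in \<open>auto simp: eval_term_code plain_codes_def letter_value_def sc_one A_in_B\<close>)

text \<open>Every subset of A is closed under the trivial involution, so both notions of generation
  quantify over the same subalgebras, and the norm programs are exchanged by translating
  codes.\<close>

lemma cstar_presentation_iff_banach_presentation:
  "computable_cstar_presentation A scR star P \<longleftrightarrow> computable_banach_presentation A scR P"
proof -
  have "cstar_presentation A scR star P \<longleftrightarrow> banach_presentation A scR P"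
  proof -
    have "(\<forall>x\<in>S. star x \<in> S)" if "S \<subseteq> A" for S
      using that star_A by auto
    moreover have "banach_algebra_on A scR"
      using banach_star_algebra_A by (simp add: banach_star_algebra_on_def)
    ultimately show ?thesis
      unfolding cstar_presentation_def banach_presentation_def using cstar_algebra_A by blast
  qed
  moreover have "computable_norm (star_codes P) (star_point scR star P)
      \<longleftrightarrow> computable_norm (plain_codes P) (plain_point scR P)"
    if pts: "\<forall>i. enat i < fst P \<longrightarrow> snd P i \<in> A"
  proof
    assume "computable_norm (star_codes P) (star_point scR star P)"
    then show "computable_norm (plain_codes P) (plain_point scR P)"
      by (rule computable_norm_reduce[OF _ rec_star_codes(2)]) (simp add: star_code_in eval_star_code[OF pts])
  next
    assume "computable_norm (plain_codes P) (plain_point scR P)"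
    then show "computable_norm (star_codes P) (star_point scR star P)"
      by (rule computable_norm_reduce[OF _ rec_star_codes(1)]) (simp add: unstar_code_in eval_unstar_code[OF pts])
  qed
  ultimately show ?thesis
    unfolding computable_cstar_presentation_def computable_banach_presentation_def
    by (meson banach_presentation_def)
qed

text \<open>Preservation of the involution is automatic on A. The isometry demanded of a Banach
  algebra isomorphism comes from \<open>algebra_iso_isometric\<close>.\<close>

lemma star_iso_iff_banach_iso:
  assumes P: "\<forall>i. enat i < fst P \<longrightarrow> snd P i \<in> A" and Q: "\<forall>i. enat i < fst Q \<longrightarrow> snd Q i \<in> A"
  shows "computable_star_iso A scR star P A scR star Q \<phi> \<longleftrightarrow> computable_banach_iso A scR P A scR Q \<phi>"
proof -
  have "star_hom A scR star A scR star \<phi> \<longleftrightarrow> algebra_hom A scR A scR \<phi>"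
    unfolding star_hom_def algebra_hom_def by (auto simp: star_A)
  moreover have "computable_map (star_codes P) (star_point scR star P) (star_codes Q) (star_point scR star Q) \<phi>
      \<longleftrightarrow> computable_map (plain_codes P) (plain_point scR P) (plain_codes Q) (plain_point scR Q) \<phi>"
  proof
    assume "computable_map (star_codes P) (star_point scR star P) (star_codes Q) (star_point scR star Q) \<phi>"
    then show "computable_map (plain_codes P) (plain_point scR P) (plain_codes Q) (plain_point scR Q) \<phi>"
      by (rule computable_map_reduce[OF _ rec_star_codes(2,1)])
        (simp_all add: star_code_in unstar_code_in eval_star_code[OF P] eval_unstar_code[OF Q])
  next
    assume "computable_map (plain_codes P) (plain_point scR P) (plain_codes Q) (plain_point scR Q) \<phi>"
    then show "computable_map (star_codes P) (star_point scR star P) (star_codes Q) (star_point scR star Q) \<phi>"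
      by (rule computable_map_reduce[OF _ rec_star_codes(1,2)])
        (simp_all add: star_code_in unstar_code_in eval_star_code[OF Q] eval_unstar_code[OF P])
  qed
  ultimately show ?thesis
    unfolding computable_star_iso_def computable_banach_iso_def using algebra_iso_isometric by blast
qed

lemma categorical_cstar_iff_banach:
  "computably_categorical_cstar A scR star \<longleftrightarrow> computably_categorical_banach A scR"
proof -
  have "(\<exists>\<phi>. computable_star_iso A scR star P A scR star Q \<phi>) \<longleftrightarrow> (\<exists>\<phi>. computable_banach_iso A scR P A scR Q \<phi>)"
    if "computable_banach_presentation A scR P" "computable_banach_presentation A scR Q" for P Q
    using star_iso_iff_banach_iso[of P Q] that
    unfolding computable_banach_presentation_def banach_presentation_def by blast
  then show ?thesis
    unfolding computably_categorical_cstar_def computably_categorical_banach_def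
      cstar_presentation_iff_banach_presentation by blast
qed

end

theorem theorem4p5:
  fixes B A :: "'b::real_normed_algebra set"
    and scC :: "complex \<Rightarrow> 'b \<Rightarrow> 'b"
    and scR :: "real \<Rightarrow> 'b \<Rightarrow> 'b"
    and star :: "'b \<Rightarrow> 'b"
  assumes B: "cstar_algebra B scC star"
    and abelian: "\<forall>x\<in>B. \<forall>y\<in>B. x * y = y * x"
    and presented: "\<exists>P. computable_cstar_presentation B scC star P"
    and A_def: "A = {x \<in> B. star x = x}"
    and scR_def: "scR = (\<lambda>r. scC (complex_of_real r))"
  shows "cstar_algebra A scR star
    \<and> (\<forall>P. computable_cstar_presentation A scR star P \<longrightarrow>
           computable_cstar_presentation B scC star P)
    \<and> (computably_categorical_cstar B scC star \<longleftrightarrow> computably_categorical_cstar A scR star)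
    \<and> (computably_categorical_cstar A scR star \<longleftrightarrow> computably_categorical_banach A scR)"
proof -
  interpret BA: banach_star_algebra_on B scC star
    using B by (simp add: cstar_algebra_def)
  interpret AC: abelian_cstar_algebra B scC star
    by unfold_locales (use B abelian in auto)
  have "A = AC.A"
    by (simp add: A_def AC.A_def)
  then show ?thesis
    unfolding scR_def
    using AC.cstar_algebra_A AC.complexified_presentation AC.categorical_A_imp_B AC.categorical_B_imp_A
      AC.categorical_cstar_iff_banach by blast
qed

end
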